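(* Let $M=G/H$, $G$ compact, be a naturally reductive homogeneous space with a homogeneous spin structure, and let $t\in\mathbb R$. If the operator $\Omega_{\mathfrak g}$ is non-negative and $\nabla^t$ is not the Levi-Civita connection, then there do not exist any non-trivial spinor fields $\psi$ solving the system of equations $$\nabla^t\psi=0,\qquad T^t\cdot\psi=0 .$$
   Context: Setting. $M=G/H$ is a Riemannian homogeneous space of dimension $n$, reductive: $\mathfrak g=\mathfrak h\oplus\mathfrak m$ with $\mathrm{Ad}(H)\mathfrak m\subset\mathfrak m$; $\mathfrak m$ is identified with the tangent space at the base point and $\langle\,,\rangle$ is the inner product on $\mathfrak m$ induced by the metric. The subscript $\mathfrak m$ denotes the component in $\mathfrak m$. The metric is naturally reductive: $\langle[X,Y]_{\mathfrak m},Z\rangle+\langle Y,[X,Z]_{\mathfrak m}\rangle=0$ for all $X,Y,Z\in\mathfrak m$. It is assumed that $\mathfrak g=\mathfrak m+[\mathfrak m,\mathfrak m]$, and $Q$ denotes the $\mathrm{Ad}(G)$-invariant, symmetric, non-degenerate bilinear form on $\mathfrak g$ (not necessarily positive definite) with $Q(\mathfrak h,\mathfrak m)=0$ and $Q|_{\mathfrak m}=\langle\,,\rangle$. $Z_1,\dots,Z_n$ is an orthonormal basis of $\mathfrak m$. Spinors. The Clifford algebra $\mathcal C(\mathfrak m)$ has relations $Z_i\cdot Z_j+Z_j\cdot Z_i=-2\delta_{ij}$. A homogeneous spin structure is a lift $\widetilde{\mathrm{Ad}}:H\to\mathrm{Spin}(\mathfrak m)$ of the isotropy representation; $\widetilde{\mathrm{ad}}:\mathfrak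 h\to\mathfrak{spin}(\mathfrak m)\subset\mathcal C(\mathfrak m)$ is its differential, $\widetilde{\mathrm{ad}}(Y)=\frac14\sum_{i,j}\langle[Y,Z_i],Z_j\rangle Z_i\cdot Z_j$; $\kappa:\mathrm{Spin}(\mathfrak m)\to\mathrm{GL}(\Delta_{\mathfrak m})$ is the spin representation. Spinor fields are smooth maps $\psi:G\to\Delta_{\mathfrak m}$ with $\psi(gh)=\kappa(\widetilde{\mathrm{Ad}}(h^{-1}))\psi(g)$ for $g\in G$, $h\in H$, i.e. sections of $S=G\times_{\widetilde{\mathrm{Ad}}}\Delta_{\mathfrak m}$. $X(\psi)$ is the derivative of $\psi$ along the left invariant vector field induced by $X$. Connections and operators. $\nabla^t$ is the $G$-invariant metric connection $\nabla^t_XY=\nabla^0_XY+t[X,Y]_{\mathfrak m}$, $\nabla^0$ the canonical connection; on spinor fields $\nabla^t_Z\psi=Z(\psi)+\frac t4\sum_{j,k}\langle[Z,Z_j]_{\mathfrak m},Z_k\rangle Z_j\cdot Z_k\cdot\psi$. Its torsion $3$-form acts by Clifford multiplication as $T^t=(2t-1)\sum_{i<j<k}\langle[Z_i,Z_j]_{\mathfrak m},Z_k\rangle Z_i\cdot Z_j\cdot Z_k$. With $\widetilde C_{\mathfrak h}=-\sum_i\widetilde{\mathrm{ad}}(X_i)\cdot\widetilde{\mathrm{ad}}(Y_i)\in\mathcal C(\mathfrak m)$, where $X_i,Y_i$ are bases of $\mathfrak h$ with $Q(X_i,Y_j)=\delta_{ij}$, one sets $\Omega_{\mathfrak g}(\psi)=-\sum_iZ_i^2(\psi)+\widetilde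 C_{\mathfrak h}\cdot\psi$. "Non-negative" means that all eigenvalues of $\Omega_{\mathfrak g}$ on $L^2(S)$ are $\geq0$. *)

theory Defs
  imports "HOL-Analysis.Analysis" "HOL-Algebra.Group"
begin

subsection \<open>Smooth maps and Lie groups\<close>

(* C^k and C^infinity on an open subset S of a Euclidean space. *)
primrec Ck_on :: "nat \<Rightarrow> 'a::euclidean_space set \<Rightarrow> ('a \<Rightarrow> 'b::real_normed_vector) \<Rightarrow> bool" where
  "Ck_on 0 S f \<longleftrightarrow> continuous_on S f"
| "Ck_on (Suc k) S f \<longleftrightarrow>
     (\<forall>x\<in>S. f differentiable (at x)) \<and>
     (\<forall>v. Ck_on k S (\<lambda>x. frechet_derivative f (at x) v))"

definition smooth_on :: "'a::euclidean_space set \<Rightarrow> ('a \<Rightarrow> 'b::real_normed_vector) \<Rightarrow> bool" where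
  "smooth_on S f \<longleftrightarrow> (\<forall>k. Ck_on k S f)"

(* A chart is a pair (domain, coordinate map).  The chosen chart id_chart around the
   identity serves to identify the tangent space at the identity, i.e. the Lie algebra,
   with the model space 'e. *)
record ('g, 'e) liegroup = "'g monoid" +
  atlas :: "('g set \<times> ('g \<Rightarrow> 'e)) set"
  id_chart :: "'g set \<times> ('g \<Rightarrow> 'e)"

locale lie_group = group G
  for G :: "('g::{t2_space,second_countable_topology}, 'e::euclidean_space, 'z) liegroup_scheme"
      (structure) +
  assumes carrier_UNIV: "carrier G = UNIV"
    and chart: "(U, \<phi>) \<in> atlas G \<Longrightarrow>
      open U \<and> open (\<phi> ` U) \<and> homeomorphism U (\<phi> ` U) \<phi> (inv_into U \<phi>)"
    and cover: "(\<Union>(U, \<phi>)\<in>atlas G. U) = UNIV"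
    and transition: "\<lbrakk>(U, \<phi>) \<in> atlas G; (V, \<eta>) \<in> atlas G\<rbrakk> \<Longrightarrow>
      smooth_on (\<phi> ` (U \<inter> V)) (\<lambda>u. \<eta> (inv_into U \<phi> u))"
    and chart_at_one: "id_chart G \<in> atlas G" "\<one> \<in> fst (id_chart G)"
    and mult_continuous: "continuous_on UNIV (\<lambda>(a, b). a \<otimes> b)"
    and mult_smooth: "\<lbrakk>(U, \<phi>) \<in> atlas G; (V, \<eta>) \<in> atlas G; (W, \<omega>) \<in> atlas G\<rbrakk> \<Longrightarrow>
      smooth_on {(u, v). u \<in> \<phi> ` U \<and> v \<in> \<eta> ` V \<and> inv_into U \<phi> u \<otimes> inv_into V \<eta> v \<in> W}
        (\<lambda>(u, v). \<omega> (inv_into U \<phi> u \<otimes> inv_into V \<eta> v))"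
    and inv_continuous: "continuous_on UNIV (\<lambda>a. inv a)"
    and inv_smooth: "\<lbrakk>(U, \<phi>) \<in> atlas G; (W, \<omega>) \<in> atlas G\<rbrakk> \<Longrightarrow>
      smooth_on {u. u \<in> \<phi> ` U \<and> inv (inv_into U \<phi> u) \<in> W} (\<lambda>u. \<omega> (inv (inv_into U \<phi> u)))"

definition smooth_map ::
  "('g, 'e::euclidean_space, 'z) liegroup_scheme \<Rightarrow> ('g \<Rightarrow> 'b::real_normed_vector) \<Rightarrow> bool" where
  "smooth_map G f \<longleftrightarrow> (\<forall>(U, \<phi>)\<in>atlas G. smooth_on (\<phi> ` U) (\<lambda>u. f (inv_into U \<phi> u)))"

definition coord :: "('g, 'e, 'z) liegroup_scheme \<Rightarrow> 'g \<Rightarrow> 'e" where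
  "coord G = snd (id_chart G)"

definition param :: "('g, 'e, 'z) liegroup_scheme \<Rightarrow> 'e \<Rightarrow> 'g" where
  "param G = inv_into (fst (id_chart G)) (snd (id_chart G))"

(* X(f)(a): derivative of f at a along the left invariant vector field induced by X. *)
definition lderiv ::
  "('g, 'e::euclidean_space, 'z) liegroup_scheme \<Rightarrow> 'e \<Rightarrow> ('g \<Rightarrow> 'b::real_normed_vector) \<Rightarrow> 'g \<Rightarrow> 'b" where
  "lderiv G X f a =
     frechet_derivative (\<lambda>v. f (a \<otimes>\<^bsub>G\<^esub> param G v)) (at (coord G \<one>\<^bsub>G\<^esub>)) X"

(* Ad(a): differential at the identity of conjugation by a. *)
definition Ad :: "('g, 'e::euclidean_space, 'z) liegroup_scheme \<Rightarrow> 'g \<Rightarrow> 'e \<Rightarrow> 'e" where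
  "Ad G a X = frechet_derivative
     (\<lambda>v. coord G (a \<otimes>\<^bsub>G\<^esub> param G v \<otimes>\<^bsub>G\<^esub> inv\<^bsub>G\<^esub> a)) (at (coord G \<one>\<^bsub>G\<^esub>)) X"

(* [X,Y] = ad(X)Y, where ad is the differential of Ad at the identity. *)
definition bracket :: "('g, 'e::euclidean_space, 'z) liegroup_scheme \<Rightarrow> 'e \<Rightarrow> 'e \<Rightarrow> 'e" where
  "bracket G X Y = frechet_derivative (\<lambda>v. Ad G (param G v) Y) (at (coord G \<one>\<^bsub>G\<^esub>)) X"

(* Lie algebra of a closed subgroup H: initial velocities of the one-parameter subgroups
   of G that stay in H. *)
definition lie_sub :: "('g::topological_space, 'e::euclidean_space, 'z) liegroup_scheme \<Rightarrow> 'g set \<Rightarrow> 'e set" where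
  "lie_sub G H = {X. \<exists>\<gamma> :: real \<Rightarrow> 'g. continuous_on UNIV \<gamma> \<and>
     (\<forall>s u. \<gamma> (s + u) = \<gamma> s \<otimes>\<^bsub>G\<^esub> \<gamma> u) \<and> range \<gamma> \<subseteq> H \<and>
     ((\<lambda>s. coord G (\<gamma> s)) has_vector_derivative X) (at 0)}"


subsection \<open>Naturally reductive homogeneous spaces\<close>

(* Data of M = G/H.  Only the values of ip on the complement mm are relevant; Zb 1, ..., Zb dim_m
   is an orthonormal basis of mm, and Xb, Yb (indices 1, ..., dim_h) are bases of the Lie algebra
   of H which are dual with respect to Qf. *)
record ('g, 'e) homogeneous =
  Grp :: "('g, 'e) liegroup"
  Sub :: "'g set"
  mm :: "'e set"
  ip :: "'e \<Rightarrow> 'e \<Rightarrow> real"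
  Qf :: "'e \<Rightarrow> 'e \<Rightarrow> real"
  dim_m :: nat
  Zb :: "nat \<Rightarrow> 'e"
  dim_h :: nat
  Xb :: "nat \<Rightarrow> 'e"
  Yb :: "nat \<Rightarrow> 'e"

definition hh :: "('g::topological_space, 'e::euclidean_space, 'z) homogeneous_scheme \<Rightarrow> 'e set" where
  "hh M = lie_sub (Grp M) (Sub M)"

definition brm :: "('g::topological_space, 'e::euclidean_space, 'z) homogeneous_scheme \<Rightarrow> 'e \<Rightarrow> 'e \<Rightarrow> 'e" where
  "brm M X Y = (THE W. W \<in> mm M \<and> bracket (Grp M) X Y - W \<in> hh M)"

locale naturally_reductive =
  fixes M :: "('g::{t2_space,second_countable_topology}, 'e::euclidean_space, 'z) homogeneous_scheme"
  assumes lie_group: "lie_group (Grp M)"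
    and subgroup: "subgroup (Sub M) (Grp M)" "closed (Sub M)"
    and reductive: "subspace (mm M)" "hh M \<inter> mm M = {0}" "{X + Y |X Y. X \<in> hh M \<and> Y \<in> mm M} = UNIV"
      "\<lbrakk>a \<in> Sub M; X \<in> mm M\<rbrakk> \<Longrightarrow> Ad (Grp M) a X \<in> mm M"
    and ip_inner_product:
      "\<lbrakk>X \<in> mm M; Y \<in> mm M\<rbrakk> \<Longrightarrow> ip M X Y = ip M Y X"
      "\<lbrakk>X \<in> mm M; Y \<in> mm M; W \<in> mm M\<rbrakk> \<Longrightarrow> ip M (X + Y) W = ip M X W + ip M Y W"
      "\<lbrakk>X \<in> mm M; Y \<in> mm M\<rbrakk> \<Longrightarrow> ip M (c *\<^sub>R X) Y = c * ip M X Y"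
      "\<lbrakk>X \<in> mm M; X \<noteq> 0\<rbrakk> \<Longrightarrow> ip M X X > 0"
    and ip_invariant: "\<lbrakk>a \<in> Sub M; X \<in> mm M; Y \<in> mm M\<rbrakk> \<Longrightarrow>
      ip M (Ad (Grp M) a X) (Ad (Grp M) a Y) = ip M X Y"
    and nat_reductive: "\<lbrakk>X \<in> mm M; Y \<in> mm M; W \<in> mm M\<rbrakk> \<Longrightarrow>
      ip M (brm M X Y) W + ip M Y (brm M X W) = 0"
    and generated: "{X + Y |X Y. X \<in> mm M \<and>
      Y \<in> span {bracket (Grp M) A B |A B. A \<in> mm M \<and> B \<in> mm M}} = UNIV"
    and Q_form: "bilinear (Qf M)" "Qf M X Y = Qf M Y X" "(\<And>Y. Qf M X Y = 0) \<Longrightarrow> X = 0"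
      "Qf M (Ad (Grp M) a X) (Ad (Grp M) a Y) = Qf M X Y"
    and Q_h_m: "\<lbrakk>X \<in> hh M; Y \<in> mm M\<rbrakk> \<Longrightarrow> Qf M X Y = 0"
    and Q_m: "\<lbrakk>X \<in> mm M; Y \<in> mm M\<rbrakk> \<Longrightarrow> Qf M X Y = ip M X Y"
    and Z_basis: "span (Zb M ` {1..dim_m M}) = mm M"
      "\<lbrakk>i \<in> {1..dim_m M}; j \<in> {1..dim_m M}\<rbrakk> \<Longrightarrow> ip M (Zb M i) (Zb M j) = (if i = j then 1 else 0)"
    and XY_bases: "span (Xb M ` {1..dim_h M}) = hh M" "span (Yb M ` {1..dim_h M}) = hh M"
      "\<lbrakk>i \<in> {1..dim_h M}; j \<in> {1..dim_h M}\<rbrakk> \<Longrightarrow> Qf M (Xb M i) (Yb M j) = (if i = j then 1 else 0)"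

(* Vector fields on M as sections of the bundle associated with the isotropy representation,
   smooth functions on M as right H-invariant functions on G. *)
definition vector_field ::
  "('g::topological_space, 'e::euclidean_space, 'z) homogeneous_scheme \<Rightarrow> ('g \<Rightarrow> 'e) \<Rightarrow> bool" where
  "vector_field M Y \<longleftrightarrow> smooth_map (Grp M) Y \<and> (\<forall>a. Y a \<in> mm M) \<and>
     (\<forall>a. \<forall>h\<in>Sub M. Y (a \<otimes>\<^bsub>Grp M\<^esub> h) = Ad (Grp M) (inv\<^bsub>Grp M\<^esub> h) (Y a))"

definition smooth_function ::
  "('g::topological_space, 'e::euclidean_space, 'z) homogeneous_scheme \<Rightarrow> ('g \<Rightarrow> real) \<Rightarrow> bool" where
  "smooth_function M f \<longleftrightarrow> smooth_map (Grp M) f \<and> (\<forall>a. \<forall>h\<in>Sub M. f (a \<otimes>\<^bsub>Grp M\<^esub> h) = f a)"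

(* Derivative of a map on G along the vector field X. *)
definition vderiv ::
  "('g::topological_space, 'e::euclidean_space, 'z) homogeneous_scheme \<Rightarrow> ('g \<Rightarrow> 'e) \<Rightarrow>
     ('g \<Rightarrow> 'b::real_normed_vector) \<Rightarrow> 'g \<Rightarrow> 'b" where
  "vderiv M X f a = lderiv (Grp M) (X a) f a"

(* The canonical connection is X(Y). *)
definition nabla ::
  "('g::topological_space, 'e::euclidean_space, 'z) homogeneous_scheme \<Rightarrow> real \<Rightarrow>
     ('g \<Rightarrow> 'e) \<Rightarrow> ('g \<Rightarrow> 'e) \<Rightarrow> 'g \<Rightarrow> 'e" where
  "nabla M t X Y a = vderiv M X Y a + t *\<^sub>R brm M (X a) (Y a)"

(* Metric and torsion-free; torsion-freeness D X Y - D Y X = [X,Y] (the commutator of vector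
   fields on M) is expressed by the action on smooth functions on M. *)
definition is_levi_civita ::
  "('g::topological_space, 'e::euclidean_space, 'z) homogeneous_scheme \<Rightarrow>
     (('g \<Rightarrow> 'e) \<Rightarrow> ('g \<Rightarrow> 'e) \<Rightarrow> 'g \<Rightarrow> 'e) \<Rightarrow> bool" where
  "is_levi_civita M D \<longleftrightarrow>
     (\<forall>X Y W. vector_field M X \<and> vector_field M Y \<and> vector_field M W \<longrightarrow>
        (\<forall>a. vderiv M X (\<lambda>b. ip M (Y b) (W b)) a = ip M (D X Y a) (W a) + ip M (Y a) (D X W a))) \<and>
     (\<forall>X Y f. vector_field M X \<and> vector_field M Y \<and> smooth_function M f \<longrightarrow>
        (\<forall>a. vderiv M (\<lambda>b. D X Y b - D Y X b) f a =
              vderiv M X (vderiv M Y f) a - vderiv M Y (vderiv M X f) a))"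


subsection \<open>Homogeneous spin structures\<close>

(* cl embeds mm into its Clifford algebra 'c, lift is the homomorphism from H to Spin(mm), and
   rep is an irreducible complex representation of the Clifford algebra, whose restriction to
   Spin(mm) is the spin representation. *)
record ('g, 'e, 'c, 's) spin_homogeneous = "('g, 'e) homogeneous" +
  cl :: "'e \<Rightarrow> 'c"
  lift :: "'g \<Rightarrow> 'c"
  rep :: "'c \<Rightarrow> complex^'s^'s"

definition cl_monomial :: "('g, 'e, 'c::monoid_mult, 's::finite, 'z) spin_homogeneous_scheme \<Rightarrow> nat set \<Rightarrow> 'c" where
  "cl_monomial M A = prod_list (map (\<lambda>i. cl M (Zb M i)) (sorted_list_of_set A))"

definition Spin :: "('g, 'e, 'c::monoid_mult, 's::finite, 'z) spin_homogeneous_scheme \<Rightarrow> 'c set" where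
  "Spin M = {prod_list (map (cl M) vs) |vs. even (length vs) \<and>
     (\<forall>v\<in>set vs. v \<in> mm M \<and> ip M v v = 1)}"

(* The Clifford algebra is characterised by the Clifford relations together with the ordered
   monomials in Z_1, ..., Z_n forming a basis.  In lift_covers, Spin(mm) acts on mm by
   v -> x v x^(-1). *)
locale naturally_reductive_spin = naturally_reductive M
  for M :: "('g::{t2_space,second_countable_topology}, 'e::euclidean_space,
     'c::real_normed_algebra_1, 's::finite, 'z) spin_homogeneous_scheme" +
  assumes cl_linear:
      "\<lbrakk>X \<in> mm M; Y \<in> mm M\<rbrakk> \<Longrightarrow> cl M (X + Y) = cl M X + cl M Y"
      "X \<in> mm M \<Longrightarrow> cl M (c *\<^sub>R X) = c *\<^sub>R cl M X"
    and cl_relations: "\<lbrakk>X \<in> mm M; Y \<in> mm M\<rbrakk> \<Longrightarrow>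
      cl M X * cl M Y + cl M Y * cl M X = of_real (- 2 * ip M X Y)"
    and cl_basis: "inj_on (cl_monomial M) (Pow {1..dim_m M})"
      "independent (cl_monomial M ` Pow {1..dim_m M})"
      "span (cl_monomial M ` Pow {1..dim_m M}) = UNIV"
    and lift_Spin: "a \<in> Sub M \<Longrightarrow> lift M a \<in> Spin M"
    and lift_hom: "\<lbrakk>a \<in> Sub M; b \<in> Sub M\<rbrakk> \<Longrightarrow> lift M (a \<otimes>\<^bsub>Grp M\<^esub> b) = lift M a * lift M b"
    and lift_continuous: "continuous_on (Sub M) (lift M)"
    and lift_covers: "\<lbrakk>a \<in> Sub M; v \<in> mm M\<rbrakk> \<Longrightarrow>
      lift M a * cl M v = cl M (Ad (Grp M) a v) * lift M a"
    and rep_hom: "linear (rep M)" "rep M 1 = mat 1" "rep M (x * y) = rep M x ** rep M y"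
    and rep_irreducible: "\<lbrakk>vec.subspace W; \<And>x w. w \<in> W \<Longrightarrow> rep M x *v w \<in> W\<rbrakk> \<Longrightarrow>
      W = {0} \<or> W = UNIV"

definition spinor_field ::
  "('g, 'e::euclidean_space, 'c, 's::finite, 'z) spin_homogeneous_scheme \<Rightarrow> ('g \<Rightarrow> complex^'s) \<Rightarrow> bool" where
  "spinor_field M \<psi> \<longleftrightarrow> smooth_map (Grp M) \<psi> \<and>
     (\<forall>a. \<forall>h\<in>Sub M. \<psi> (a \<otimes>\<^bsub>Grp M\<^esub> h) = rep M (lift M (inv\<^bsub>Grp M\<^esub> h)) *v \<psi> a)"

definition nabla_spinor ::
  "('g::topological_space, 'e::euclidean_space, 'c::real_algebra_1, 's::finite, 'z) spin_homogeneous_scheme \<Rightarrow>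
     real \<Rightarrow> 'e \<Rightarrow> ('g \<Rightarrow> complex^'s) \<Rightarrow> 'g \<Rightarrow> complex^'s" where
  "nabla_spinor M t W \<psi> a = lderiv (Grp M) W \<psi> a +
     rep M ((t / 4) *\<^sub>R (\<Sum>j=1..dim_m M. \<Sum>k=1..dim_m M.
       ip M (brm M W (Zb M j)) (Zb M k) *\<^sub>R (cl M (Zb M j) * cl M (Zb M k)))) *v \<psi> a"

definition torsion ::
  "('g::topological_space, 'e::euclidean_space, 'c::real_algebra_1, 's::finite, 'z) spin_homogeneous_scheme \<Rightarrow>
     real \<Rightarrow> 'c" where
  "torsion M t = (2 * t - 1) *\<^sub>R
     (\<Sum>(i, j, k)\<in>{(i, j, k). 1 \<le> i \<and> i < j \<and> j < k \<and> k \<le> dim_m M}.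
        ip M (brm M (Zb M i) (Zb M j)) (Zb M k) *\<^sub>R
          (cl M (Zb M i) * cl M (Zb M j) * cl M (Zb M k)))"

(* Differential of lift; for Y in the Lie algebra of H, [Y,Z_i] lies in mm. *)
definition ad_spin ::
  "('g::topological_space, 'e::euclidean_space, 'c::real_algebra_1, 's::finite, 'z) spin_homogeneous_scheme \<Rightarrow>
     'e \<Rightarrow> 'c" where
  "ad_spin M Y = (1 / 4) *\<^sub>R (\<Sum>i=1..dim_m M. \<Sum>j=1..dim_m M.
     ip M (bracket (Grp M) Y (Zb M i)) (Zb M j) *\<^sub>R (cl M (Zb M i) * cl M (Zb M j)))"

definition casimir_h ::
  "('g::topological_space, 'e::euclidean_space, 'c::real_algebra_1, 's::finite, 'z) spin_homogeneous_scheme \<Rightarrow> 'c" where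
  "casimir_h M = - (\<Sum>i=1..dim_h M. ad_spin M (Xb M i) * ad_spin M (Yb M i))"

definition Omega ::
  "('g::topological_space, 'e::euclidean_space, 'c::real_algebra_1, 's::finite, 'z) spin_homogeneous_scheme \<Rightarrow>
     ('g \<Rightarrow> complex^'s) \<Rightarrow> 'g \<Rightarrow> complex^'s" where
  "Omega M \<psi> a =
     - (\<Sum>i=1..dim_m M. lderiv (Grp M) (Zb M i) (lderiv (Grp M) (Zb M i) \<psi>) a) + rep M (casimir_h M) *v \<psi> a"

(* Omega is elliptic, so for compact G its L2 eigensections are smooth spinor fields. *)
definition Omega_nonneg ::
  "('g::topological_space, 'e::euclidean_space, 'c::real_algebra_1, 's::finite, 'z) spin_homogeneous_scheme \<Rightarrow> bool" where
  "Omega_nonneg M \<longleftrightarrow>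
     (\<forall>(\<mu>::complex) \<psi>. spinor_field M \<psi> \<and> \<psi> \<noteq> (\<lambda>_. 0) \<and> (\<forall>a. Omega M \<psi> a = \<mu> *s \<psi> a) \<longrightarrow>
        Im \<mu> = 0 \<and> Re \<mu> \<ge> 0)"

end

theory Submission
  imports Defs
begin

text \<open>
  Write \<open>T\<close> for the Clifford element of the three-form \<open>\<langle>[X,Y]\<^sub>m, Z\<rangle>\<close>, \<open>t\<^sub>i\<close> for its (rescaled) contractions
  with the \<open>Z\<^sub>i\<close>, and \<open>\<psi>\<close> for a nontrivial solution. The connection is the Levi-Civita connection if
  \<open>t = 1/2\<close> or the form vanishes, so one may assume \<open>T \<psi> = 0\<close> and has to show that the form vanishes.

  If \<open>t \<noteq> 0\<close>, differentiating \<open>T \<psi> = 0\<close> along the parallel \<open>\<psi>\<close> gives \<open>T t\<^sub>i \<psi> = 0\<close>. As \<open>Z\<^sub>i T + T Z\<^sub>i\<close> is a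
  multiple of \<open>t\<^sub>i\<close>, the sum of the \<open>t\<^sub>i\<^sup>2\<close> kills \<open>\<psi>\<close>; since \<open>T\<^sup>2\<close> is a combination of this sum and of the
  square norm of the form, that norm is zero.

  If \<open>t = 0\<close>, then \<open>\<psi>\<close> is locally constant, hence annihilated by the spin representation of \<open>h\<close>, and the
  algebraic Bianchi identity yields equality of the traces of the Casimir operators of the adjoint
  representations of \<open>g\<close> and \<open>h\<close> (with respect to \<open>Q\<close>). Multiplying \<open>\<psi>\<close> with the vector fields
  \<open>(Ad(b\<^sup>-\<^sup>1) W)\<^sub>m\<close>, for \<open>W\<close> an eigenvector of the Casimir operator, gives eigensections of \<open>\<Omega>\<close>; non-negativity
  thus makes \<open>Q\<close> positive on \<open>[g,g]\<close>. Both traces are then sums of squares of structure constants, so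
  \<open>[g,g] \<subseteq> h\<close> and the form vanishes.
\<close>

subsection \<open>Calculus of smooth maps\<close>

text \<open>For t = 0 the spinor has no horizontal derivative, so differentiating T psi = 0 yields
  nothing. Write q for the sum over i, j, a of Q(X_a,[Z_i,Z_j]) Q(Y_a,[Z_i,Z_j]) and C2 for the
  square norm of the form. The tensor Q([Z_i,Z_j],[Z_k,Z_l]) has the symmetries of a curvature
  tensor, Jacobi being its Bianchi identity, so its Clifford contraction is the scalar -2 (q + C2).
  As the Casimir element of h kills psi, this scalar is the value of the sum of the t_i^2 on psi.
  Inserted into T6^2 = -9 (sum of t_i^2) - 12 C2, it gives 3 q + C2 = 0, and 3 q + C2 is exactly the
  difference of the two traces. The obstacle is that Q may be indefinite on h, so q has no sign a
  priori. Compactness supplies an Ad-invariant positive form B; with it the Killing form is negative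
  semidefinite with kernel the centre. Relative to the Killing form the sign of Q on the derived
  algebra is the sign of the eigenvalues of the Casimir operator, and these are what the
  eigensections of Omega control.\<close>

lemma Ck_on_subset: "Ck_on k T f \<Longrightarrow> S \<subseteq> T \<Longrightarrow> Ck_on k S f"
  by (induction k arbitrary: f) (auto intro: continuous_on_subset)

lemma Ck_on_Suc_imp: "Ck_on (Suc k) S f \<Longrightarrow> Ck_on k S f"
proof (induction k arbitrary: f)
  case 0
  then show ?case
    by (auto intro!: continuous_at_imp_continuous_on differentiable_imp_continuous_within)
next
  case (Suc k)
  then show ?case by simp
qed

lemma Ck_on_cong_imp:
  assumes "open S" "\<And>x. x \<in> S \<Longrightarrow> f x = g x" "Ck_on k S f"
  shows "Ck_on k S g"
  using assms(2,3)
proof (induction k arbitrary: f g)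
  case 0
  then show ?case using continuous_on_cong[of S S f g] by auto
next
  case (Suc k)
  have d: "(g has_derivative frechet_derivative f (at x)) (at x)" if "x \<in> S" for x
  proof (rule has_derivative_transform_within_open)
    show "(f has_derivative frechet_derivative f (at x)) (at x)"
      using Suc.prems(2) that frechet_derivative_works by auto
  qed (use assms(1) that Suc.prems(1) in auto)
  have e: "frechet_derivative f (at x) = frechet_derivative g (at x)" if "x \<in> S" for x
    using frechet_derivative_at[OF d[OF that]] by simp
  show ?case
  proof (simp, intro conjI ballI allI)
    show "g differentiable at x" if "x \<in> S" for x using d[OF that] unfolding differentiable_def by blast
    show "Ck_on k S (\<lambda>x. frechet_derivative g (at x) v)" for v
      by (rule Suc.IH[of "\<lambda>x. frechet_derivative f (at x) v"]) (use Suc.prems(2) e in auto)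
  qed
qed

text \<open>Derivatives in \<open>Ck_on\<close> are full derivatives at points, not within the set,
  so the property passes from open neighbourhoods to S by induction on k.\<close>

lemma Ck_on_local:
  assumes "\<And>x. x \<in> S \<Longrightarrow> \<exists>T. open T \<and> x \<in> T \<and> Ck_on k T f"
  shows "Ck_on k S f"
  using assms
proof (induction k arbitrary: f)
  case 0
  have "continuous_on S f"
  proof (rule continuous_at_imp_continuous_on, rule ballI)
    fix x assume "x \<in> S"
    then obtain T where "open T" "x \<in> T" "continuous_on T f" using 0 by force
    then show "isCont f x" using continuous_on_eq_continuous_at by blast
  qed
  then show ?case by simp
next
  case (Suc k)
  show ?case
  proof (simp, intro conjI ballI allI)
    show "f differentiable at x" if "x \<in> S" for x using Suc.prems[OF that] by auto
    show "Ck_on k S (\<lambda>x. frechet_derivative f (at x) v)" for v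
      by (rule Suc.IH) (use Suc.prems in force)
  qed
qed

lemma Ck_on_const [simp]: "Ck_on k S (\<lambda>x. c)"
  by (induction k arbitrary: c) (auto simp: frechet_derivative_const)

lemma Ck_on_Suc_I:
  assumes "open S" "\<And>x. x \<in> S \<Longrightarrow> (f has_derivative f' x) (at x)" "\<And>v. Ck_on k S (\<lambda>x. f' x v)"
  shows "Ck_on (Suc k) S f"
proof (simp, intro conjI ballI allI)
  show "f differentiable at x" if "x \<in> S" for x using assms(2)[OF that] unfolding differentiable_def by blast
  show "Ck_on k S (\<lambda>x. frechet_derivative f (at x) v)" for v
    by (rule Ck_on_cong_imp[OF assms(1) _ assms(3)[of v]]) (use frechet_derivative_at[OF assms(2)] in auto)
qed

lemma Ck_on_SucD:
  assumes "Ck_on (Suc k) S f"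
  shows "x \<in> S \<Longrightarrow> (f has_derivative frechet_derivative f (at x)) (at x)"
    and "Ck_on k S (\<lambda>x. frechet_derivative f (at x) v)"
  using assms frechet_derivative_works by auto

lemma Ck_on_linear:
  assumes "bounded_linear g" "open S" "Ck_on k S f"
  shows "Ck_on k S (\<lambda>x. g (f x))"
  using assms(3)
proof (induction k arbitrary: f)
  case 0
  then show ?case using bounded_linear.continuous_on[OF assms(1)] by auto
next
  case (Suc k)
  show ?case
    by (rule Ck_on_Suc_I[OF assms(2) bounded_linear.has_derivative[OF assms(1) Ck_on_SucD(1)[OF Suc.prems]]])
       (use Suc.IH Ck_on_SucD(2)[OF Suc.prems] in auto)
qed

lemma Ck_on_add:
  assumes "open S" "Ck_on k S f" "Ck_on k S g"
  shows "Ck_on k S (\<lambda>x. f x + g x)"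
  using assms(2,3)
proof (induction k arbitrary: f g)
  case 0
  then show ?case by (auto intro: continuous_intros)
next
  case (Suc k)
  show ?case
    by (rule Ck_on_Suc_I[OF assms(1) has_derivative_add[OF Ck_on_SucD(1)[OF Suc.prems(1)] Ck_on_SucD(1)[OF Suc.prems(2)]]])
       (use Suc.IH Ck_on_SucD(2)[OF Suc.prems(1)] Ck_on_SucD(2)[OF Suc.prems(2)] in auto)
qed

lemma Ck_on_sum:
  assumes "open S" "\<And>i. i \<in> I \<Longrightarrow> Ck_on k S (f i)"
  shows "Ck_on k S (\<lambda>x. \<Sum>i\<in>I. f i x)"
  using assms(2) by (induction I rule: infinite_finite_induct) (auto intro: Ck_on_add[OF assms(1)])

lemma Ck_on_bilinear:
  assumes "bounded_bilinear h" "open S" "Ck_on k S f" "Ck_on k S g"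
  shows "Ck_on k S (\<lambda>x. h (f x) (g x))"
  using assms(3,4)
proof (induction k arbitrary: f g)
  case 0
  then show ?case using bounded_bilinear.continuous_on[OF assms(1)] by auto
next
  case (Suc k)
  show ?case
    by (rule Ck_on_Suc_I[OF assms(2) bounded_bilinear.FDERIV[OF assms(1) Ck_on_SucD(1)[OF Suc.prems(1)] Ck_on_SucD(1)[OF Suc.prems(2)]]])
       (use Suc.IH Ck_on_SucD(2)[OF Suc.prems(1)] Ck_on_SucD(2)[OF Suc.prems(2)]
          Ck_on_Suc_imp[OF Suc.prems(1)] Ck_on_Suc_imp[OF Suc.prems(2)] in \<open>auto intro!: Ck_on_add[OF assms(2)]\<close>)
qed

lemma Ck_on_id:
  assumes "open S"
  shows "Ck_on k S (\<lambda>x. x)"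
proof (cases k)
  case (Suc j)
  then show ?thesis using Ck_on_Suc_I[OF assms has_derivative_ident, of j] by simp
qed simp

lemma Ck_on_compose:
  fixes f :: "'a::euclidean_space \<Rightarrow> 'b::euclidean_space"
  assumes "open S" "open T" "Ck_on k S f" "Ck_on k T g" "f ` S \<subseteq> T"
  shows "Ck_on k S (\<lambda>x. g (f x))"
  using assms(3,4)
proof (induction k arbitrary: g)
  case 0
  then show ?case using continuous_on_compose2[of T g S f] assms(5) by auto
next
  case (Suc k)
  note f = Ck_on_SucD[OF Suc.prems(1)] and g = Ck_on_SucD[OF Suc.prems(2)]
  \<comment> \<open>The direction in which g is differentiated varies with x, so it is expanded in
    \<open>Basis\<close>. Each summand is then a product of derivatives in fixed directions, the one
    of g composed with f, to which the induction hypothesis applies.\<close>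
  let ?d = "\<lambda>x v. \<Sum>b\<in>Basis. (frechet_derivative f (at x) v \<bullet> b) *\<^sub>R frechet_derivative g (at (f x)) b"
  have d: "((\<lambda>x. g (f x)) has_derivative ?d x) (at x)" if "x \<in> S" for x
  proof -
    have fx: "f x \<in> T" using that assms(5) by auto
    have "((\<lambda>x. g (f x)) has_derivative (\<lambda>v. frechet_derivative g (at (f x)) (frechet_derivative f (at x) v))) (at x)"
      using has_derivative_compose[OF f(1)[OF that] g(1)[OF fx]] .
    moreover have "frechet_derivative g (at (f x)) (frechet_derivative f (at x) v) = ?d x v" for v
    proof -
      interpret g: linear "frechet_derivative g (at (f x))"
        using g(1)[OF fx] has_derivative_linear by blast
      show ?thesis
        by (subst euclidean_representation[of "frechet_derivative f (at x) v", symmetric])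
           (simp only: g.sum g.scaleR)
    qed
    ultimately show ?thesis by simp
  qed
  show ?case
  proof (rule Ck_on_Suc_I[OF assms(1) d])
    fix v
    show "Ck_on k S (\<lambda>x. ?d x v)"
    proof (intro Ck_on_sum[OF assms(1)] Ck_on_bilinear[OF bounded_bilinear_scaleR assms(1)])
      fix b :: 'b assume "b \<in> Basis"
      show "Ck_on k S (\<lambda>x. frechet_derivative f (at x) v \<bullet> b)"
        by (rule Ck_on_linear[OF bounded_linear_inner_left assms(1) f(2)])
      show "Ck_on k S (\<lambda>x. frechet_derivative g (at (f x)) b)"
        by (rule Suc.IH[OF Ck_on_Suc_imp[OF Suc.prems(1)] g(2)])
    qed
  qed
qed

lemma smooth_on_subset: "smooth_on T f \<Longrightarrow> S \<subseteq> T \<Longrightarrow> smooth_on S f"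
  unfolding smooth_on_def using Ck_on_subset by blast

lemma smooth_on_cong:
  assumes "open S" "\<And>x. x \<in> S \<Longrightarrow> f x = g x" "smooth_on S f"
  shows "smooth_on S g"
  using assms Ck_on_cong_imp[of S f g] unfolding smooth_on_def by blast

lemma smooth_on_local:
  assumes "\<And>x. x \<in> S \<Longrightarrow> \<exists>T. open T \<and> x \<in> T \<and> smooth_on T f"
  shows "smooth_on S f"
  unfolding smooth_on_def
proof
  fix k
  show "Ck_on k S f" by (rule Ck_on_local) (use assms in \<open>auto simp: smooth_on_def\<close>)
qed

lemma smooth_on_const [simp]: "smooth_on S (\<lambda>x. c)"
  unfolding smooth_on_def by simp

lemma smooth_on_id: "open S \<Longrightarrow> smooth_on S (\<lambda>x. x)"
  unfolding smooth_on_def using Ck_on_id by blast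

lemma smooth_on_linear:
  "bounded_linear g \<Longrightarrow> open S \<Longrightarrow> smooth_on S f \<Longrightarrow> smooth_on S (\<lambda>x. g (f x))"
  unfolding smooth_on_def using Ck_on_linear by blast

lemma smooth_on_add:
  "open S \<Longrightarrow> smooth_on S f \<Longrightarrow> smooth_on S g \<Longrightarrow> smooth_on S (\<lambda>x. f x + g x)"
  unfolding smooth_on_def using Ck_on_add by blast

lemma smooth_on_bilinear:
  "bounded_bilinear h \<Longrightarrow> open S \<Longrightarrow> smooth_on S f \<Longrightarrow> smooth_on S g \<Longrightarrow> smooth_on S (\<lambda>x. h (f x) (g x))"
  unfolding smooth_on_def using Ck_on_bilinear by blast

lemma smooth_on_compose:
  fixes f :: "'a::euclidean_space \<Rightarrow> 'b::euclidean_space"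
  shows "open S \<Longrightarrow> open T \<Longrightarrow> smooth_on S f \<Longrightarrow> smooth_on T g \<Longrightarrow> f ` S \<subseteq> T \<Longrightarrow> smooth_on S (\<lambda>x. g (f x))"
  unfolding smooth_on_def using Ck_on_compose by blast

lemma smooth_on_Pair:
  fixes f :: "'a::euclidean_space \<Rightarrow> 'b::euclidean_space" and g :: "'a \<Rightarrow> 'c::euclidean_space"
  assumes "open S" "smooth_on S f" "smooth_on S g"
  shows "smooth_on S (\<lambda>x. (f x, g x))"
proof -
  have "smooth_on S (\<lambda>x. (f x, 0) + (0, g x))"
    by (intro smooth_on_add[OF assms(1)] smooth_on_linear[OF _ assms(1,2), of "\<lambda>y. (y, 0)"]
        smooth_on_linear[OF _ assms(1,3), of "\<lambda>y. (0, y)"])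
       (auto intro!: bounded_linear_Pair bounded_linear_zero bounded_linear_ident)
  then show ?thesis by simp
qed

lemma smooth_on_imp_continuous_on: "smooth_on S f \<Longrightarrow> continuous_on S f"
  unfolding smooth_on_def by (metis Ck_on.simps(1))

lemma smooth_on_has_derivative:
  assumes "smooth_on S f" "x \<in> S"
  shows "(f has_derivative frechet_derivative f (at x)) (at x)"
  using assms Ck_on_SucD(1)[of 0 S f x] unfolding smooth_on_def by blast

lemma smooth_on_frechet_derivative:
  "smooth_on S f \<Longrightarrow> smooth_on S (\<lambda>x. frechet_derivative f (at x) v)"
  unfolding smooth_on_def using Ck_on_SucD(2) by blast

lemma smooth_on_fst: "open S \<Longrightarrow> smooth_on S f \<Longrightarrow> smooth_on S (\<lambda>x. fst (f x))"
  and smooth_on_snd: "open S \<Longrightarrow> smooth_on S f \<Longrightarrow> smooth_on S (\<lambda>x. snd (f x))"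
  using smooth_on_linear bounded_linear_fst bounded_linear_snd by blast+

section \<open>Partial derivatives and their symmetry\<close>

lemma partial_derivative_snd:
  fixes F :: "'a::euclidean_space \<times> 'b::euclidean_space \<Rightarrow> 'c::real_normed_vector"
  assumes "smooth_on S F" "(u, v) \<in> S"
  shows "((\<lambda>y. F (u, y)) has_derivative (\<lambda>Y. frechet_derivative F (at (u, v)) (0, Y))) (at v)"
proof -
  have "((\<lambda>y. (u, y)) has_derivative (\<lambda>Y. (0, Y))) (at v)"
    by (auto intro!: derivative_eq_intros)
  from has_derivative_compose[OF this, of F] smooth_on_has_derivative[OF assms] show ?thesis by simp
qed

lemma partial_derivative_fst:
  fixes F :: "'a::euclidean_space \<times> 'b::euclidean_space \<Rightarrow> 'c::real_normed_vector"
  assumes "smooth_on S F" "(u, v) \<in> S"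
  shows "((\<lambda>y. F (y, v)) has_derivative (\<lambda>Y. frechet_derivative F (at (u, v)) (Y, 0))) (at u)"
proof -
  have "((\<lambda>y. (y, v)) has_derivative (\<lambda>Y. (Y, 0))) (at u)"
    by (auto intro!: derivative_eq_intros)
  from has_derivative_compose[OF this, of F] smooth_on_has_derivative[OF assms] show ?thesis by simp
qed

lemma smooth_on_slice_snd:
  fixes F :: "'a::euclidean_space \<times> 'b::euclidean_space \<Rightarrow> 'c::real_normed_vector"
  assumes "open S" "smooth_on S F"
  shows "open {v. (u, v) \<in> S}" "smooth_on {v. (u, v) \<in> S} (\<lambda>v. F (u, v))"
proof -
  have c: "continuous_on UNIV (\<lambda>v. (u, v))" by (intro continuous_intros)
  show o: "open {v. (u, v) \<in> S}"
    using open_vimage[OF assms(1) c] by (simp add: vimage_def)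
  show "smooth_on {v. (u, v) \<in> S} (\<lambda>v. F (u, v))"
    by (rule smooth_on_compose[OF o assms(1) smooth_on_Pair[OF o smooth_on_const smooth_on_id[OF o]] assms(2)]) auto
qed

lemma smooth_on_slice_fst:
  fixes F :: "'a::euclidean_space \<times> 'b::euclidean_space \<Rightarrow> 'c::real_normed_vector"
  assumes "open S" "smooth_on S F"
  shows "open {u. (u, v) \<in> S}" "smooth_on {u. (u, v) \<in> S} (\<lambda>u. F (u, v))"
proof -
  have c: "continuous_on UNIV (\<lambda>u. (u, v))" by (intro continuous_intros)
  show o: "open {u. (u, v) \<in> S}"
    using open_vimage[OF assms(1) c] by (simp add: vimage_def)
  show "smooth_on {u. (u, v) \<in> S} (\<lambda>u. F (u, v))"
    by (rule smooth_on_compose[OF o assms(1) smooth_on_Pair[OF o smooth_on_id[OF o] smooth_on_const] assms(2)]) auto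
qed

text \<open>Smooth dependence on parameters, because the partial derivative is the full derivative
  in the direction (0, Y). The smoothness of \<open>lderiv\<close> and \<open>Ad\<close> in the
  group element rests on it.\<close>

lemma smooth_on_partial_snd:
  fixes F :: "'a::euclidean_space \<times> 'b::euclidean_space \<Rightarrow> 'c::real_normed_vector"
  assumes "open S" "smooth_on S F"
  shows "smooth_on {u. (u, v) \<in> S} (\<lambda>u. frechet_derivative (\<lambda>y. F (u, y)) (at v) Y)"
proof (rule smooth_on_cong[OF smooth_on_slice_fst(1)[OF assms]])
  show "smooth_on {u. (u, v) \<in> S} (\<lambda>u. frechet_derivative F (at (u, v)) (0, Y))"
    by (rule smooth_on_slice_fst(2)[OF assms(1) smooth_on_frechet_derivative[OF assms(2)]])
  show "frechet_derivative F (at (u, v)) (0, Y) = frechet_derivative (\<lambda>y. F (u, y)) (at v) Y"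
    if "u \<in> {u. (u, v) \<in> S}" for u
    using frechet_derivative_at[OF partial_derivative_snd[OF assms(2)], of u v] that by (metis mem_Collect_eq)
qed

text \<open>The mean value theorem is applied twice: to the increment in direction Y as a function
  of s, then to the derivative along X as a function of t. The second difference on the left is
  symmetric in X and Y, the expression on the right is not.\<close>

lemma second_difference_mvt:
  fixes f :: "'a::euclidean_space \<Rightarrow> real"
  assumes sm: "smooth_on S f" and h: "h > 0"
    and box: "\<And>s t. 0 \<le> s \<Longrightarrow> s \<le> h \<Longrightarrow> 0 \<le> t \<Longrightarrow> t \<le> h \<Longrightarrow> x + s *\<^sub>R X + t *\<^sub>R Y \<in> S"
  shows "\<exists>s t. 0 \<le> s \<and> s \<le> h \<and> 0 \<le> t \<and> t \<le> h \<and>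
    f (x + h *\<^sub>R X + h *\<^sub>R Y) - f (x + h *\<^sub>R X) - f (x + h *\<^sub>R Y) + f x =
    h\<^sup>2 * frechet_derivative (\<lambda>y. frechet_derivative f (at y) X) (at (x + s *\<^sub>R X + t *\<^sub>R Y)) Y"
proof -
  define f1 where "f1 = (\<lambda>y. frechet_derivative f (at y) X)"
  have sm1: "smooth_on S f1" unfolding f1_def by (rule smooth_on_frechet_derivative[OF sm])
  define p where "p s = f (x + s *\<^sub>R X + h *\<^sub>R Y) - f (x + s *\<^sub>R X)" for s
  have lin: "linear (frechet_derivative g (at y))" if "smooth_on S g" "y \<in> S" for g :: "'a \<Rightarrow> real" and y
    using smooth_on_has_derivative[OF that] has_derivative_linear by blast
  have dX: "((\<lambda>s. f (x + s *\<^sub>R X + t *\<^sub>R Y)) has_real_derivative f1 (x + s *\<^sub>R X + t *\<^sub>R Y)) (at s)"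
    if "0 \<le> s" "s \<le> h" "0 \<le> t" "t \<le> h" for s t
  proof -
    have "((\<lambda>s. x + s *\<^sub>R X + t *\<^sub>R Y) has_derivative (\<lambda>r. r *\<^sub>R X)) (at s)"
      by (auto intro!: derivative_eq_intros)
    from has_derivative_compose[OF this smooth_on_has_derivative[OF sm box[OF that]]]
    have "((\<lambda>s. f (x + s *\<^sub>R X + t *\<^sub>R Y)) has_derivative
        (\<lambda>r. frechet_derivative f (at (x + s *\<^sub>R X + t *\<^sub>R Y)) (r *\<^sub>R X))) (at s)" .
    then show ?thesis unfolding has_field_derivative_def f1_def
      by (simp add: linear_cmul[OF lin[OF sm box[OF that]]] mult_commute_abs)
  qed
  have dY: "((\<lambda>t. f1 (x + s *\<^sub>R X + t *\<^sub>R Y)) has_real_derivative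
      frechet_derivative f1 (at (x + s *\<^sub>R X + t *\<^sub>R Y)) Y) (at t)"
    if "0 \<le> s" "s \<le> h" "0 \<le> t" "t \<le> h" for s t
  proof -
    have "((\<lambda>t. x + s *\<^sub>R X + t *\<^sub>R Y) has_derivative (\<lambda>r. r *\<^sub>R Y)) (at t)"
      by (auto intro!: derivative_eq_intros)
    from has_derivative_compose[OF this smooth_on_has_derivative[OF sm1 box[OF that]]]
    have "((\<lambda>t. f1 (x + s *\<^sub>R X + t *\<^sub>R Y)) has_derivative
        (\<lambda>r. frechet_derivative f1 (at (x + s *\<^sub>R X + t *\<^sub>R Y)) (r *\<^sub>R Y))) (at t)" .
    then show ?thesis unfolding has_field_derivative_def
      by (simp add: linear_cmul[OF lin[OF sm1 box[OF that]]] mult_commute_abs)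
  qed
  have "\<exists>s. 0 < s \<and> s < h \<and> p h - p 0 = (h - 0) * (f1 (x + s *\<^sub>R X + h *\<^sub>R Y) - f1 (x + s *\<^sub>R X + 0 *\<^sub>R Y))"
  proof (rule MVT2[OF h])
    fix s assume s: "0 \<le> s" "s \<le> h"
    show "(p has_real_derivative f1 (x + s *\<^sub>R X + h *\<^sub>R Y) - f1 (x + s *\<^sub>R X + 0 *\<^sub>R Y)) (at s)"
      unfolding p_def using DERIV_diff[OF dX[of s h] dX[of s 0]] s h by simp
  qed
  then obtain s where s: "0 < s" "s < h"
    and e1: "p h - p 0 = h * (f1 (x + s *\<^sub>R X + h *\<^sub>R Y) - f1 (x + s *\<^sub>R X + 0 *\<^sub>R Y))" by auto
  have "\<exists>t. 0 < t \<and> t < h \<and> f1 (x + s *\<^sub>R X + h *\<^sub>R Y) - f1 (x + s *\<^sub>R X + 0 *\<^sub>R Y) =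
     (h - 0) * frechet_derivative f1 (at (x + s *\<^sub>R X + t *\<^sub>R Y)) Y"
    by (rule MVT2[OF h]) (use dY s in auto)
  then obtain t where t: "0 < t" "t < h" and e2: "f1 (x + s *\<^sub>R X + h *\<^sub>R Y) - f1 (x + s *\<^sub>R X + 0 *\<^sub>R Y) =
     h * frechet_derivative f1 (at (x + s *\<^sub>R X + t *\<^sub>R Y)) Y" by auto
  have "p h - p 0 = h\<^sup>2 * frechet_derivative f1 (at (x + s *\<^sub>R X + t *\<^sub>R Y)) Y"
    unfolding e1 e2 by (simp add: power2_eq_square)
  then show ?thesis
    using s t by (intro exI[of _ s] exI[of _ t]) (auto simp: p_def f1_def algebra_simps)
qed

text \<open>Over a small square the symmetric second difference equals h^2 times either mixed
  derivative, each taken at some point of the square; continuity of both at x gives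
  equality.\<close>

lemma frechet_derivative_commute_real:
  fixes f :: "'a::euclidean_space \<Rightarrow> real"
  assumes "open S" "smooth_on S f" "x \<in> S"
  shows "frechet_derivative (\<lambda>y. frechet_derivative f (at y) X) (at x) Y =
         frechet_derivative (\<lambda>y. frechet_derivative f (at y) Y) (at x) X"
proof -
  define P where "P = (\<lambda>z. frechet_derivative (\<lambda>y. frechet_derivative f (at y) X) (at z) Y)"
  define R where "R = (\<lambda>z. frechet_derivative (\<lambda>y. frechet_derivative f (at y) Y) (at z) X)"
  have cont: "isCont P x" "isCont R x"
    using smooth_on_frechet_derivative[OF smooth_on_frechet_derivative[OF assms(2)]]
      smooth_on_imp_continuous_on assms(1,3) continuous_on_eq_continuous_at
    unfolding P_def R_def by blast+
  have "\<bar>P x - R x\<bar> < e" if e: "e > 0" for e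
  proof -
    obtain d0 where d0: "d0 > 0" "ball x d0 \<subseteq> S" using assms(1,3) openE by blast
    obtain d1 where d1: "d1 > 0" "\<And>z. dist z x < d1 \<Longrightarrow> \<bar>P z - P x\<bar> < e / 2"
      using cont(1)[unfolded continuous_at_eps_delta] e by (metis dist_real_def half_gt_zero)
    obtain d2 where d2: "d2 > 0" "\<And>z. dist z x < d2 \<Longrightarrow> \<bar>R z - R x\<bar> < e / 2"
      using cont(2)[unfolded continuous_at_eps_delta] e by (metis dist_real_def half_gt_zero)
    define d where "d = min d0 (min d1 d2)"
    have d: "d > 0" using d0 d1 d2 by (simp add: d_def)
    \<comment> \<open>The factor 1/2 keeps the square of side h strictly inside the ball of radius
      d; the summand 1 keeps the denominator positive when X and Y vanish.\<close>
    define h where "h = d / (norm X + norm Y + 1) / 2"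
    have h: "h > 0" unfolding h_def using d by (auto intro!: divide_pos_pos add_nonneg_pos)
    have near: "dist (x + s *\<^sub>R X + t *\<^sub>R Y) x < d" if "0 \<le> s" "s \<le> h" "0 \<le> t" "t \<le> h" for s t
    proof -
      have "dist (x + s *\<^sub>R X + t *\<^sub>R Y) x = norm (s *\<^sub>R X + t *\<^sub>R Y)" by (simp add: dist_norm)
      also have "\<dots> \<le> s * norm X + t * norm Y"
        using norm_triangle_ineq[of "s *\<^sub>R X" "t *\<^sub>R Y"] that by simp
      also have "\<dots> \<le> h * norm X + h * norm Y"
        using that by (intro add_mono mult_right_mono) auto
      also have "\<dots> < h * (norm X + norm Y + 1)" using h by (simp add: algebra_simps)
      also have "\<dots> = d / 2"
      proof -
        have "norm X + norm Y + 1 \<noteq> 0" using norm_ge_zero[of X] norm_ge_zero[of Y] by linarith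
        then show ?thesis unfolding h_def by (metis nonzero_eq_divide_eq times_divide_eq_left mult.commute divide_divide_eq_left)
      qed
      finally show ?thesis using d by simp
    qed
    have inS: "x + s *\<^sub>R X + t *\<^sub>R Y \<in> S" if "0 \<le> s" "s \<le> h" "0 \<le> t" "t \<le> h" for s t
      using near[OF that] d0(2) unfolding d_def by (auto simp: dist_commute)
    have inS': "x + s *\<^sub>R Y + t *\<^sub>R X \<in> S" if "0 \<le> s" "s \<le> h" "0 \<le> t" "t \<le> h" for s t
      using inS[of t s] that by (simp add: add.assoc add.commute[of "s *\<^sub>R Y"])
    obtain s t where st: "0 \<le> s" "s \<le> h" "0 \<le> t" "t \<le> h" and
      e1: "f (x + h *\<^sub>R X + h *\<^sub>R Y) - f (x + h *\<^sub>R X) - f (x + h *\<^sub>R Y) + f x = h\<^sup>2 * P (x + s *\<^sub>R X + t *\<^sub>R Y)"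
      using second_difference_mvt[OF assms(2) h inS] unfolding P_def by blast
    obtain s' t' where st': "0 \<le> s'" "s' \<le> h" "0 \<le> t'" "t' \<le> h" and
      e2: "f (x + h *\<^sub>R Y + h *\<^sub>R X) - f (x + h *\<^sub>R Y) - f (x + h *\<^sub>R X) + f x = h\<^sup>2 * R (x + s' *\<^sub>R Y + t' *\<^sub>R X)"
      using second_difference_mvt[OF assms(2) h inS'] unfolding R_def by blast
    have "x + h *\<^sub>R Y + h *\<^sub>R X = x + h *\<^sub>R X + h *\<^sub>R Y" by simp
    then have "h\<^sup>2 * P (x + s *\<^sub>R X + t *\<^sub>R Y) = h\<^sup>2 * R (x + s' *\<^sub>R Y + t' *\<^sub>R X)"
      using e1 e2 by (simp add: algebra_simps)
    then have eq: "P (x + s *\<^sub>R X + t *\<^sub>R Y) = R (x + s' *\<^sub>R Y + t' *\<^sub>R X)" using h by simp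
    have n1: "\<bar>P (x + s *\<^sub>R X + t *\<^sub>R Y) - P x\<bar> < e / 2" using near[OF st] by (intro d1(2)) (simp add: d_def)
    have n2: "\<bar>R (x + s' *\<^sub>R Y + t' *\<^sub>R X) - R x\<bar> < e / 2"
      using near[of t' s'] st' by (intro d2(2)) (simp add: d_def add.assoc add.commute[of "s' *\<^sub>R Y"])
    show ?thesis using n1 n2 eq by linarith
  qed
  then have "\<bar>P x - R x\<bar> = 0" by (metis abs_ge_zero less_irrefl order_le_less)
  then show ?thesis unfolding P_def R_def by simp
qed

lemma frechet_derivative_commute:
  fixes f :: "'a::euclidean_space \<Rightarrow> 'b::euclidean_space"
  assumes "open S" "smooth_on S f" "x \<in> S"
  shows "frechet_derivative (\<lambda>y. frechet_derivative f (at y) X) (at x) Y =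
         frechet_derivative (\<lambda>y. frechet_derivative f (at y) Y) (at x) X"
proof (rule euclidean_eqI)
  fix b :: 'b assume "b \<in> Basis"
  have i: "frechet_derivative (\<lambda>y. g y \<bullet> b) (at y) Z = frechet_derivative g (at y) Z \<bullet> b"
    if "smooth_on S g" "y \<in> S" for g :: "'a \<Rightarrow> 'b" and y Z
    using frechet_derivative_at[OF has_derivative_inner_left[OF smooth_on_has_derivative[OF that], of b]]
    by metis
  have j: "frechet_derivative (\<lambda>y. frechet_derivative (\<lambda>y. f y \<bullet> b) (at y) Z) (at x) W =
      frechet_derivative (\<lambda>y. frechet_derivative f (at y) Z) (at x) W \<bullet> b" for Z W
  proof -
    have "((\<lambda>y. frechet_derivative f (at y) Z \<bullet> b) has_derivative
       (\<lambda>W. frechet_derivative (\<lambda>y. frechet_derivative f (at y) Z) (at x) W \<bullet> b)) (at x)"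
      by (rule has_derivative_inner_left[OF smooth_on_has_derivative[OF smooth_on_frechet_derivative[OF assms(2)] assms(3)]])
    then have "((\<lambda>y. frechet_derivative (\<lambda>y. f y \<bullet> b) (at y) Z) has_derivative
       (\<lambda>W. frechet_derivative (\<lambda>y. frechet_derivative f (at y) Z) (at x) W \<bullet> b)) (at x)"
      by (rule has_derivative_transform_within_open[OF _ assms(1,3)]) (simp add: i[OF assms(2)])
    from frechet_derivative_at[OF this] show ?thesis by metis
  qed
  show "frechet_derivative (\<lambda>y. frechet_derivative f (at y) X) (at x) Y \<bullet> b =
         frechet_derivative (\<lambda>y. frechet_derivative f (at y) Y) (at x) X \<bullet> b"
    using frechet_derivative_commute_real[OF assms(1) smooth_on_linear[OF bounded_linear_inner_left assms(1,2)] assms(3), of b X Y]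
    by (simp add: j)
qed

lemma mixed_partials_commute:
  fixes F :: "'a::euclidean_space \<times> 'b::euclidean_space \<Rightarrow> 'c::euclidean_space"
  assumes "open S" "smooth_on S F" "(u, v) \<in> S"
  shows "frechet_derivative (\<lambda>x. frechet_derivative (\<lambda>y. F (x, y)) (at v) Y) (at u) X =
         frechet_derivative (\<lambda>y. frechet_derivative (\<lambda>x. F (x, y)) (at u) X) (at v) Y"
proof -
  note sm = smooth_on_frechet_derivative[OF assms(2)]
  have a: "((\<lambda>x. frechet_derivative (\<lambda>y. F (x, y)) (at v) Y) has_derivative
     (\<lambda>X. frechet_derivative (\<lambda>z. frechet_derivative F (at z) (0, Y)) (at (u, v)) (X, 0))) (at u)"
    by (rule has_derivative_transform_within_open[OF partial_derivative_fst[OF sm assms(3)]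
          smooth_on_slice_fst(1)[OF assms(1,2)]])
       (use assms(3) in \<open>auto simp: frechet_derivative_at[OF partial_derivative_snd[OF assms(2)], symmetric]\<close>)
  have b: "((\<lambda>y. frechet_derivative (\<lambda>x. F (x, y)) (at u) X) has_derivative
     (\<lambda>Y. frechet_derivative (\<lambda>z. frechet_derivative F (at z) (X, 0)) (at (u, v)) (0, Y))) (at v)"
    by (rule has_derivative_transform_within_open[OF partial_derivative_snd[OF sm assms(3)]
          smooth_on_slice_snd(1)[OF assms(1,2)]])
       (use assms(3) in \<open>auto simp: frechet_derivative_at[OF partial_derivative_fst[OF assms(2)], symmetric]\<close>)
  show ?thesis
    using frechet_derivative_commute[OF assms, of "(0, Y)" "(X, 0)"]
    by (simp only: frechet_derivative_at[OF a, symmetric] frechet_derivative_at[OF b, symmetric])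
qed

subsection \<open>Smooth maps into and out of a Lie group\<close>

context lie_group
begin

text \<open>Continuity is included because it makes the sets on which the chart condition is tested
  relatively open.\<close>

definition smooth_into :: "'a::euclidean_space set \<Rightarrow> ('a \<Rightarrow> 'g) \<Rightarrow> bool" where
  "smooth_into S p \<longleftrightarrow> continuous_on S p \<and>
     (\<forall>(W, \<omega>)\<in>atlas G. smooth_on {x\<in>S. p x \<in> W} (\<lambda>x. \<omega> (p x)))"

definition smooth_from :: "'g set \<Rightarrow> ('g \<Rightarrow> 'b::real_normed_vector) \<Rightarrow> bool" where
  "smooth_from U f \<longleftrightarrow> (\<forall>(V, \<phi>)\<in>atlas G. smooth_on (\<phi> ` (U \<inter> V)) (\<lambda>u. f (inv_into V \<phi> u)))"

lemma smooth_map_iff: "smooth_map G f \<longleftrightarrow> smooth_from UNIV f"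
  unfolding smooth_map_def smooth_from_def by simp

lemma in_carrier [simp]: "x \<in> carrier G"
  using carrier_UNIV by simp

lemma inv_cancel [simp]: "inv a \<otimes> (a \<otimes> b) = b" "a \<otimes> (inv a \<otimes> b) = b"
  by (simp_all add: m_assoc[symmetric])

lemma chart_facts:
  assumes "(U, \<phi>) \<in> atlas G"
  shows "open U" "open (\<phi> ` U)" "continuous_on U \<phi>" "continuous_on (\<phi> ` U) (inv_into U \<phi>)"
    "\<And>x. x \<in> U \<Longrightarrow> inv_into U \<phi> (\<phi> x) = x" "\<And>u. u \<in> \<phi> ` U \<Longrightarrow> inv_into U \<phi> u \<in> U"
    "\<And>u. u \<in> \<phi> ` U \<Longrightarrow> \<phi> (inv_into U \<phi> u) = u"
  using chart[OF assms] by (auto simp: homeomorphism_def inv_into_into f_inv_into_f)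

lemma chart_at:
  obtains U \<phi> where "(U, \<phi>) \<in> atlas G" "x \<in> U"
  using cover by (metis (no_types, lifting) UNIV_I UN_E case_prod_unfold prod.collapse)

lemma open_preimage:
  assumes "open S" "continuous_on S p" "open W"
  shows "open {x\<in>S. p x \<in> W}"
  using continuous_open_preimage[OF assms(2,1,3)] by (simp add: vimage_def Int_def)

lemma smooth_into_continuous: "smooth_into S p \<Longrightarrow> continuous_on S p"
  unfolding smooth_into_def by blast

lemma smooth_intoD:
  "smooth_into S p \<Longrightarrow> (W, \<omega>) \<in> atlas G \<Longrightarrow> smooth_on {x\<in>S. p x \<in> W} (\<lambda>x. \<omega> (p x))"
  unfolding smooth_into_def by blast

lemma smooth_into_const [simp]: "smooth_into S (\<lambda>_. a)"
  unfolding smooth_into_def by auto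

lemma chart_image_Int:
  assumes "(U, \<phi>) \<in> atlas G"
  shows "\<phi> ` (W \<inter> U) = {u \<in> \<phi> ` U. inv_into U \<phi> u \<in> W}"
  using chart_facts(5,7)[OF assms] by (force simp: image_iff)

lemma open_chart_image:
  assumes "(U, \<phi>) \<in> atlas G" "open W"
  shows "open (\<phi> ` (W \<inter> U))"
  unfolding chart_image_Int[OF assms(1)]
  by (rule open_preimage[OF chart_facts(2,4)[OF assms(1)] assms(2)])

lemma smooth_into_chart:
  assumes "(U, \<phi>) \<in> atlas G"
  shows "smooth_into (\<phi> ` U) (inv_into U \<phi>)"
  unfolding smooth_into_def
  using chart_facts(4)[OF assms] transition[OF assms] chart_image_Int[OF assms]
  by (auto simp: Int_commute)

lemma smooth_from_chart: "(W, \<omega>) \<in> atlas G \<Longrightarrow> smooth_from W \<omega>"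
  unfolding smooth_from_def using transition by (auto simp: Int_commute)

lemma smooth_into_compose:
  assumes "open S" "open T" "smooth_on S h" "h ` S \<subseteq> T" "smooth_into T p"
  shows "smooth_into S (\<lambda>x. p (h x))"
  unfolding smooth_into_def
proof (intro conjI ballI, goal_cases)
  case 1
  show ?case using continuous_on_compose2[OF smooth_into_continuous[OF assms(5)] smooth_on_imp_continuous_on[OF assms(3)] assms(4)] .
next
  case (2 c)
  obtain W \<omega> where c: "c = (W, \<omega>)" by (cases c)
  then have W: "(W, \<omega>) \<in> atlas G" using 2 by simp
  have oW: "open W" by (rule chart_facts(1)[OF W])
  have oT: "open {y\<in>T. p y \<in> W}" by (rule open_preimage[OF assms(2) smooth_into_continuous[OF assms(5)] oW])
  have "open {x\<in>S. h x \<in> {y\<in>T. p y \<in> W}}"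
    by (rule open_preimage[OF assms(1) smooth_on_imp_continuous_on[OF assms(3)] oT])
  moreover have "{x\<in>S. h x \<in> {y\<in>T. p y \<in> W}} = {x\<in>S. p (h x) \<in> W}" using assms(4) by auto
  ultimately have oS: "open {x\<in>S. p (h x) \<in> W}" by simp
  have "smooth_on {x\<in>S. p (h x) \<in> W} (\<lambda>x. \<omega> (p (h x)))"
    by (rule smooth_on_compose[OF oS oT smooth_on_subset[OF assms(3)] smooth_intoD[OF assms(5) W]])
       (use assms(4) in auto)
  then show ?case using c by simp
qed

text \<open>Near x both maps are read in one chart around \<open>p x\<close>. The smoothness of
  translations, conjugations and left invariant derivatives is obtained through this
  composition.\<close>

lemma smooth_on_from_into:
  assumes "open S" "open U" "smooth_from U f" "smooth_into S p"
  shows "open {x\<in>S. p x \<in> U}" "smooth_on {x\<in>S. p x \<in> U} (\<lambda>x. f (p x))"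
proof -
  note cp = smooth_into_continuous[OF assms(4)]
  show "open {x\<in>S. p x \<in> U}" by (rule open_preimage[OF assms(1) cp assms(2)])
  show "smooth_on {x\<in>S. p x \<in> U} (\<lambda>x. f (p x))"
  proof (rule smooth_on_local)
    fix x assume x: "x \<in> {x\<in>S. p x \<in> U}"
    obtain V \<phi> where V: "(V, \<phi>) \<in> atlas G" "p x \<in> V" by (rule chart_at)
    let ?T = "{x\<in>S. p x \<in> U \<inter> V}"
    have oT: "open ?T"
      by (rule open_preimage[OF assms(1) cp]) (use assms(2) chart_facts(1)[OF V(1)] in auto)
    have "smooth_on ?T (\<lambda>x. f (inv_into V \<phi> (\<phi> (p x))))"
    proof (rule smooth_on_compose[OF oT open_chart_image[OF V(1) assms(2)]])
      show "smooth_on ?T (\<lambda>x. \<phi> (p x))"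
        by (rule smooth_on_subset[OF smooth_intoD[OF assms(4) V(1)]]) auto
      show "smooth_on (\<phi> ` (U \<inter> V)) (\<lambda>u. f (inv_into V \<phi> u))"
        using assms(3) V(1) unfolding smooth_from_def by auto
    qed auto
    then have "smooth_on ?T (\<lambda>x. f (p x))"
      by (rule smooth_on_cong[OF oT, rotated]) (use chart_facts(5)[OF V(1)] in auto)
    then show "\<exists>T. open T \<and> x \<in> T \<and> smooth_on T (\<lambda>x. f (p x))" using oT x V(2) by blast
  qed
qed

lemma smooth_into_mult:
  fixes p q :: "'a::euclidean_space \<Rightarrow> 'g"
  assumes "open S" "smooth_into S p" "smooth_into S q"
  shows "smooth_into S (\<lambda>x. p x \<otimes> q x)"
proof -
  note cp = smooth_into_continuous[OF assms(2)] and cq = smooth_into_continuous[OF assms(3)]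
  have c: "continuous_on S (\<lambda>x. p x \<otimes> q x)"
    using continuous_on_compose2[OF mult_continuous continuous_on_Pair[OF cp cq]] by auto
  have "smooth_on {x\<in>S. p x \<otimes> q x \<in> W} (\<lambda>x. \<omega> (p x \<otimes> q x))" if W: "(W, \<omega>) \<in> atlas G" for W \<omega>
  proof (rule smooth_on_local)
    fix x assume x: "x \<in> {x\<in>S. p x \<otimes> q x \<in> W}"
    obtain U \<phi> where U: "(U, \<phi>) \<in> atlas G" "p x \<in> U" by (rule chart_at)
    obtain V \<eta> where V: "(V, \<eta>) \<in> atlas G" "q x \<in> V" by (rule chart_at)
    note oU = chart_facts(1)[OF U(1)] and oV = chart_facts(1)[OF V(1)] and oW = chart_facts(1)[OF W]
    let ?T = "{x\<in>S. p x \<in> U} \<inter> {x\<in>S. q x \<in> V} \<inter> {x\<in>S. p x \<otimes> q x \<in> W}"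
    have oT: "open ?T"
      by (intro open_Int open_preimage[OF assms(1)] cp cq c oU oV oW)
    let ?D = "{(u, v). u \<in> \<phi> ` U \<and> v \<in> \<eta> ` V \<and> inv_into U \<phi> u \<otimes> inv_into V \<eta> v \<in> W}"
    have oD: "open ?D"
    proof -
      have 1: "continuous_on (\<phi> ` U \<times> \<eta> ` V) (\<lambda>z. inv_into U \<phi> (fst z))"
        by (rule continuous_on_compose2[OF chart_facts(4)[OF U(1)]]) (auto intro: continuous_intros)
      have 2: "continuous_on (\<phi> ` U \<times> \<eta> ` V) (\<lambda>z. inv_into V \<eta> (snd z))"
        by (rule continuous_on_compose2[OF chart_facts(4)[OF V(1)]]) (auto intro: continuous_intros)
      have "continuous_on (\<phi> ` U \<times> \<eta> ` V) (\<lambda>z. inv_into U \<phi> (fst z) \<otimes> inv_into V \<eta> (snd z))"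
        using continuous_on_compose2[OF mult_continuous continuous_on_Pair[OF 1 2]] by auto
      from open_preimage[OF open_Times[OF chart_facts(2)[OF U(1)] chart_facts(2)[OF V(1)]] this oW]
      moreover have "{z\<in>\<phi> ` U \<times> \<eta> ` V. inv_into U \<phi> (fst z) \<otimes> inv_into V \<eta> (snd z) \<in> W} = ?D" by auto
      ultimately show ?thesis by simp
    qed
    have s: "smooth_on ?T (\<lambda>x. (\<phi> (p x), \<eta> (q x)))"
      by (rule smooth_on_Pair[OF oT smooth_on_subset[OF smooth_intoD[OF assms(2) U(1)]]
            smooth_on_subset[OF smooth_intoD[OF assms(3) V(1)]]]) auto
    have "smooth_on ?T (\<lambda>x. (case (\<phi> (p x), \<eta> (q x)) of (u, v) \<Rightarrow> \<omega> (inv_into U \<phi> u \<otimes> inv_into V \<eta> v)))"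
      by (rule smooth_on_compose[OF oT oD s mult_smooth[OF U(1) V(1) W]])
         (auto simp: chart_facts(5)[OF U(1)] chart_facts(5)[OF V(1)])
    then have "smooth_on ?T (\<lambda>x. \<omega> (p x \<otimes> q x))"
      by (rule smooth_on_cong[OF oT, rotated]) (auto simp: chart_facts(5)[OF U(1)] chart_facts(5)[OF V(1)])
    then show "\<exists>T. open T \<and> x \<in> T \<and> smooth_on T (\<lambda>x. \<omega> (p x \<otimes> q x))" using oT x U(2) V(2) by blast
  qed
  then show ?thesis using c unfolding smooth_into_def by auto
qed

lemma smooth_into_inv:
  fixes p :: "'a::euclidean_space \<Rightarrow> 'g"
  assumes "open S" "smooth_into S p"
  shows "smooth_into S (\<lambda>x. inv (p x))"
proof -
  note cp = smooth_into_continuous[OF assms(2)]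
  have c: "continuous_on S (\<lambda>x. inv (p x))"
    using continuous_on_compose2[OF inv_continuous cp] by auto
  have "smooth_on {x\<in>S. inv (p x) \<in> W} (\<lambda>x. \<omega> (inv (p x)))" if W: "(W, \<omega>) \<in> atlas G" for W \<omega>
  proof (rule smooth_on_local)
    fix x assume x: "x \<in> {x\<in>S. inv (p x) \<in> W}"
    obtain U \<phi> where U: "(U, \<phi>) \<in> atlas G" "p x \<in> U" by (rule chart_at)
    note oU = chart_facts(1)[OF U(1)] and oW = chart_facts(1)[OF W]
    let ?T = "{x\<in>S. p x \<in> U} \<inter> {x\<in>S. inv (p x) \<in> W}"
    have oT: "open ?T" by (intro open_Int open_preimage[OF assms(1)] cp c oU oW)
    let ?D = "{u. u \<in> \<phi> ` U \<and> inv (inv_into U \<phi> u) \<in> W}"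
    have "continuous_on (\<phi> ` U) (\<lambda>u. inv (inv_into U \<phi> u))"
      using continuous_on_compose2[OF inv_continuous chart_facts(4)[OF U(1)]] by auto
    from open_preimage[OF chart_facts(2)[OF U(1)] this oW] have oD: "open ?D" .
    have "smooth_on ?T (\<lambda>x. \<omega> (inv (inv_into U \<phi> (\<phi> (p x)))))"
      by (rule smooth_on_compose[OF oT oD smooth_on_subset[OF smooth_intoD[OF assms(2) U(1)]] inv_smooth[OF U(1) W]])
         (auto simp: chart_facts(5)[OF U(1)])
    then have "smooth_on ?T (\<lambda>x. \<omega> (inv (p x)))"
      by (rule smooth_on_cong[OF oT, rotated]) (auto simp: chart_facts(5)[OF U(1)])
    then show "\<exists>T. open T \<and> x \<in> T \<and> smooth_on T (\<lambda>x. \<omega> (inv (p x)))" using oT x U(2) by blast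
  qed
  then show ?thesis using c unfolding smooth_into_def by auto
qed

lemma smooth_from_continuous:
  assumes "open U" "smooth_from U f"
  shows "continuous_on U f"
proof (rule continuous_at_imp_continuous_on, rule ballI)
  fix x assume x: "x \<in> U"
  obtain V \<phi> where V: "(V, \<phi>) \<in> atlas G" "x \<in> V" by (rule chart_at)
  have oUV: "open (U \<inter> V)" using assms(1) chart_facts(1)[OF V(1)] by auto
  have "continuous_on (\<phi> ` (U \<inter> V)) (\<lambda>u. f (inv_into V \<phi> u))"
    using assms(2) V(1) smooth_on_imp_continuous_on unfolding smooth_from_def by blast
  from continuous_on_compose2[OF this continuous_on_subset[OF chart_facts(3)[OF V(1)]]]
  have "continuous_on (U \<inter> V) (\<lambda>x. f (inv_into V \<phi> (\<phi> x)))" by blast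
  then have "continuous_on (U \<inter> V) f"
    by (rule continuous_on_eq) (use chart_facts(5)[OF V(1)] in auto)
  then show "isCont f x" using continuous_on_eq_continuous_at[OF oUV] x V(2) by auto
qed

lemma smooth_from_linear:
  assumes "bounded_linear h" "open U" "smooth_from U f"
  shows "smooth_from U (\<lambda>x. h (f x))"
  using assms unfolding smooth_from_def by (auto intro: smooth_on_linear open_chart_image)

lemma smooth_from_bilinear:
  assumes "bounded_bilinear h" "open U" "smooth_from U f" "smooth_from U g"
  shows "smooth_from U (\<lambda>x. h (f x) (g x))"
  unfolding smooth_from_def
proof clarify
  fix V \<phi> assume V: "(V, \<phi>) \<in> atlas G"
  show "smooth_on (\<phi> ` (U \<inter> V)) (\<lambda>u. h (f (inv_into V \<phi> u)) (g (inv_into V \<phi> u)))"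
    by (rule smooth_on_bilinear[OF assms(1) open_chart_image[OF V assms(2)]]) (use V assms in \<open>auto simp: smooth_from_def\<close>)
qed

subsection \<open>Left invariant derivatives\<close>

definition dom0 :: "'g set" where "dom0 = fst (id_chart G)"
definition cod0 :: "'e set" where "cod0 = coord G ` dom0"
definition e0 :: 'e where "e0 = coord G \<one>"

lemma id_chart: "(dom0, coord G) \<in> atlas G"
  using chart_at_one(1) unfolding dom0_def coord_def by simp

lemma param_eq: "param G = inv_into dom0 (coord G)"
  unfolding param_def dom0_def coord_def ..

lemma one_in_dom0 [simp]: "\<one> \<in> dom0"
  using chart_at_one(2) unfolding dom0_def .

lemma e0_in_cod0 [simp]: "e0 \<in> cod0"
  unfolding e0_def cod0_def by simp

lemma open_cod0: "open cod0" and open_dom0: "open dom0"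
  using chart_facts(1,2)[OF id_chart] unfolding cod0_def by auto

lemma param_coord [simp]: "x \<in> dom0 \<Longrightarrow> param G (coord G x) = x"
  using chart_facts(5)[OF id_chart] param_eq by simp

lemma coord_param [simp]: "u \<in> cod0 \<Longrightarrow> coord G (param G u) = u"
  using chart_facts(7)[OF id_chart] param_eq cod0_def by simp

lemma param_e0 [simp]: "param G e0 = \<one>"
  unfolding e0_def by simp

lemma smooth_into_param: "smooth_into cod0 (param G)"
  using smooth_into_chart[OF id_chart] param_eq cod0_def by simp

lemma smooth_from_coord: "smooth_from dom0 (coord G)"
  using smooth_from_chart[OF id_chart] .

lemma lderiv_eq: "lderiv G X f a = frechet_derivative (\<lambda>v. f (a \<otimes> param G v)) (at e0) X"
  unfolding lderiv_def e0_def ..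

lemma smooth_translate_param:
  assumes "open U" "smooth_from U f"
  shows "open {v\<in>cod0. a \<otimes> param G v \<in> U}" "smooth_on {v\<in>cod0. a \<otimes> param G v \<in> U} (\<lambda>v. f (a \<otimes> param G v))"
  using smooth_on_from_into[OF open_cod0 assms smooth_into_mult[OF open_cod0 smooth_into_const smooth_into_param]]
  by auto

lemma lderiv_has_derivative:
  assumes "open U" "smooth_from U f" "a \<in> U"
  shows "((\<lambda>v. f (a \<otimes> param G v)) has_derivative (\<lambda>X. lderiv G X f a)) (at e0)"
  using smooth_on_has_derivative[OF smooth_translate_param(2)[OF assms(1,2)], of e0 a] assms(3)
  by (simp add: lderiv_eq[abs_def])

lemma lderiv_eqI:
  "((\<lambda>v. f (a \<otimes> param G v)) has_derivative f') (at e0) \<Longrightarrow> lderiv G X f a = f' X"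
  unfolding lderiv_eq using frechet_derivative_at by metis

lemma lderiv_linear:
  "open U \<Longrightarrow> smooth_from U f \<Longrightarrow> a \<in> U \<Longrightarrow> linear (\<lambda>X. lderiv G X f a)"
  using lderiv_has_derivative has_derivative_linear by blast

lemma open_translate: "open U \<Longrightarrow> open {v\<in>cod0. a \<otimes> param G v \<in> U}"
  using smooth_translate_param(1)[of U "\<lambda>_. 0::real" a] by (auto simp: smooth_from_def)

lemma lderiv_cong:
  assumes "open U" "smooth_from U f" "\<And>x. x \<in> U \<Longrightarrow> f x = g x" "a \<in> U"
  shows "lderiv G X g a = lderiv G X f a"
  by (rule lderiv_eqI, rule has_derivative_transform_within_open[OF lderiv_has_derivative[OF assms(1,2,4)] open_translate[OF assms(1)]])
     (use assms in auto)

text \<open>In a chart with inverse y, the derivative is the partial derivative in v at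
  \<open>e0\<close> of the smooth function sending (u, v) to f of the product of y(u) and
  \<open>param G v\<close>.\<close>

lemma lderiv_smooth:
  assumes "open U" "smooth_from U f"
  shows "smooth_from U (lderiv G X f)"
  unfolding smooth_from_def
proof clarify
  fix V \<phi> assume V: "(V, \<phi>) \<in> atlas G"
  let ?S = "\<phi> ` V \<times> cod0"
  have oS: "open ?S" using chart_facts(2)[OF V] open_cod0 by (intro open_Times)
  have 1: "smooth_into ?S (\<lambda>z. inv_into V \<phi> (fst z))"
    by (rule smooth_into_compose[OF oS chart_facts(2)[OF V] smooth_on_fst[OF oS smooth_on_id[OF oS]] _ smooth_into_chart[OF V]]) auto
  have 2: "smooth_into ?S (\<lambda>z. param G (snd z))"
    by (rule smooth_into_compose[OF oS open_cod0 smooth_on_snd[OF oS smooth_on_id[OF oS]] _ smooth_into_param]) auto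
  note F = smooth_on_from_into[OF oS assms smooth_into_mult[OF oS 1 2]]
  have eq: "\<phi> ` (U \<inter> V) = {u. (u, e0) \<in> {z\<in>?S. inv_into V \<phi> (fst z) \<otimes> param G (snd z) \<in> U}}"
    unfolding chart_image_Int[OF V] by auto
  show "smooth_on (\<phi> ` (U \<inter> V)) (\<lambda>u. lderiv G X f (inv_into V \<phi> u))"
    unfolding eq lderiv_eq using smooth_on_partial_snd[OF F, of e0 X] by simp
qed

lemma lderiv_linear_comp:
  assumes "bounded_linear h" "open U" "smooth_from U f" "a \<in> U"
  shows "lderiv G X (\<lambda>x. h (f x)) a = h (lderiv G X f a)"
  by (rule lderiv_eqI[OF bounded_linear.has_derivative[OF assms(1) lderiv_has_derivative[OF assms(2-4)]]])

lemma lderiv_bilinear: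
  assumes "bounded_bilinear h" "open U" "smooth_from U f" "smooth_from U g" "a \<in> U"
  shows "lderiv G X (\<lambda>x. h (f x) (g x)) a = h (f a) (lderiv G X g a) + h (lderiv G X f a) (g a)"
  using lderiv_eqI[OF bounded_bilinear.FDERIV[OF assms(1) lderiv_has_derivative[OF assms(2,3,5)]
        lderiv_has_derivative[OF assms(2,4,5)]]] by simp

lemma lderiv_const [simp]: "lderiv G X (\<lambda>_. c) a = 0"
  unfolding lderiv_eq by (simp add: frechet_derivative_const)

text \<open>The coordinate function recovers X from the derivation that X induces at the identity.
  Identities for the bracket can therefore be proved by differentiating
  \<open>coord G\<close>.\<close>

lemma lderiv_coord_one: "lderiv G X (coord G) \<one> = X"
proof (rule lderiv_eqI)
  show "((\<lambda>v. coord G (\<one> \<otimes> param G v)) has_derivative (\<lambda>X. X)) (at e0)"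
    by (rule has_derivative_transform_within_open[OF has_derivative_ident open_cod0 e0_in_cod0]) simp
qed

subsection \<open>The adjoint representation and the bracket\<close>

lemma conj_smooth:
  assumes "(V, \<phi>) \<in> atlas G"
  shows "smooth_into (\<phi> ` V \<times> cod0) (\<lambda>z. inv_into V \<phi> (fst z) \<otimes> param G (snd z) \<otimes> inv (inv_into V \<phi> (fst z)))"
proof -
  let ?S = "\<phi> ` V \<times> cod0"
  have oS: "open ?S" using chart_facts(2)[OF assms] open_cod0 by (intro open_Times)
  have 1: "smooth_into ?S (\<lambda>z. inv_into V \<phi> (fst z))"
    by (rule smooth_into_compose[OF oS chart_facts(2)[OF assms] smooth_on_fst[OF oS smooth_on_id[OF oS]] _ smooth_into_chart[OF assms]]) auto
  have 2: "smooth_into ?S (\<lambda>z. param G (snd z))"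
    by (rule smooth_into_compose[OF oS open_cod0 smooth_on_snd[OF oS smooth_on_id[OF oS]] _ smooth_into_param]) auto
  show ?thesis
    by (intro smooth_into_mult[OF oS] smooth_into_inv[OF oS] 1 2)
qed

lemma Ad_eq: "Ad G a X = frechet_derivative (\<lambda>v. coord G (a \<otimes> param G v \<otimes> inv a)) (at e0) X"
  unfolding Ad_def e0_def ..

lemma smooth_into_conj: "smooth_into cod0 (\<lambda>v. a \<otimes> param G v \<otimes> inv a)"
  by (intro smooth_into_mult open_cod0 smooth_into_const smooth_into_param)

lemma open_conj: "open U \<Longrightarrow> open {v\<in>cod0. a \<otimes> param G v \<otimes> inv a \<in> U}"
  by (rule open_preimage[OF open_cod0 smooth_into_continuous[OF smooth_into_conj]])

lemma Ad_has_derivative: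
  "((\<lambda>v. coord G (a \<otimes> param G v \<otimes> inv a)) has_derivative Ad G a) (at e0)"
  using smooth_on_has_derivative[OF smooth_on_from_into(2)[OF open_cod0 open_dom0 smooth_from_coord smooth_into_conj[of a]], of e0]
  by (simp add: Ad_eq[abs_def])

lemma Ad_linear: "linear (Ad G a)"
  using Ad_has_derivative has_derivative_linear by blast

lemma Ad_smooth: "smooth_from UNIV (\<lambda>a. Ad G a X)"
  unfolding smooth_from_def
proof clarify
  fix V \<phi> assume V: "(V, \<phi>) \<in> atlas G"
  have oS: "open (\<phi> ` V \<times> cod0)" using chart_facts(2)[OF V] open_cod0 by (intro open_Times)
  note F = smooth_on_from_into[OF oS open_dom0 smooth_from_coord conj_smooth[OF V]]
  have eq: "\<phi> ` (UNIV \<inter> V) = {u. (u, e0) \<in> {z\<in>\<phi> ` V \<times> cod0. inv_into V \<phi> (fst z) \<otimes> param G (snd z) \<otimes> inv (inv_into V \<phi> (fst z)) \<in> dom0}}"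
    by auto
  show "smooth_on (\<phi> ` (UNIV \<inter> V)) (\<lambda>u. Ad G (inv_into V \<phi> u) X)"
    unfolding eq Ad_eq using smooth_on_partial_snd[OF F, of e0 X] by simp
qed

lemma smooth_from_inv:
  assumes "smooth_from UNIV f"
  shows "smooth_from UNIV (\<lambda>a. f (inv a))"
  unfolding smooth_from_def
proof clarify
  fix V \<phi> assume V: "(V, \<phi>) \<in> atlas G"
  show "smooth_on (\<phi> ` (UNIV \<inter> V)) (\<lambda>u. f (inv (inv_into V \<phi> u)))"
    using smooth_on_from_into(2)[OF chart_facts(2)[OF V] open_UNIV assms smooth_into_inv[OF chart_facts(2)[OF V] smooth_into_chart[OF V]]]
    by simp
qed

lemma Ad_one [simp]: "Ad G \<one> X = X"
proof -
  have "((\<lambda>v. coord G (\<one> \<otimes> param G v \<otimes> inv \<one>)) has_derivative (\<lambda>X. X)) (at e0)"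
    by (rule has_derivative_transform_within_open[OF has_derivative_ident open_cod0 e0_in_cod0]) simp
  from frechet_derivative_at[OF this] show ?thesis unfolding Ad_eq by metis
qed

lemma bracket_has_derivative:
  "((\<lambda>v. Ad G (param G v) Y) has_derivative (\<lambda>X. bracket G X Y)) (at e0)"
  using lderiv_has_derivative[OF open_UNIV Ad_smooth, of \<one> Y]
  by (simp add: lderiv_eq bracket_def e0_def[symmetric])

lemma bracket_linear_left: "linear (\<lambda>X. bracket G X Y)"
  using bracket_has_derivative has_derivative_linear by blast

lemma bracket_linear_right: "linear (\<lambda>Y. bracket G X Y)"
proof (rule linearI)
  show "bracket G X (Y + Z) = bracket G X Y + bracket G X Z" for Y Z
  proof -
    have "((\<lambda>v. Ad G (param G v) (Y + Z)) has_derivative (\<lambda>X. bracket G X Y + bracket G X Z)) (at e0)"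
      using has_derivative_add[OF bracket_has_derivative bracket_has_derivative, of Y Z]
      by (simp add: linear_add[OF Ad_linear])
    from has_derivative_unique[OF this bracket_has_derivative] show ?thesis by metis
  qed
  show "bracket G X (c *\<^sub>R Y) = c *\<^sub>R bracket G X Y" for c Y
  proof -
    have "((\<lambda>v. Ad G (param G v) (c *\<^sub>R Y)) has_derivative (\<lambda>X. c *\<^sub>R bracket G X Y)) (at e0)"
      using has_derivative_scaleR_right[OF bracket_has_derivative, of c Y]
      by (simp add: linear_scale[OF Ad_linear])
    from has_derivative_unique[OF this bracket_has_derivative] show ?thesis by metis
  qed
qed

lemma bracket_bilinear: "bilinear (bracket G)"
  unfolding bilinear_def using bracket_linear_left bracket_linear_right by blast

lemma conj_derivative_chain:
  assumes "(F has_derivative F') (at e0)"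
  shows "((\<lambda>v. F (coord G (a \<otimes> param G v \<otimes> inv a))) has_derivative (\<lambda>X. F' (Ad G a X))) (at e0)"
  using has_derivative_compose[OF Ad_has_derivative, of F F' a] assms by (simp add: e0_def[symmetric])

lemma lderiv_conj:
  assumes "open U" "smooth_from U f" "a \<otimes> b \<otimes> inv a \<in> U"
  shows "lderiv G X (\<lambda>b. f (a \<otimes> b \<otimes> inv a)) b = lderiv G (Ad G a X) f (a \<otimes> b \<otimes> inv a)"
proof -
  have *: "a \<otimes> b \<otimes> inv a \<otimes> (a \<otimes> p \<otimes> inv a) = a \<otimes> (b \<otimes> p) \<otimes> inv a" for p
    by (simp add: m_assoc)
  have "((\<lambda>v. f (a \<otimes> (b \<otimes> param G v) \<otimes> inv a)) has_derivative (\<lambda>X. lderiv G (Ad G a X) f (a \<otimes> b \<otimes> inv a))) (at e0)"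
    by (rule has_derivative_transform_within_open[OF conj_derivative_chain[OF lderiv_has_derivative[OF assms]] open_conj[OF open_dom0, of a]])
       (simp_all add: *)
  from lderiv_eqI[of "\<lambda>b. f (a \<otimes> b \<otimes> inv a)", OF this] show ?thesis .
qed

text \<open>Since \<open>a u v = a (u v u\<^sup>-\<^sup>1) u\<close>, differentiating in \<open>v\<close> and then in \<open>u\<close> gives
  \<open>X Y f = Y X f + [X, Y] f\<close>, the middle term by symmetry of the mixed partial derivatives.\<close>

lemma lderiv_commutator:
  fixes f :: "'g \<Rightarrow> 'b::euclidean_space"
  assumes "open U" "smooth_from U f" "a \<in> U"
  shows "lderiv G X (lderiv G Y f) a = lderiv G Y (lderiv G X f) a + lderiv G (bracket G X Y) f a"
proof -
  define F where "F = (\<lambda>z. f (a \<otimes> param G (fst z) \<otimes> param G (snd z)))"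
  let ?S = "{z\<in>cod0 \<times> cod0. a \<otimes> param G (fst z) \<otimes> param G (snd z) \<in> U}"
  have oS: "open (cod0 \<times> cod0)" using open_cod0 by (intro open_Times)
  have 1: "smooth_into (cod0 \<times> cod0) (\<lambda>z. param G (fst z))"
    by (rule smooth_into_compose[OF oS open_cod0 smooth_on_fst[OF oS smooth_on_id[OF oS]] _ smooth_into_param]) auto
  have 2: "smooth_into (cod0 \<times> cod0) (\<lambda>z. param G (snd z))"
    by (rule smooth_into_compose[OF oS open_cod0 smooth_on_snd[OF oS smooth_on_id[OF oS]] _ smooth_into_param]) auto
  have oF: "open ?S" and smF: "smooth_on ?S F"
    unfolding F_def
    using smooth_on_from_into[OF oS assms(1,2) smooth_into_mult[OF oS smooth_into_mult[OF oS smooth_into_const 1] 2]]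
    by auto
  have inS: "(e0, e0) \<in> ?S" using assms(3) by simp
  define P where "P W u = frechet_derivative F (at (e0, u)) (W, 0)" for W u
  have P: "frechet_derivative (\<lambda>w. F (w, u)) (at e0) W = P W u" if "(e0, u) \<in> ?S" for u W
    using frechet_derivative_at[OF partial_derivative_fst[OF smF that]] unfolding P_def by metis
  have Plin: "linear (\<lambda>W. P W u)" if "(e0, u) \<in> ?S" for u
    using has_derivative_linear[OF partial_derivative_fst[OF smF that]] unfolding P_def .
  have oN: "open {u. (e0, u) \<in> ?S}" by (rule smooth_on_slice_snd(1)[OF oF smF])
  have dP: "((\<lambda>u. P W u) has_derivative (\<lambda>X. frechet_derivative (P W) (at e0) X)) (at e0)" for W
    using smooth_on_has_derivative[OF smooth_on_slice_snd(2)[OF oF smooth_on_frechet_derivative[OF smF]], of e0 e0 "(W, 0)"] inS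
    unfolding P_def by simp
  have YX: "lderiv G Y (lderiv G X f) a = frechet_derivative (P Y) (at e0) X"
  proof -
    have "lderiv G Y (lderiv G X f) a = frechet_derivative (\<lambda>w. frechet_derivative (\<lambda>u. F (w, u)) (at e0) X) (at e0) Y"
      unfolding lderiv_eq F_def by simp
    also have "\<dots> = frechet_derivative (\<lambda>u. frechet_derivative (\<lambda>w. F (w, u)) (at e0) Y) (at e0) X"
      by (rule mixed_partials_commute[OF oF smF inS])
    also have "\<dots> = frechet_derivative (P Y) (at e0) X"
    proof -
      have "((\<lambda>u. frechet_derivative (\<lambda>w. F (w, u)) (at e0) Y) has_derivative frechet_derivative (P Y) (at e0)) (at e0)"
        by (rule has_derivative_transform_within_open[OF dP oN]) (use inS P in auto)
      from frechet_derivative_at[OF this] show ?thesis by simp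
    qed
    finally show ?thesis .
  qed
  have inner: "lderiv G Y f (a \<otimes> param G u) = P (Ad G (param G u) Y) u" if u: "(e0, u) \<in> ?S" for u
  proof -
    have *: "a \<otimes> (param G u \<otimes> p \<otimes> inv param G u) \<otimes> param G u = a \<otimes> param G u \<otimes> p" for p
      by (simp add: m_assoc)
    have "((\<lambda>w. F (w, u)) has_derivative (\<lambda>W. P W u)) (at e0)"
      using partial_derivative_fst[OF smF u] unfolding P_def .
    from conj_derivative_chain[OF this, of "param G u"]
    have "((\<lambda>v. f (a \<otimes> param G u \<otimes> param G v)) has_derivative (\<lambda>W. P (Ad G (param G u) W) u)) (at e0)"
      by (rule has_derivative_transform_within_open[OF _ open_conj[OF open_dom0, of "param G u"]])
         (simp_all add: F_def *)
    from lderiv_eqI[OF this] show ?thesis .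
  qed
  \<comment> \<open>In \<open>inner\<close> the variable u occurs both in the direction and in the
    base point. Expanding the direction in \<open>Basis\<close> gives a sum of products, whose two
    factors contribute the second derivative and the bracket term.\<close>
  have expand: "P W u = (\<Sum>b\<in>Basis. (W \<bullet> b) *\<^sub>R P b u)" if u: "(e0, u) \<in> ?S" for W u
  proof -
    have "P W u = P (\<Sum>b\<in>Basis. (W \<bullet> b) *\<^sub>R b) u" by (simp add: euclidean_representation)
    also have "\<dots> = (\<Sum>b\<in>Basis. (W \<bullet> b) *\<^sub>R P b u)"
      by (simp add: linear_sum[OF Plin[OF u]] linear_scale[OF Plin[OF u]])
    finally show ?thesis .
  qed
  have d0: "((\<lambda>u. Ad G (param G u) Y \<bullet> b) has_derivative (\<lambda>X. bracket G X Y \<bullet> b)) (at e0)" for b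
    by (rule has_derivative_inner_left[OF bracket_has_derivative])
  have d1: "((\<lambda>u. \<Sum>b\<in>Basis. (Ad G (param G u) Y \<bullet> b) *\<^sub>R P b u) has_derivative
     (\<lambda>X. \<Sum>b\<in>Basis. (Y \<bullet> b) *\<^sub>R frechet_derivative (P b) (at e0) X + (bracket G X Y \<bullet> b) *\<^sub>R P b e0)) (at e0)"
    using has_derivative_sum[of Basis, OF has_derivative_scaleR[OF d0 dP]] by simp
  have d2: "((\<lambda>u. lderiv G Y f (a \<otimes> param G u)) has_derivative
     (\<lambda>X. \<Sum>b\<in>Basis. (Y \<bullet> b) *\<^sub>R frechet_derivative (P b) (at e0) X + (bracket G X Y \<bullet> b) *\<^sub>R P b e0)) (at e0)"
    by (rule has_derivative_transform_within_open[OF d1 oN]) (use inS inner expand in auto)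
  have d3: "((\<lambda>u. P Y u) has_derivative (\<lambda>X. \<Sum>b\<in>Basis. (Y \<bullet> b) *\<^sub>R frechet_derivative (P b) (at e0) X)) (at e0)"
    by (rule has_derivative_transform_within_open[OF has_derivative_sum[OF has_derivative_scaleR_right[OF dP]] oN])
       (use inS expand[of _ Y] in auto)
  have "lderiv G X (lderiv G Y f) a =
     (\<Sum>b\<in>Basis. (Y \<bullet> b) *\<^sub>R frechet_derivative (P b) (at e0) X) + (\<Sum>b\<in>Basis. (bracket G X Y \<bullet> b) *\<^sub>R P b e0)"
    unfolding lderiv_eqI[OF d2] by (rule sum.distrib)
  also have "(\<Sum>b\<in>Basis. (Y \<bullet> b) *\<^sub>R frechet_derivative (P b) (at e0) X) = frechet_derivative (P Y) (at e0) X"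
    using frechet_derivative_at[OF d3] by metis
  also have "(\<Sum>b\<in>Basis. (bracket G X Y \<bullet> b) *\<^sub>R P b e0) = P (bracket G X Y) e0"
    by (rule expand[OF inS, symmetric])
  also have "\<dots> = lderiv G (bracket G X Y) f a"
    using P[OF inS] unfolding lderiv_eq F_def by simp
  finally show ?thesis unfolding YX .
qed

lemma bracket_coord: "bracket G X Y = lderiv G X (lderiv G Y (coord G)) \<one> - lderiv G Y (lderiv G X (coord G)) \<one>"
  using lderiv_commutator[OF open_dom0 smooth_from_coord one_in_dom0, of X Y] lderiv_coord_one by simp

lemma bracket_antisym: "bracket G X Y = - bracket G Y X"
  using bracket_coord[of X Y] bracket_coord[of Y X] by simp

lemma lderiv_bracket_deriv:
  fixes f :: "'g \<Rightarrow> 'b::euclidean_space"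
  assumes "open U" "smooth_from U f" "a \<in> U"
  shows "lderiv G Z (lderiv G (bracket G X Y) f) a =
    lderiv G Z (lderiv G X (lderiv G Y f)) a - lderiv G Z (lderiv G Y (lderiv G X f)) a"
proof -
  note sXY = lderiv_smooth[OF assms(1) lderiv_smooth[OF assms(1,2), of Y], of X]
  note sYX = lderiv_smooth[OF assms(1) lderiv_smooth[OF assms(1,2), of X], of Y]
  have e: "lderiv G (bracket G X Y) f x = lderiv G X (lderiv G Y f) x - lderiv G Y (lderiv G X f) x" if "x \<in> U" for x
    using lderiv_commutator[OF assms(1,2) that, of X Y] by simp
  have "lderiv G Z (lderiv G X (lderiv G Y f)) a - lderiv G Z (lderiv G Y (lderiv G X f)) a =
      lderiv G Z (\<lambda>x. lderiv G X (lderiv G Y f) x - lderiv G Y (lderiv G X f) x) a"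
    using lderiv_eqI[OF has_derivative_diff[OF lderiv_has_derivative[OF assms(1) sXY assms(3)]
          lderiv_has_derivative[OF assms(1) sYX assms(3)]]] by simp
  also have "\<dots> = lderiv G Z (lderiv G (bracket G X Y) f) a"
    by (rule lderiv_cong[OF assms(1) lderiv_smooth[OF assms(1,2)] e assms(3)])
  finally show ?thesis by simp
qed

text \<open>Every double bracket is a combination of four third derivatives of
  \<open>coord G\<close> at the identity, and the identity is their cancellation.\<close>

lemma jacobi:
  "bracket G X (bracket G Y Z) = bracket G (bracket G X Y) Z + bracket G Y (bracket G X Z)"
proof -
  let ?f = "coord G"
  note c = lderiv_commutator[OF open_dom0 _ one_in_dom0]
  note sf = smooth_from_coord
  note s1 = lderiv_smooth[OF open_dom0 sf]
  note b = lderiv_bracket_deriv[OF open_dom0 sf one_in_dom0]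
  have br: "bracket G A B = lderiv G (bracket G A B) ?f \<one>" for A B by (simp add: lderiv_coord_one)
  have e: "lderiv G (bracket G A B) (lderiv G D ?f) \<one> =
     lderiv G A (lderiv G B (lderiv G D ?f)) \<one> - lderiv G B (lderiv G A (lderiv G D ?f)) \<one>" for A B D
    using c[OF s1, of A B D] by simp
  have t: "bracket G A (bracket G B D) = lderiv G A (lderiv G B (lderiv G D ?f)) \<one> - lderiv G A (lderiv G D (lderiv G B ?f)) \<one>
     - (lderiv G B (lderiv G D (lderiv G A ?f)) \<one> - lderiv G D (lderiv G B (lderiv G A ?f)) \<one>)" for A B D
    unfolding bracket_coord[of A "bracket G B D"] b e ..
  show ?thesis
    unfolding bracket_antisym[of "bracket G X Y" Z] t by simp
qed

text \<open>Deriving \<open>coord G\<close> after conjugation along W is deriving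
  \<open>coord G\<close> along \<open>Ad G a W\<close>. Applied twice, this carries the commutator
  formula for \<open>bracket G X Y\<close> to the one for the images.\<close>

lemma bracket_Ad: "bracket G (Ad G a X) (Ad G a Y) = Ad G a (bracket G X Y)"
proof -
  let ?C = "\<lambda>b. a \<otimes> b \<otimes> inv a"
  let ?U = "{b. ?C b \<in> dom0}"
  have cont: "continuous_on UNIV ?C"
  proof -
    have "continuous_on UNIV (\<lambda>b. (a, b))" by (intro continuous_intros)
    from continuous_on_compose2[OF mult_continuous this] have 1: "continuous_on UNIV (\<lambda>b. a \<otimes> b)" by simp
    have "continuous_on UNIV (\<lambda>b. (a \<otimes> b, inv a))" by (intro continuous_intros 1)
    from continuous_on_compose2[OF mult_continuous this] show ?thesis by simp
  qed
  have oU: "open ?U" using open_preimage[OF open_UNIV cont open_dom0] by simp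
  have one: "\<one> \<in> ?U" by simp
  have smC: "smooth_from ?U (\<lambda>b. f (?C b))" if f: "smooth_from dom0 f" for f :: "'g \<Rightarrow> 'e"
    unfolding smooth_from_def
  proof clarify
    fix V \<phi> assume V: "(V, \<phi>) \<in> atlas G"
    note o = chart_facts(2)[OF V]
    have "smooth_into (\<phi> ` V) (\<lambda>u. a \<otimes> inv_into V \<phi> u \<otimes> inv a)"
      by (intro smooth_into_mult o smooth_into_const smooth_into_chart[OF V])
    from smooth_on_from_into(2)[OF o open_dom0 f this]
    show "smooth_on (\<phi> ` (?U \<inter> V)) (\<lambda>u. f (?C (inv_into V \<phi> u)))"
      unfolding chart_image_Int[OF V] by simp
  qed
  let ?f = "coord G"
  let ?g = "\<lambda>b. ?f (?C b)"
  have L: "lderiv G W (\<lambda>b. f (?C b)) b = lderiv G (Ad G a W) f (?C b)"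
    if "smooth_from dom0 f" "b \<in> ?U" for f :: "'g \<Rightarrow> 'e" and W b
    using lderiv_conj[OF open_dom0 that(1)] that(2) by simp
  note sf = smooth_from_coord
  have LL: "lderiv G W (lderiv G W' ?g) \<one> = lderiv G (Ad G a W) (lderiv G (Ad G a W') ?f) \<one>" for W W'
  proof -
    have "lderiv G W (lderiv G W' ?g) \<one> = lderiv G W (\<lambda>b. lderiv G (Ad G a W') ?f (?C b)) \<one>"
      by (rule lderiv_cong[OF oU smC[OF lderiv_smooth[OF open_dom0 sf]]]) (use L[OF sf] one in auto)
    also have "\<dots> = lderiv G (Ad G a W) (lderiv G (Ad G a W') ?f) \<one>"
      using L[OF lderiv_smooth[OF open_dom0 sf] one] by simp
    finally show ?thesis .
  qed
  have "lderiv G (bracket G X Y) ?g \<one> = lderiv G X (lderiv G Y ?g) \<one> - lderiv G Y (lderiv G X ?g) \<one>"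
    using lderiv_commutator[OF oU smC[OF sf] one, of X Y] by simp
  then show ?thesis
    unfolding LL bracket_coord[of "Ad G a X"] L[OF sf one] by (simp add: lderiv_coord_one)
qed

lemma Ad_mult: "Ad G (a \<otimes> b) X = Ad G a (Ad G b X)"
proof -
  have *: "a \<otimes> (b \<otimes> p \<otimes> inv b) \<otimes> inv a = a \<otimes> b \<otimes> p \<otimes> inv (a \<otimes> b)" for p
    by (simp add: m_assoc inv_mult_group)
  have "((\<lambda>v. coord G (a \<otimes> b \<otimes> param G v \<otimes> inv (a \<otimes> b))) has_derivative (\<lambda>X. Ad G a (Ad G b X))) (at e0)"
    by (rule has_derivative_transform_within_open[OF conj_derivative_chain[OF Ad_has_derivative[of a]] open_conj[OF open_dom0, of b]])
       (simp_all add: *)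
  from has_derivative_unique[OF this Ad_has_derivative] show ?thesis by metis
qed

lemma Ad_inv [simp]: "Ad G (inv a) (Ad G a X) = X" "Ad G a (Ad G (inv a) X) = X"
  using Ad_mult[of "inv a" a X] Ad_mult[of a "inv a" X] by simp_all

text \<open>At the identity the constant V, written as Ad(b) Ad(b^-1) V, is differentiated by the
  product rule, with the inner vector expanded in \<open>Basis\<close>. Since Ad((ab)^-1) W =
  Ad(b^-1) Ad(a^-1) W, a general point reduces to the identity.\<close>

lemma lderiv_Ad_inv: "lderiv G Z (\<lambda>b. Ad G (inv b) W) a = - bracket G Z (Ad G (inv a) W)"
proof -
  have sm: "smooth_from UNIV (\<lambda>b. Ad G (inv b) V)" for V by (rule smooth_from_inv[OF Ad_smooth])
  have at_one: "lderiv G Z (\<lambda>b. Ad G (inv b) V) \<one> = - bracket G Z V" for V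
  proof -
    have rep: "Ad G b V = (\<Sum>c\<in>Basis. (V \<bullet> c) *\<^sub>R Ad G b c)" for b V
      by (subst euclidean_representation[of V, symmetric])
         (simp only: linear_sum[OF Ad_linear] linear_scale[OF Ad_linear])
    note s2 = lderiv_bilinear[OF bounded_bilinear_scaleR open_UNIV _ Ad_smooth UNIV_I]
    have i: "smooth_from UNIV (\<lambda>b. Ad G (inv b) V \<bullet> c)" for c
      by (rule smooth_from_linear[OF bounded_linear_inner_left open_UNIV sm])
    have t: "smooth_from UNIV (\<lambda>b. (Ad G (inv b) V \<bullet> c) *\<^sub>R Ad G b c)" for c
      by (rule smooth_from_bilinear[OF bounded_bilinear_scaleR open_UNIV i Ad_smooth])
    have "V = (\<Sum>c\<in>Basis. (Ad G (inv b) V \<bullet> c) *\<^sub>R Ad G b c)" for b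
      using rep[of b "Ad G (inv b) V"] by simp
    then have "lderiv G Z (\<lambda>b. \<Sum>c\<in>Basis. (Ad G (inv b) V \<bullet> c) *\<^sub>R Ad G b c) \<one> = lderiv G Z (\<lambda>b. V) \<one>"
      by simp
    also have "lderiv G Z (\<lambda>b. \<Sum>c\<in>Basis. (Ad G (inv b) V \<bullet> c) *\<^sub>R Ad G b c) \<one> =
       (\<Sum>c\<in>Basis. lderiv G Z (\<lambda>b. (Ad G (inv b) V \<bullet> c) *\<^sub>R Ad G b c) \<one>)"
      by (rule lderiv_eqI[where X = Z], rule has_derivative_sum) (rule lderiv_has_derivative[OF open_UNIV t UNIV_I])
    also have "\<dots> = (\<Sum>c\<in>Basis. (V \<bullet> c) *\<^sub>R bracket G Z c + (lderiv G Z (\<lambda>b. Ad G (inv b) V) \<one> \<bullet> c) *\<^sub>R c)"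
    proof (rule sum.cong[OF refl])
      fix c :: 'e
      have b: "lderiv G Z (\<lambda>b. Ad G b c) \<one> = bracket G Z c"
        unfolding lderiv_eq bracket_def e0_def by simp
      show "lderiv G Z (\<lambda>b. (Ad G (inv b) V \<bullet> c) *\<^sub>R Ad G b c) \<one> =
        (V \<bullet> c) *\<^sub>R bracket G Z c + (lderiv G Z (\<lambda>b. Ad G (inv b) V) \<one> \<bullet> c) *\<^sub>R c"
        using s2[OF i] lderiv_linear_comp[OF bounded_linear_inner_left open_UNIV sm UNIV_I] b by simp
    qed
    also have "\<dots> = bracket G Z V + lderiv G Z (\<lambda>b. Ad G (inv b) V) \<one>"
      unfolding sum.distrib
      by (simp add: euclidean_representation linear_sum[OF bracket_linear_right, symmetric]
          linear_scale[OF bracket_linear_right, symmetric])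
    finally show ?thesis by (simp add: eq_neg_iff_add_eq_0 add.commute)
  qed
  have "Ad G (inv (a \<otimes> b)) W = Ad G (inv b) (Ad G (inv a) W)" for b
    by (simp add: inv_mult_group Ad_mult)
  then have "lderiv G Z (\<lambda>b. Ad G (inv b) W) a = lderiv G Z (\<lambda>b. Ad G (inv b) (Ad G (inv a) W)) \<one>"
    unfolding lderiv_eq by simp
  then show ?thesis using at_one by simp
qed

subsection \<open>One-parameter subgroups\<close>

lemma curve_derivative:
  fixes \<gamma> :: "real \<Rightarrow> 'g"
  assumes "continuous_on UNIV \<gamma>" "\<gamma> 0 = \<one>" "((\<lambda>s. coord G (\<gamma> s)) has_vector_derivative X) (at 0)"
    and "open U" "smooth_from U f" "a \<in> U"
  shows "((\<lambda>s. f (a \<otimes> \<gamma> s)) has_vector_derivative lderiv G X f a) (at 0)"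
proof -
  let ?T = "{s\<in>UNIV. \<gamma> s \<in> dom0}"
  have o: "open ?T" by (rule open_preimage[OF open_UNIV assms(1) open_dom0])
  have d: "((\<lambda>v. f (a \<otimes> param G v)) has_derivative (\<lambda>X. lderiv G X f a)) (at (coord G (\<gamma> 0)))"
    using lderiv_has_derivative[OF assms(4-6)] assms(2) by (simp add: e0_def)
  have "((\<lambda>s. f (a \<otimes> param G (coord G (\<gamma> s)))) has_derivative (\<lambda>r. lderiv G (r *\<^sub>R X) f a)) (at 0)"
    by (rule has_derivative_compose[OF assms(3)[unfolded has_vector_derivative_def] d])
  then have "((\<lambda>s. f (a \<otimes> \<gamma> s)) has_derivative (\<lambda>r. lderiv G (r *\<^sub>R X) f a)) (at 0)"
    by (rule has_derivative_transform_within_open[OF _ o]) (use assms(2) in auto)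
  then show ?thesis
    unfolding has_vector_derivative_def by (simp add: linear_scale[OF lderiv_linear[OF assms(4-6)]])
qed

lemma hom_zero:
  assumes "\<forall>s u. \<gamma> (s + u) = \<gamma> s \<otimes> \<gamma> u"
  shows "\<gamma> (0::real) = \<one>"
  using assms[rule_format, of 0 0] by (simp add: r_cancel_one')

end

subsection \<open>Invariant inner products of bounded groups\<close>

definition hs_square :: "('e::euclidean_space \<Rightarrow>\<^sub>L 'e) \<Rightarrow> real" where
  "hs_square P = (\<Sum>b\<in>Basis. (norm (blinfun_apply P b))\<^sup>2)"

lemma hs_nonneg: "hs_square P \<ge> 0"
  unfolding hs_square_def by (intro sum_nonneg) auto

lemma norm_le_hs: "norm (blinfun_apply P x) \<le> DIM('e) * sqrt (hs_square P) * norm x"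
  for P :: "'e::euclidean_space \<Rightarrow>\<^sub>L 'e"
proof -
  have b: "norm (blinfun_apply P b) \<le> sqrt (hs_square P)" if "b \<in> Basis" for b
    unfolding hs_square_def by (rule real_le_rsqrt, rule member_le_sum) (use that in auto)
  have "blinfun_apply P x = (\<Sum>b\<in>Basis. (x \<bullet> b) *\<^sub>R blinfun_apply P b)"
    by (subst euclidean_representation[of x, symmetric]) (simp only: blinfun.sum_right blinfun.scaleR_right)
  also have "norm \<dots> \<le> (\<Sum>b\<in>(Basis::'e set). norm x * sqrt (hs_square P))"
    by (rule sum_norm_le) (auto intro!: mult_mono b Basis_le_norm)
  finally show ?thesis by (simp add: mult.commute mult.left_commute)
qed

text \<open>The last term is the gain at a midpoint that makes the minimizer below unique.\<close>

lemma hs_parallelogram: "hs_square ((1/2) *\<^sub>R (P + R)) = hs_square P / 2 + hs_square R / 2 - hs_square (P - R) / 4"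
proof -
  have "(norm ((1/2) *\<^sub>R (u + v)))\<^sup>2 = (norm u)\<^sup>2 / 2 + (norm v)\<^sup>2 / 2 - (norm (u - v))\<^sup>2 / 4" for u v :: 'a
    unfolding power2_norm_eq_inner
    by (simp add: inner_add_left inner_add_right inner_diff_left inner_diff_right inner_commute[of v u] field_simps)
  then show ?thesis unfolding hs_square_def
    by (simp add: blinfun.bilinear_simps sum.distrib sum_subtractf sum_divide_distrib)
qed

lemma hs_eq_0: "hs_square P = 0 \<Longrightarrow> P = 0"
  using norm_le_hs[of P] by (intro blinfun_eqI) simp

text \<open>An operator P stands for the form sending x, y to P x \<bullet> y, and this is the
  pullback of that form along A. Bounded operators are used because they form a normed space in
  which closed bounded sets are compact.\<close>

definition pullback :: "('e::euclidean_space \<Rightarrow> 'e) \<Rightarrow> ('e \<Rightarrow>\<^sub>L 'e) \<Rightarrow> 'e \<Rightarrow>\<^sub>L 'e" where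
  "pullback A P = Blinfun (\<lambda>x. adjoint A (blinfun_apply P (A x)))"

lemma pull_apply:
  assumes "linear A"
  shows "blinfun_apply (pullback A P) x = adjoint A (blinfun_apply P (A x))"
proof -
  have "linear (\<lambda>x. adjoint A (blinfun_apply P (A x)))"
    using linear_compose[OF linear_compose[OF assms blinfun.bounded_linear_right[THEN bounded_linear.linear]] adjoint_linear[OF assms]]
    by (simp add: o_def)
  then show ?thesis
    unfolding pullback_def using bounded_linear_Blinfun_apply linear_conv_bounded_linear by metis
qed

lemma pull_inner: "linear A \<Longrightarrow> blinfun_apply (pullback A P) x \<bullet> y = blinfun_apply P (A x) \<bullet> A y"
  by (simp add: pull_apply adjoint_clauses)

lemma blinfun_eq_inner: "(\<And>x y. blinfun_apply P x \<bullet> y = blinfun_apply R x \<bullet> y) \<Longrightarrow> P = R"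
  by (intro blinfun_eqI) (metis vector_eq_rdot)

lemma pull_pull:
  assumes "linear A" "linear A'"
  shows "pullback A' (pullback A P) = pullback (A \<circ> A') P"
  by (rule blinfun_eq_inner) (simp add: pull_inner assms linear_compose)

text \<open>The fixed point is the unique minimizer, over the forms that are uniformly positive along
  the group, of the supremum of the Hilbert-Schmidt norm over the group orbit.\<close>

theorem invariant_inner_product:
  fixes S :: "('e::euclidean_space \<Rightarrow> 'e) set"
  assumes lin: "\<And>A. A \<in> S \<Longrightarrow> linear A"
    and id: "(\<lambda>x. x) \<in> S"
    and comp: "\<And>A A'. A \<in> S \<Longrightarrow> A' \<in> S \<Longrightarrow> A \<circ> A' \<in> S"
    and inv: "\<And>A. A \<in> S \<Longrightarrow> \<exists>A'\<in>S. A \<circ> A' = (\<lambda>x. x)"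
    and bnd: "\<And>A x. A \<in> S \<Longrightarrow> norm (A x) \<le> C * norm x"
  shows "\<exists>B. bilinear B \<and> (\<forall>x y. B x y = B y x) \<and> (\<forall>x. x \<noteq> 0 \<longrightarrow> B x x > (0::real)) \<and>
    (\<forall>A\<in>S. \<forall>x y. B (A x) (A y) = B x y)"
proof -
  have bnd': "\<exists>K>0. \<forall>A\<in>S. \<forall>x. norm (A x) \<le> K * norm x"
  proof (intro exI[of _ "\<bar>C\<bar> + 1"] conjI ballI allI)
    fix A x assume "A \<in> S"
    have "norm (A x) \<le> C * norm x" by (rule bnd) fact
    also have "\<dots> \<le> (\<bar>C\<bar> + 1) * norm x" by (intro mult_right_mono) auto
    finally show "norm (A x) \<le> (\<bar>C\<bar> + 1) * norm x" .
  qed auto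
  then obtain K where K: "K > 0" "\<And>A x. A \<in> S \<Longrightarrow> norm (A x) \<le> K * norm x" by blast
  have inv': "\<exists>A'\<in>S. (\<forall>x. A (A' x) = x) \<and> (\<forall>x. A' (A x) = x)" if A: "A \<in> S" for A
  proof -
    obtain A' where A': "A' \<in> S" "A \<circ> A' = (\<lambda>x. x)" using inv[OF A] by blast
    have "A' \<circ> A = id" using linear_inverse_left[OF lin[OF A] lin[OF A'(1)]] A'(2) by (simp add: id_def)
    then show ?thesis using A' by (auto simp: fun_eq_iff)
  qed
  \<comment> \<open>The lower bound by the squared norm, instead of bare positivity, keeps the set
    closed; demanding it along all of S makes the set stable under \<open>pullback\<close>.\<close>
  define PP where "PP = {P :: 'e \<Rightarrow>\<^sub>L 'e. (\<forall>x y. blinfun_apply P x \<bullet> y = x \<bullet> blinfun_apply P y) \<and>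
     (\<forall>A\<in>S. \<forall>x. blinfun_apply P (A x) \<bullet> A x \<ge> (norm x)\<^sup>2)}"
  define KK where "KK r = {P\<in>PP. \<forall>A\<in>S. hs_square (pullback A P) \<le> r}" for r
  have pullP: "pullback A P \<in> PP" if "A \<in> S" "P \<in> PP" for A P
  proof -
    have "blinfun_apply (pullback A P) x \<bullet> y = x \<bullet> blinfun_apply (pullback A P) y" for x y
      using that unfolding PP_def by (simp add: pull_inner[OF lin[OF that(1)]] inner_commute[of x])
         (metis inner_commute)
    moreover have "blinfun_apply (pullback A P) (A' x) \<bullet> A' x \<ge> (norm x)\<^sup>2" if "A' \<in> S" for A' x
      using comp[OF \<open>A \<in> S\<close> that] \<open>P \<in> PP\<close> unfolding PP_def by (auto simp: pull_inner[OF lin[OF \<open>A \<in> S\<close>]] o_def)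
    ultimately show ?thesis unfolding PP_def by blast
  qed
  have pullK: "pullback A P \<in> KK r" if "A \<in> S" "P \<in> KK r" for A P r
  proof -
    have "hs_square (pullback A' (pullback A P)) \<le> r" if "A' \<in> S" for A'
      using that \<open>P \<in> KK r\<close> comp[OF \<open>A \<in> S\<close> that] unfolding KK_def
      by (simp add: pull_pull[OF lin[OF \<open>A \<in> S\<close>] lin[OF that]])
    then show ?thesis using pullP[OF that(1)] that(2) unfolding KK_def by blast
  qed
  have pull_lin: "pullback A (P + R) = pullback A P + pullback A R" "pullback A (c *\<^sub>R P) = c *\<^sub>R pullback A P" "pullback A (P - R) = pullback A P - pullback A R"
    if "A \<in> S" for A P R c
    by (rule blinfun_eq_inner, simp add: pull_inner[OF lin[OF that]] blinfun.bilinear_simps inner_simps)+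
  have cont_pull: "continuous_on UNIV (\<lambda>P. hs_square (pullback A P))" if "A \<in> S" for A
    unfolding hs_square_def pull_apply[OF lin[OF that]]
    by (intro continuous_intros bounded_linear.continuous_on[OF linear_conv_bounded_linear[THEN iffD1, OF adjoint_linear[OF lin[OF that]]]])
  have closedK: "closed (KK r)" for r
  proof -
    have "KK r = (\<Inter>x. \<Inter>y. {P. blinfun_apply P x \<bullet> y = x \<bullet> blinfun_apply P y}) \<inter>
       (\<Inter>A\<in>S. \<Inter>x. {P. (norm x)\<^sup>2 \<le> blinfun_apply P (A x) \<bullet> A x}) \<inter> (\<Inter>A\<in>S. {P. hs_square (pullback A P) \<le> r})"
      unfolding KK_def PP_def by auto
    moreover have "closed (\<Inter>x. \<Inter>y. {P::'e \<Rightarrow>\<^sub>L 'e. blinfun_apply P x \<bullet> y = x \<bullet> blinfun_apply P y})"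
      by (intro closed_INT ballI closed_Collect_eq continuous_intros)
    moreover have "closed (\<Inter>A\<in>S. \<Inter>x. {P::'e \<Rightarrow>\<^sub>L 'e. (norm x)\<^sup>2 \<le> blinfun_apply P (A x) \<bullet> A x})"
      by (intro closed_INT ballI closed_Collect_le continuous_intros)
    moreover have "closed (\<Inter>A\<in>S. {P. hs_square (pullback A P) \<le> r})"
      by (intro closed_INT ballI closed_Collect_le cont_pull continuous_intros)
    ultimately show ?thesis by (simp only: closed_Int)
  qed
  have hsK: "hs_square P \<le> r" if "P \<in> KK r" for P r
  proof -
    have "pullback (\<lambda>x. x) P = P" by (rule blinfun_eq_inner) (simp add: pull_inner[OF lin[OF id]])
    then show ?thesis using that id unfolding KK_def by fastforce
  qed
  have boundedK: "bounded (KK r)" for r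
  proof (rule boundedI)
    fix P assume P: "P \<in> KK r"
    show "norm P \<le> DIM('e) * sqrt r"
    proof (rule norm_blinfun_bound)
      have "0 \<le> r" using hsK[OF P] hs_nonneg[of P] by simp
      then show "0 \<le> DIM('e) * sqrt r" by simp
      fix x
      have "norm (blinfun_apply P x) \<le> DIM('e) * sqrt (hs_square P) * norm x" by (rule norm_le_hs)
      also have "\<dots> \<le> DIM('e) * sqrt r * norm x" using hsK[OF P] by (intro mult_right_mono mult_left_mono) auto
      finally show "norm (blinfun_apply P x) \<le> DIM('e) * sqrt r * norm x" .
    qed
  qed
  have compK: "compact (KK r)" for r using closedK boundedK compact_eq_bounded_closed by blast
  have nonempty: "\<exists>r. KK r \<noteq> {}"
  proof -
    \<comment> \<open>A suitable multiple of the standard form: the inverse of A lies in S and is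
      bounded by K, so the norm of x is at most K times the norm of A x.\<close>
    define P where "P = K\<^sup>2 *\<^sub>R (id_blinfun :: 'e \<Rightarrow>\<^sub>L 'e)"
    have "P \<in> PP"
    proof -
      have "(norm x)\<^sup>2 \<le> blinfun_apply P (A x) \<bullet> A x" if A: "A \<in> S" for A x
      proof -
        obtain A' where A': "A' \<in> S" "A' (A x) = x" using inv'[OF A] by blast
        have "norm x \<le> K * norm (A x)" using K(2)[OF A'(1), of "A x"] A'(2) by simp
        then have "(norm x)\<^sup>2 \<le> (K * norm (A x))\<^sup>2" by (intro power_mono) auto
        then show ?thesis by (simp add: P_def blinfun.scaleR_left power_mult_distrib power2_norm_eq_inner)
      qed
      then show ?thesis unfolding PP_def by (simp add: P_def blinfun.scaleR_left)
    qed
    moreover have "hs_square (pullback A P) \<le> (\<Sum>b\<in>(Basis::'e set). (K\<^sup>2 * K * K)\<^sup>2)" if A: "A \<in> S" for A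
      unfolding hs_square_def
    proof (rule sum_mono, rule power_mono)
      fix b :: 'e assume b: "b \<in> Basis"
      let ?v = "blinfun_apply (pullback A P) b"
      have "norm ?v * norm ?v = K\<^sup>2 * (A b \<bullet> A ?v)"
        by (simp add: power2_norm_eq_inner[symmetric] power2_eq_square[symmetric])
           (simp add: power2_norm_eq_inner pull_inner[OF lin[OF A]] P_def blinfun.scaleR_left)
      also have "\<dots> \<le> K\<^sup>2 * ((K * norm b) * (K * norm ?v))"
        by (intro mult_left_mono order_trans[OF norm_cauchy_schwarz] mult_mono K(2) A) (use K(1) in auto)
      also have "\<dots> = (K\<^sup>2 * K * K) * norm ?v" using b by simp
      finally show "norm ?v \<le> K\<^sup>2 * K * K"
        using K(1) by (cases "norm ?v = 0") (auto dest: mult_right_le_imp_le)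
    qed auto
    ultimately show ?thesis unfolding KK_def by blast
  qed
  define R where "R = {r. KK r \<noteq> {}}"
  have R0: "r \<ge> 0" if "r \<in> R" for r using that hsK hs_nonneg order_trans unfolding R_def by blast
  have bb: "bdd_below R" using R0 by (rule bdd_belowI)
  have Rne: "R \<noteq> {}" using nonempty unfolding R_def by blast
  define m where "m = Inf R"
  have KKmono: "KK r \<subseteq> KK r'" if "r \<le> r'" for r r' using that unfolding KK_def by force
  \<comment> \<open>The sublevel sets are compact and nested, so the infimum m is attained.\<close>
  have "(\<Inter>n. KK (m + 1 / real (Suc n))) \<noteq> {}"
  proof (rule compact_nest)
    show "compact (KK (m + 1 / real (Suc n)))" for n by (rule compK)
    show "KK (m + 1 / real (Suc n)) \<noteq> {}" for n
    proof -
      have "Inf R < m + 1 / real (Suc n)" unfolding m_def by simp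
      then obtain r where "r \<in> R" "r < m + 1 / real (Suc n)" using cInf_less_iff[OF Rne bb] by blast
      then show ?thesis using KKmono[of r "m + 1 / real (Suc n)"] unfolding R_def by auto
    qed
    show "KK (m + 1 / real (Suc n)) \<subseteq> KK (m + 1 / real (Suc k))" if "k \<le> n" for k n
      by (rule KKmono) (use that in \<open>auto simp: field_simps\<close>)
  qed
  then obtain P where P': "\<And>n. P \<in> KK (m + 1 / real (Suc n))" by blast
  have P: "P \<in> KK m"
  proof -
    have "hs_square (pullback A P) \<le> m" if "A \<in> S" for A
    proof (rule field_le_epsilon)
      fix e :: real assume "e > 0"
      then obtain n where "1 / real (Suc n) < e" using nat_approx_posE by blast
      moreover have "hs_square (pullback A P) \<le> m + 1 / real (Suc n)" using P'[of n] that unfolding KK_def by blast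
      ultimately show "hs_square (pullback A P) \<le> m + e" by linarith
    qed
    then show ?thesis using P'[of 0] unfolding KK_def by blast
  qed
  have unique: "P1 = P2" if P12: "P1 \<in> KK m" "P2 \<in> KK m" for P1 P2
  proof -
    define D where "D = P1 - P2"
    define N where "N = real DIM('e)"
    define L where "L = N * (K * (N * K))\<^sup>2"
    have N: "N > 0" unfolding N_def by simp
    have L: "L > 0" unfolding L_def using N K(1) by simp
    \<comment> \<open>The inverse of A is again bounded by K, so pulling D back shrinks it at most
      by a factor L that is uniform in A. Hence the gain of \<open>hs_parallelogram\<close> survives
      the supremum over the orbit.\<close>
    have low: "hs_square D \<le> L * hs_square (pullback A D)" if A: "A \<in> S" for A
    proof -
      obtain A' where A': "A' \<in> S" "\<And>x. A (A' x) = x" using inv'[OF A] by blast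
      let ?h = "sqrt (hs_square (pullback A D))"
      have "norm (blinfun_apply D b) \<le> K * (N * K) * ?h" if b: "b \<in> Basis" for b
      proof -
        let ?v = "blinfun_apply D b"
        have "norm ?v * norm ?v = blinfun_apply (pullback A D) (A' b) \<bullet> A' ?v"
          by (simp add: power2_norm_eq_inner[symmetric] power2_eq_square[symmetric])
             (simp add: power2_norm_eq_inner pull_inner[OF lin[OF A]] A'(2))
        also have "\<dots> \<le> (N * ?h * norm (A' b)) * norm (A' ?v)"
          unfolding N_def by (intro order_trans[OF norm_cauchy_schwarz] mult_right_mono norm_le_hs) auto
        also have "\<dots> \<le> (N * ?h * (K * norm b)) * (K * norm ?v)"
          by (intro mult_mono mult_left_mono K(2) A'(1) order_refl) (use N K(1) hs_nonneg in \<open>auto intro!: mult_nonneg_nonneg\<close>)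
        also have "\<dots> = (K * (N * K) * ?h) * norm ?v" using b by simp
        finally show ?thesis
          using K(1) N hs_nonneg by (cases "norm ?v = 0") (auto dest: mult_right_le_imp_le intro!: mult_nonneg_nonneg)
      qed
      then have "hs_square D \<le> (\<Sum>b\<in>(Basis::'e set). (K * (N * K) * ?h)\<^sup>2)"
        unfolding hs_square_def by (intro sum_mono power_mono) auto
      also have "\<dots> = L * hs_square (pullback A D)"
        by (simp add: L_def N_def power_mult_distrib real_sqrt_pow2[OF hs_nonneg])
      finally show ?thesis .
    qed
    let ?M = "(1/2) *\<^sub>R (P1 + P2)"
    \<comment> \<open>The midpoint of two minimizers lies in a strictly lower sublevel set unless
      they coincide.\<close>
    have "?M \<in> KK (m - hs_square D / L / 4)"
    proof -
      have "?M \<in> PP"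
      proof -
        have "(norm x)\<^sup>2 \<le> blinfun_apply ?M (A x) \<bullet> A x" if "A \<in> S" for A x
        proof -
          have "(norm x)\<^sup>2 \<le> blinfun_apply P1 (A x) \<bullet> A x" "(norm x)\<^sup>2 \<le> blinfun_apply P2 (A x) \<bullet> A x"
            using P12 that unfolding KK_def PP_def by auto
          then show ?thesis by (simp add: blinfun.bilinear_simps inner_simps)
        qed
        moreover have "blinfun_apply ?M x \<bullet> y = x \<bullet> blinfun_apply ?M y" for x y
          using P12 unfolding KK_def PP_def by (simp add: blinfun.bilinear_simps inner_simps)
        ultimately show ?thesis unfolding PP_def by blast
      qed
      moreover have "hs_square (pullback A ?M) \<le> m - hs_square D / L / 4" if A: "A \<in> S" for A
      proof -
        have "hs_square D / L \<le> hs_square (pullback A D)" using low[OF A] L by (simp add: field_simps)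
        moreover have "hs_square (pullback A P1) \<le> m" "hs_square (pullback A P2) \<le> m" using P12 A unfolding KK_def by auto
        ultimately show ?thesis
          unfolding pull_lin[OF A] hs_parallelogram D_def by (simp add: field_simps)
      qed
      ultimately show ?thesis unfolding KK_def by blast
    qed
    then have "m - hs_square D / L / 4 \<in> R" unfolding R_def by blast
    then have "m \<le> m - hs_square D / L / 4" unfolding m_def using cInf_lower bb by blast
    then have "hs_square D / L \<le> 0" by simp
    then have "hs_square D \<le> 0" using L by (auto simp: divide_le_0_iff)
    then have "hs_square D = 0" using hs_nonneg[of D] by simp
    then show ?thesis using hs_eq_0 unfolding D_def by fastforce
  qed
  define B where "B x y = blinfun_apply P x \<bullet> y" for x y
  have "bilinear B" unfolding bilinear_def B_def
    by (auto intro!: linearI simp: blinfun.bilinear_simps inner_simps)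
  moreover have "B x y = B y x" for x y
    using P unfolding KK_def PP_def B_def by (auto simp: inner_commute)
  moreover have "B x x > 0" if "x \<noteq> 0" for x
  proof -
    have "(norm x)\<^sup>2 \<le> B x x" using P id unfolding KK_def PP_def B_def by auto
    moreover have "(norm x)\<^sup>2 > 0" using that by simp
    ultimately show ?thesis by linarith
  qed
  moreover have "B (A x) (A y) = B x y" if A: "A \<in> S" for A x y
    using unique[OF pullK[OF A P] P] pull_inner[OF lin[OF A], of P x y] unfolding B_def by simp
  ultimately show ?thesis by blast
qed

subsection \<open>Bilinear forms and dual bases\<close>

lemma bilinear_simps:
  fixes Q :: "'a::real_vector \<Rightarrow> 'b::real_vector \<Rightarrow> 'c::real_vector"
  assumes "bilinear Q"
  shows "Q (x + x') y = Q x y + Q x' y" "Q x (y + y') = Q x y + Q x y'"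
    "Q (c *\<^sub>R x) y = c *\<^sub>R Q x y" "Q x (c *\<^sub>R y) = c *\<^sub>R Q x y"
    "Q (- x) y = - Q x y" "Q x (- y) = - Q x y" "Q (x - x') y = Q x y - Q x' y" "Q x (y - y') = Q x y - Q x y'"
    "Q 0 y = 0" "Q x 0 = 0" "Q (sum g I) y = (\<Sum>i\<in>I. Q (g i) y)" "Q x (sum g' I) = (\<Sum>i\<in>I. Q x (g' i))"
proof -
  have "linear (\<lambda>x. Q x y)" "linear (Q x)" for x y using assms by (auto simp: bilinear_def)
  from linear_sum[OF this(1)] linear_sum[OF this(2)]
  show "Q (sum g I) y = (\<Sum>i\<in>I. Q (g i) y)" "Q x (sum g' I) = (\<Sum>i\<in>I. Q x (g' i))" by auto
qed (use assms in \<open>simp_all add: bilinear_ladd bilinear_radd bilinear_lmul bilinear_rmul bilinear_lneg bilinear_rneg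
      bilinear_lsub bilinear_rsub bilinear_lzero bilinear_rzero\<close>)

text \<open>An orthonormal set in V of maximal size spans V, since a nonzero Gram-Schmidt remainder
  could be normalised and added. Positivity is asked on V only: the lemma serves B on the whole
  algebra and Q on subspaces of the derived algebra.\<close>

lemma orthonormal_basis_exists:
  fixes B :: "'e::euclidean_space \<Rightarrow> 'e \<Rightarrow> real"
  assumes bil: "bilinear B" and sym: "\<And>x y. B x y = B y x"
    and V: "subspace V" and pos: "\<And>x. x \<in> V \<Longrightarrow> x \<noteq> 0 \<Longrightarrow> B x x > 0"
  shows "\<exists>D. finite D \<and> span D = V \<and> (\<forall>u\<in>D. \<forall>v\<in>D. B u v = (if u = v then 1 else 0))"
proof -
  note bs = bilinear_simps[OF bil]
  define ON where "ON D \<longleftrightarrow> D \<subseteq> V \<and> finite D \<and> (\<forall>u\<in>D. \<forall>v\<in>D. B u v = (if u = v then 1 else 0))" for D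
  have coeff: "B (\<Sum>d\<in>D. c d *\<^sub>R d) v = c v" if "ON D" "v \<in> D" for D c v
  proof -
    have "B (\<Sum>d\<in>D. c d *\<^sub>R d) v = (\<Sum>d\<in>D. if d = v then c d else 0)"
      unfolding bs by (rule sum.cong) (use that in \<open>auto simp: ON_def\<close>)
    then show ?thesis using that by (simp add: ON_def)
  qed
  have ind: "independent D" if D: "ON D" for D
  proof (rule independent_if_scalars_zero)
    show "finite D" using D by (simp add: ON_def)
    show "c x = 0" if "(\<Sum>x\<in>D. c x *\<^sub>R x) = 0" "x \<in> D" for c x
      using coeff[OF D that(2), of c] unfolding that(1) bs(9) by simp
  qed
  have "ON {}" unfolding ON_def by simp
  moreover have "\<forall>D. ON D \<longrightarrow> card D < Suc DIM('e)" using independent_bound[OF ind] by (simp add: less_Suc_eq_le)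
  ultimately have "\<exists>D. ON D \<and> (\<forall>D'. ON D' \<longrightarrow> card D' \<le> card D)" by (rule ex_has_greatest_nat)
  then obtain D where D: "ON D" and max: "\<And>D'. ON D' \<Longrightarrow> card D' \<le> card D" by blast
  have "V \<subseteq> span D"
  proof
    fix x assume x: "x \<in> V"
    define y where "y = x - (\<Sum>d\<in>D. B x d *\<^sub>R d)"
    have DV: "D \<subseteq> V" and fin: "finite D" using D by (auto simp: ON_def)
    have yV: "y \<in> V" unfolding y_def
      using x DV V by (intro subspace_diff subspace_sum subspace_scale) auto
    have orth: "B y d = 0" if "d \<in> D" for d
      unfolding y_def bs(7) coeff[OF D that] by simp
    have "y = 0"
    proof (rule ccontr)
      assume y: "y \<noteq> 0"
      define u where "u = (1 / sqrt (B y y)) *\<^sub>R y"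
      have p: "B y y > 0" by (rule pos[OF yV y])
      have uu: "B u u = 1" unfolding u_def bs(3,4) using p by simp
      have ud: "B u d = 0" if "d \<in> D" for d unfolding u_def bs(3,4) using orth[OF that] by simp
      have uV: "u \<in> V" unfolding u_def using yV V by (rule subspace_scale[rotated])
      have du: "B d u = 0" if "d \<in> D" for d using ud[OF that] sym[of d u] by simp
      have uD: "u \<notin> D" using ud[of u] uu by auto
      have "ON (insert u D)"
        using D uu ud du uV uD unfolding ON_def by auto
      then show False using max[of "insert u D"] fin uD by simp
    qed
    then have "x = (\<Sum>d\<in>D. B x d *\<^sub>R d)" unfolding y_def by simp
    also have "\<dots> \<in> span D" by (intro span_sum span_scale span_base)
    finally show "x \<in> span D" .
  qed
  moreover have "span D \<subseteq> V" using D V by (simp add: ON_def span_minimal)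
  ultimately show ?thesis using D unfolding ON_def by blast
qed

text \<open>A pair of bases replaces an orthonormal one because Q may be indefinite.\<close>

definition dual_bases :: "('e::real_vector \<Rightarrow> 'e \<Rightarrow> real) \<Rightarrow> 'i set \<Rightarrow> ('i \<Rightarrow> 'e) \<Rightarrow> ('i \<Rightarrow> 'e) \<Rightarrow> 'e set \<Rightarrow> bool" where
  "dual_bases Q I e f V \<longleftrightarrow> finite I \<and> span (e ` I) = V \<and> span (f ` I) = V \<and>
     (\<forall>i\<in>I. \<forall>j\<in>I. Q (e i) (f j) = (if i = j then 1 else 0))"

lemma dual_bases_expand_left:
  fixes Q :: "'e::real_vector \<Rightarrow> 'e \<Rightarrow> real"
  assumes bil: "bilinear Q" and d: "dual_bases Q I e f V" and x: "x \<in> V"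
  shows "x = (\<Sum>i\<in>I. Q x (f i) *\<^sub>R e i)"
proof -
  have "x \<in> span (e ` I)" using d x by (simp add: dual_bases_def)
  then show ?thesis
  proof (induction rule: span_induct_alt)
    case base
    then show ?case by (simp add: bilinear_simps[OF bil])
  next
    case (step c x y)
    then obtain j where j: "j \<in> I" "x = e j" by blast
    have "(\<Sum>i\<in>I. Q (e j) (f i) *\<^sub>R e i) = (\<Sum>i\<in>I. if i = j then e i else 0)"
      by (rule sum.cong) (use d j in \<open>auto simp: dual_bases_def\<close>)
    also have "\<dots> = e j" using d j by (simp add: dual_bases_def)
    finally have ej: "(\<Sum>i\<in>I. Q (e j) (f i) *\<^sub>R e i) = e j" .
    have "(\<Sum>i\<in>I. Q (c *\<^sub>R x + y) (f i) *\<^sub>R e i) = c *\<^sub>R (\<Sum>i\<in>I. Q (e j) (f i) *\<^sub>R e i) + (\<Sum>i\<in>I. Q y (f i) *\<^sub>R e i)"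
      by (simp add: bilinear_simps[OF bil] j scaleR_add_left sum.distrib scaleR_sum_right)
    then show ?case using ej step(2) j by simp
  qed
qed

lemma dual_bases_sym:
  assumes "\<And>x y. Q x y = Q y x" "dual_bases Q I e f V"
  shows "dual_bases Q I f e V"
  using assms unfolding dual_bases_def by (metis (no_types, lifting))

lemma dual_bases_expand_right:
  fixes Q :: "'e::real_vector \<Rightarrow> 'e \<Rightarrow> real"
  assumes "bilinear Q" "\<And>x y. Q x y = Q y x" "dual_bases Q I e f V" "x \<in> V"
  shows "x = (\<Sum>i\<in>I. Q x (e i) *\<^sub>R f i)"
  by (rule dual_bases_expand_left[OF assms(1) dual_bases_sym[OF assms(2,3)] assms(4)])

lemma dual_bases_form_left:
  fixes Q :: "'e::real_vector \<Rightarrow> 'e \<Rightarrow> real"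
  assumes "bilinear Q" "dual_bases Q I e f V" "x \<in> V"
  shows "Q x y = (\<Sum>i\<in>I. Q x (f i) * Q (e i) y)"
  by (subst dual_bases_expand_left[OF assms]) (simp add: bilinear_simps[OF assms(1)])

lemma dual_bases_mem:
  "dual_bases Q I e f V \<Longrightarrow> i \<in> I \<Longrightarrow> e i \<in> V \<and> f i \<in> V"
  unfolding dual_bases_def using span_base by blast

text \<open>The tensor sum of e_i and f_i is intrinsic to Q on V. It is used to replace dual bases
  by their images under Ad.\<close>

lemma dual_bases_sum_independent:
  fixes Q :: "'e::real_vector \<Rightarrow> 'e \<Rightarrow> real" and \<beta> :: "'e \<Rightarrow> 'e \<Rightarrow> 'v::real_vector"
  assumes "bilinear Q" and sym: "\<And>x y. Q x y = Q y x"
    and "dual_bases Q I e f V" "dual_bases Q J u v V" and \<beta>: "bilinear \<beta>"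
  shows "(\<Sum>i\<in>I. \<beta> (e i) (f i)) = (\<Sum>j\<in>J. \<beta> (u j) (v j))"
proof -
  note bs = bilinear_simps[OF \<beta>]
  have "(\<Sum>i\<in>I. \<beta> (e i) (f i)) = (\<Sum>i\<in>I. \<Sum>j\<in>J. Q (f i) (u j) *\<^sub>R \<beta> (e i) (v j))"
  proof (rule sum.cong[OF refl])
    fix i assume "i \<in> I"
    then have "f i \<in> V" using dual_bases_mem[OF assms(3)] by blast
    from arg_cong[OF dual_bases_expand_right[OF assms(1) sym assms(4) this], of "\<beta> (e i)"]
    show "\<beta> (e i) (f i) = (\<Sum>j\<in>J. Q (f i) (u j) *\<^sub>R \<beta> (e i) (v j))" by (simp add: bs)
  qed
  also have "\<dots> = (\<Sum>j\<in>J. \<Sum>i\<in>I. Q (f i) (u j) *\<^sub>R \<beta> (e i) (v j))" by (rule sum.swap)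
  also have "\<dots> = (\<Sum>j\<in>J. \<beta> (u j) (v j))"
  proof (rule sum.cong[OF refl])
    fix j assume "j \<in> J"
    then have "u j \<in> V" using dual_bases_mem[OF assms(4)] by blast
    from arg_cong[OF dual_bases_expand_left[OF assms(1,3) this], of "\<lambda>w. \<beta> w (v j)"]
    show "(\<Sum>i\<in>I. Q (f i) (u j) *\<^sub>R \<beta> (e i) (v j)) = \<beta> (u j) (v j)" by (simp add: bs sym[of "u j"])
  qed
  finally show ?thesis .
qed

text \<open>Both sides are the trace of A on V, written in dual bases of two different
  forms.\<close>

lemma trace_independent:
  fixes Q B :: "'e::real_vector \<Rightarrow> 'e \<Rightarrow> real"
  assumes "bilinear Q" "bilinear B" "dual_bases Q I e f V" "dual_bases B J u v V"
    and sym: "\<And>x y. Q x y = Q y x" and A: "linear A" "A ` V \<subseteq> V"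
  shows "(\<Sum>i\<in>I. Q (A (f i)) (e i)) = (\<Sum>j\<in>J. B (A (u j)) (v j))"
proof -
  have "(\<Sum>i\<in>I. Q (A (f i)) (e i)) = (\<Sum>i\<in>I. \<Sum>j\<in>J. B (f i) (v j) * Q (A (u j)) (e i))"
  proof (rule sum.cong[OF refl])
    fix i assume "i \<in> I"
    then have "f i \<in> V" using dual_bases_mem[OF assms(3)] by blast
    then show "Q (A (f i)) (e i) = (\<Sum>j\<in>J. B (f i) (v j) * Q (A (u j)) (e i))"
      by (subst dual_bases_expand_left[OF assms(2,4)])
         (simp_all add: linear_sum[OF A(1)] linear_scale[OF A(1)] bilinear_simps[OF assms(1)])
  qed
  also have "\<dots> = (\<Sum>j\<in>J. \<Sum>i\<in>I. B (f i) (v j) * Q (A (u j)) (e i))" by (rule sum.swap)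
  also have "\<dots> = (\<Sum>j\<in>J. B (A (u j)) (v j))"
  proof (rule sum.cong[OF refl])
    fix j assume "j \<in> J"
    then have "A (u j) \<in> V" using dual_bases_mem[OF assms(4)] A(2) by blast
    then show "(\<Sum>i\<in>I. B (f i) (v j) * Q (A (u j)) (e i)) = B (A (u j)) (v j)"
      by (subst (2) dual_bases_expand_right[OF assms(1) sym assms(3)])
         (simp_all add: bilinear_simps[OF assms(2)] mult.commute)
  qed
  finally show ?thesis .
qed

subsection \<open>Lie algebras with an invariant inner product and an invariant quadratic form\<close>

text \<open>Two invariant forms are kept side by side: Q, which extends the metric and may be
  indefinite, defines the Casimir operator, while the positive form B, supplied by compactness,
  determines the signs of traces.\<close>

locale quadratic_lie_algebra =
  fixes br :: "'e::euclidean_space \<Rightarrow> 'e \<Rightarrow> 'e" and Q B :: "'e \<Rightarrow> 'e \<Rightarrow> real"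
  assumes br_bil: "bilinear br" and br_anti: "br x y = - br y x"
    and br_jacobi: "br x (br y z) = br (br x y) z + br y (br x z)"
    and Q_bil: "bilinear Q" and Q_sym: "Q x y = Q y x" and Q_nondeg: "(\<And>y. Q x y = 0) \<Longrightarrow> x = 0"
    and Q_inv: "Q (br x y) z = - Q y (br x z)"
    and B_bil: "bilinear B" and B_sym: "B x y = B y x" and B_pos: "x \<noteq> 0 \<Longrightarrow> B x x > 0"
    and B_inv: "B (br x y) z = - B y (br x z)"
begin

lemmas brs = bilinear_simps[OF br_bil] and Qs = bilinear_simps[OF Q_bil] and Bs = bilinear_simps[OF B_bil]

definition derived :: "'e set" where "derived = span {br x y |x y. True}"

definition central :: "'e \<Rightarrow> bool" where "central x \<longleftrightarrow> (\<forall>y. br x y = 0)"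

lemma subspace_derived: "subspace derived"
  unfolding derived_def by (rule subspace_span)

lemma br_in_derived [simp]: "br x y \<in> derived"
  unfolding derived_def by (rule span_base) blast

lemma Q_inv': "Q (br x y) z = Q x (br y z)"
  using Q_inv[of y x z] by (simp add: br_anti[of x y] Qs)

lemma B_inv': "B (br x y) z = B x (br y z)"
  using B_inv[of y x z] by (simp add: br_anti[of x y] Bs)

lemma central_orth_derived:
  assumes "central w" "x \<in> derived"
  shows "Q w x = 0" "B w x = 0"
proof -
  have "Q w x = 0 \<and> B w x = 0"
    using assms(2) unfolding derived_def
  proof (induction rule: span_induct_alt)
    case base
    show ?case by (simp add: Qs Bs)
  next
    case (step c x y)
    then obtain u v where x: "x = br u v" by blast
    have "Q w x = 0" "B w x = 0"
      using Q_inv'[of w u v] B_inv'[of w u v] assms(1) by (simp_all add: x central_def Qs Bs)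
    then show ?case using step by (simp add: Qs Bs)
  qed
  then show "Q w x = 0" "B w x = 0" by auto
qed

text \<open>Here the definiteness of B matters: with an indefinite invariant form alone the centre
  can meet the derived algebra.\<close>

lemma central_derived_0: "central w \<Longrightarrow> w \<in> derived \<Longrightarrow> w = 0"
  using central_orth_derived(2)[of w w] B_pos[of w] by force

lemma orth_derived_central:
  assumes "\<And>x. x \<in> derived \<Longrightarrow> Q w x = 0"
  shows "central w"
  unfolding central_def
proof
  fix y
  show "br w y = 0" by (rule Q_nondeg) (simp add: Q_inv' assms)
qed

text \<open>The sign makes the operator non-negative when Q is positive definite.\<close>

definition casimir :: "'i set \<Rightarrow> ('i \<Rightarrow> 'e) \<Rightarrow> ('i \<Rightarrow> 'e) \<Rightarrow> 'e \<Rightarrow> 'e" where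
  "casimir I e f x = - (\<Sum>i\<in>I. br (e i) (br (f i) x))"

lemma casimir_linear: "linear (casimir I e f)"
  unfolding casimir_def
  by (rule linearI) (simp_all add: brs sum.distrib scaleR_sum_right)

lemma casimir_derived: "casimir I e f x \<in> derived"
  unfolding casimir_def by (intro subspace_neg subspace_sum subspace_derived) simp

text \<open>By invariance \<open>Q (casimir I e f x) y\<close> is minus the trace of ad y ad x, the
  negative of the Killing form. The trace may be taken in a B-orthonormal basis instead, where ad is
  skew, so the form is visibly non-negative with kernel the centre.\<close>

lemma killing_orthonormal:
  assumes d: "dual_bases Q I e f UNIV"
  obtains D where "\<And>x y. Q (casimir I e f x) y = (\<Sum>d\<in>D. B (br x d) (br y d))"
    "\<And>x. (\<Sum>d\<in>D. B (br x d) (br x d)) \<ge> 0"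
    "\<And>x. (\<Sum>d\<in>D. B (br x d) (br x d)) = 0 \<Longrightarrow> central x"
proof -
  obtain D where D: "finite D" "span D = UNIV" "\<forall>u\<in>D. \<forall>v\<in>D. B u v = (if u = v then 1 else 0)"
    using orthonormal_basis_exists[OF B_bil B_sym subspace_UNIV] B_pos by blast
  have dB: "dual_bases B D (\<lambda>d. d) (\<lambda>d. d) UNIV" using D by (simp add: dual_bases_def)
  have 1: "Q (casimir I e f x) y = (\<Sum>d\<in>D. B (br x d) (br y d))" for x y
  proof -
    have lin: "linear (\<lambda>v. - br y (br x v))" by (rule linearI) (simp_all add: brs)
    have "Q (casimir I e f x) y = (\<Sum>i\<in>I. Q (- br y (br x (f i))) (e i))"
      unfolding casimir_def Qs sum_negf[symmetric]
    proof (rule sum.cong[OF refl])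
      fix i
      have "- Q (br (e i) (br (f i) x)) y = Q (br (f i) x) (br (e i) y)" by (simp add: Q_inv)
      also have "\<dots> = Q (br x (f i)) (br y (e i))"
        by (simp add: br_anti[of "f i"] br_anti[of "e i"] Qs)
      also have "\<dots> = - Q (br y (br x (f i))) (e i)" by (simp add: Q_inv)
      finally show "- Q (br (e i) (br (f i) x)) y = - Q (br y (br x (f i))) (e i)" .
    qed
    also have "\<dots> = (\<Sum>d\<in>D. B (- br y (br x d)) d)"
      by (rule trace_independent[OF Q_bil B_bil d dB Q_sym lin]) auto
    also have "\<dots> = (\<Sum>d\<in>D. B (br x d) (br y d))" by (simp add: Bs B_inv)
    finally show ?thesis .
  qed
  have nn: "B v v \<ge> 0" for v using B_pos[of v] by (cases "v = 0") (auto simp: Bs)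
  have 2: "(\<Sum>d\<in>D. B (br x d) (br x d)) \<ge> 0" for x by (intro sum_nonneg nn)
  have 3: "central x" if "(\<Sum>d\<in>D. B (br x d) (br x d)) = 0" for x
  proof -
    have "\<forall>d\<in>D. B (br x d) (br x d) = 0" using sum_nonneg_eq_0_iff[OF D(1) nn] that by blast
    then have "\<And>d. d \<in> D \<Longrightarrow> br x d = 0" using B_pos by fastforce
    then have "br x y = 0" for y
      using linear_eq_0_on_span[of "br x" D y] br_bil D(2) by (auto simp: bilinear_def)
    then show ?thesis by (simp add: central_def)
  qed
  show thesis by (rule that[OF 1 2 3])
qed

text \<open>The minimum \<open>c\<close> of the quotient of \<open>Q\<close> by the Killing form on the derived algebra is attained at
  an eigenvector of the Casimir operator with eigenvalue \<open>1 / c\<close>.\<close>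

lemma Q_positive_on_derived:
  assumes d: "dual_bases Q I e f UNIV"
    and noneg: "\<And>W \<mu>. W \<in> derived \<Longrightarrow> \<mu> < 0 \<Longrightarrow> casimir I e f W = \<mu> *\<^sub>R W \<Longrightarrow> W = 0"
    and x: "x \<in> derived" "x \<noteq> 0"
  shows "Q x x > 0"
proof -
  obtain D where kil: "\<And>x y. Q (casimir I e f x) y = (\<Sum>d\<in>D. B (br x d) (br y d))"
    and nn: "\<And>x. (\<Sum>d\<in>D. B (br x d) (br x d)) \<ge> 0"
    and z: "\<And>x. (\<Sum>d\<in>D. B (br x d) (br x d)) = 0 \<Longrightarrow> central x"
    by (rule killing_orthonormal[OF d]) (rule that; assumption)
  let ?E = "casimir I e f"
  define k where "k x y = Q (?E x) y" for x y
  have kbil: "bilinear k" unfolding k_def bilinear_def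
    by (auto intro!: linearI simp: Qs linear_add[OF casimir_linear] linear_scale[OF casimir_linear])
  note ks = bilinear_simps[OF kbil]
  have ksym: "k x y = k y x" for x y unfolding k_def kil by (simp add: B_sym)
  have knn: "k x x \<ge> 0" for x unfolding k_def kil by (rule nn)
  have kpos: "k x x > 0" if "x \<in> derived" "x \<noteq> 0" for x
    using knn[of x] z[of x] central_derived_0[of x] that unfolding k_def kil by fastforce
  let ?S = "{x\<in>derived. norm x = 1}"
  have cQ: "continuous_on UNIV (\<lambda>x. Q x x)" and ck: "continuous_on UNIV (\<lambda>x. k x x)"
    using bilinear_continuous_on_compose[OF continuous_on_id continuous_on_id] Q_bil kbil by auto
  have comp: "compact ?S"
  proof -
    have "?S = derived \<inter> sphere 0 1" by auto
    then show ?thesis using closed_Int_compact[OF closed_subspace[OF subspace_derived] compact_sphere] by simp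
  qed
  have ne: "?S \<noteq> {}"
  proof -
    have "(1 / norm x) *\<^sub>R x \<in> ?S" using x subspace_derived by (auto simp: subspace_scale)
    then show ?thesis by blast
  qed
  have "continuous_on ?S (\<lambda>x. Q x x / k x x)"
    by (intro continuous_on_divide continuous_on_subset[OF cQ] continuous_on_subset[OF ck]) (use kpos in force)+
  then obtain W where W: "W \<in> ?S" and min: "\<And>y. y \<in> ?S \<Longrightarrow> Q W W / k W W \<le> Q y y / k y y"
    using continuous_attains_inf[OF comp ne] by blast
  define c where "c = Q W W / k W W"
  have Wd: "W \<in> derived" "W \<noteq> 0" using W by auto
  \<comment> \<open>As c is the minimum of the quotient, R is positive semidefinite on the derived
    algebra and vanishes on the pair W, W; so W is R-orthogonal to the whole derived
    algebra.\<close>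
  define R where "R x y = Q x y - c * k x y" for x y
  have Rbil: "bilinear R" unfolding R_def bilinear_def
    by (auto intro!: linearI simp: Qs ks algebra_simps)
  note Rs = bilinear_simps[OF Rbil]
  have Rsym: "R x y = R y x" for x y unfolding R_def using Q_sym[of x y] ksym[of x y] by simp
  have Rnn: "R y y \<ge> 0" if y: "y \<in> derived" for y
  proof (cases "y = 0")
    case False
    let ?y = "(1 / norm y) *\<^sub>R y"
    have "?y \<in> ?S" using y False subspace_derived by (auto simp: subspace_scale)
    from min[OF this] have "c \<le> Q y y / k y y" using False by (simp add: c_def Qs ks)
    then show ?thesis using kpos[OF y False] by (simp add: R_def field_simps)
  qed (simp add: Rs)
  have RW: "R W W = 0" unfolding R_def c_def using kpos[OF Wd] by simp
  have RWy: "R W y = 0" if y: "y \<in> derived" for y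
  proof (rule ccontr)
    assume a: "R W y \<noteq> 0"
    \<comment> \<open>Close to the minimizer of the quadratic polynomial s -> R(W + s y, W + s y);
      the 1 avoids a vanishing denominator.\<close>
    define s where "s = - R W y / (R y y + 1)"
    have p: "R y y + 1 > 0" using Rnn[OF y] by simp
    have "W + s *\<^sub>R y \<in> derived" using Wd y subspace_derived by (simp add: subspace_add subspace_scale)
    from Rnn[OF this] have "0 \<le> 2 * s * R W y + s\<^sup>2 * R y y"
      using RW by (simp add: Rs Rsym[of y W] power2_eq_square algebra_simps)
    then have "0 \<le> (2 * s * R W y + s\<^sup>2 * R y y) * (R y y + 1)\<^sup>2" by simp
    also have "\<dots> = 2 * (s * (R y y + 1)) * R W y * (R y y + 1) + (s * (R y y + 1))\<^sup>2 * R y y"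
      by (simp add: power2_eq_square algebra_simps)
    also have "s * (R y y + 1) = - R W y" unfolding s_def using p by simp
    also have "2 * - R W y * R W y * (R y y + 1) + (- R W y)\<^sup>2 * R y y = - ((R W y)\<^sup>2 * (R y y + 2))"
      by (simp add: power2_eq_square algebra_simps)
    also have "\<dots> < 0" using a Rnn[OF y] by (simp add: zero_less_mult_iff add_nonneg_pos)
    finally show False by simp
  qed
  \<comment> \<open>By \<open>RWy\<close> the difference is Q-orthogonal to the derived algebra,
    hence central; it also lies in the derived algebra, so it is zero.\<close>
  have eig: "W = c *\<^sub>R ?E W"
  proof -
    have "W - c *\<^sub>R ?E W \<in> derived"
      by (intro subspace_diff subspace_scale subspace_derived Wd casimir_derived)
    moreover have "central (W - c *\<^sub>R ?E W)"
      by (rule orth_derived_central) (use RWy in \<open>simp add: R_def k_def Qs\<close>)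
    ultimately show ?thesis using central_derived_0 by fastforce
  qed
  have "c \<noteq> 0" using eig Wd by auto
  have "c > 0"
  proof (rule ccontr)
    assume "\<not> c > 0"
    then have "c < 0" using \<open>c \<noteq> 0\<close> by simp
    moreover have "?E W = (1 / c) *\<^sub>R W" by (subst (2) eig) (use \<open>c \<noteq> 0\<close> in simp)
    ultimately show False using noneg[OF Wd(1), of "1 / c"] Wd(2) by simp
  qed
  then have "0 < c * k x x" using kpos[OF x] by simp
  then show ?thesis using Rnn[OF x(1)] by (simp add: R_def)
qed

text \<open>A bilinear expression contracted over projected dual bases collapses to a sum over the
  orthonormal set D. Dual bases of an indefinite form, whose terms have no sign, are thus traded for
  vectors whose terms become squares.\<close>

lemma bracket_square_projection:
  assumes d: "dual_bases Q I e f V" and D: "finite D" "D \<subseteq> V" "\<forall>u\<in>D. \<forall>v\<in>D. Q u v = (if u = v then 1 else 0)"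
    and p: "\<And>x y. x \<in> V \<Longrightarrow> y \<in> V \<Longrightarrow> br x y = br (\<Sum>d\<in>D. Q x d *\<^sub>R d) y"
  shows "(\<Sum>a\<in>I. \<Sum>b\<in>I. Q (br (e a) (e b)) (br (f a) (f b))) = (\<Sum>u\<in>D. \<Sum>v\<in>D. Q (br u v) (br u v))"
proof -
  define pr where "pr x = (\<Sum>d\<in>D. Q x d *\<^sub>R d)" for x
  have prD: "pr u = u" if "u \<in> D" for u
  proof -
    have "pr u = (\<Sum>d\<in>D. if d = u then d else 0)" unfolding pr_def
      by (rule sum.cong) (use D that in auto)
    then show ?thesis using that D(1) by simp
  qed
  have V: "subspace V" using d unfolding dual_bases_def by (metis subspace_span)
  have prV: "pr x \<in> V" for x unfolding pr_def using D(2) V by (intro subspace_sum subspace_scale) auto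
  have pp: "br x y = br (pr x) (pr y)" if "x \<in> V" "y \<in> V" for x y
    using p[OF that] p[OF that(2) prV, of x] br_anti[of "pr x" y] br_anti[of "pr y" "pr x"] by (simp add: pr_def)
  have step: "(\<Sum>a\<in>I. \<beta> (pr (e a)) (pr (f a))) = (\<Sum>u\<in>D. \<beta> u u)" if \<beta>: "bilinear \<beta>" for \<beta> :: "'e \<Rightarrow> 'e \<Rightarrow> real"
  proof -
    note bs = bilinear_simps[OF \<beta>]
    have "(\<Sum>a\<in>I. \<beta> (pr (e a)) (pr (f a))) = (\<Sum>a\<in>I. \<Sum>u\<in>D. Q (f a) u * \<beta> (pr (e a)) u)"
      unfolding pr_def[of "f _"] by (simp add: bs)
    also have "\<dots> = (\<Sum>u\<in>D. \<Sum>a\<in>I. Q (f a) u * \<beta> (pr (e a)) u)" by (rule sum.swap)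
    also have "\<dots> = (\<Sum>u\<in>D. \<beta> (pr u) u)"
    proof (rule sum.cong[OF refl])
      fix u assume u: "u \<in> D"
      have lin: "linear pr" unfolding pr_def by (rule linearI) (simp_all add: Qs scaleR_add_left sum.distrib scaleR_sum_right)
      have "pr u = (\<Sum>a\<in>I. Q u (f a) *\<^sub>R pr (e a))"
        using arg_cong[OF dual_bases_expand_left[OF Q_bil d, of u], of pr] u D(2)
        by (auto simp: linear_sum[OF lin] linear_scale[OF lin])
      then have "\<beta> (pr u) u = (\<Sum>a\<in>I. Q u (f a) * \<beta> (pr (e a)) u)" by (simp add: bs)
      then show "(\<Sum>a\<in>I. Q (f a) u * \<beta> (pr (e a)) u) = \<beta> (pr u) u" by (simp add: Q_sym[of u])
    qed
    finally show ?thesis using prD by simp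
  qed
  have eq: "Q (br (e a) (e b)) (br (f a) (f b)) = Q (br (pr (e a)) (pr (e b))) (br (pr (f a)) (pr (f b)))"
    if "a \<in> I" "b \<in> I" for a b
    using pp dual_bases_mem[OF d] that by metis
  have "(\<Sum>a\<in>I. \<Sum>b\<in>I. Q (br (e a) (e b)) (br (f a) (f b))) =
     (\<Sum>a\<in>I. \<Sum>b\<in>I. Q (br (pr (e a)) (pr (e b))) (br (pr (f a)) (pr (f b))))"
    by (intro sum.cong refl eq)
  also have "\<dots> = (\<Sum>a\<in>I. \<Sum>v\<in>D. Q (br (pr (e a)) v) (br (pr (f a)) v))"
  proof (rule sum.cong[OF refl])
    fix a
    have "bilinear (\<lambda>x y. Q (br (pr (e a)) x) (br (pr (f a)) y))"
      unfolding bilinear_def by (auto intro!: linearI simp: Qs brs)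
    from step[OF this]
    show "(\<Sum>b\<in>I. Q (br (pr (e a)) (pr (e b))) (br (pr (f a)) (pr (f b)))) = (\<Sum>v\<in>D. Q (br (pr (e a)) v) (br (pr (f a)) v))" .
  qed
  also have "\<dots> = (\<Sum>u\<in>D. \<Sum>v\<in>D. Q (br u v) (br u v))"
  proof -
    have "bilinear (\<lambda>x y. \<Sum>v\<in>D. Q (br x v) (br y v))"
      unfolding bilinear_def by (auto intro!: linearI simp: Qs brs sum.distrib sum_distrib_left)
    from step[OF this] show ?thesis .
  qed
  finally show ?thesis .
qed

text \<open>In orthonormal bases of \<open>[h,h]\<close> and of its complement in the derived algebra, equality of the two
  sums of squared structure constants forces the complement to be central.\<close>

lemma derived_subset_subalgebra:
  assumes dg: "dual_bases Q I e f UNIV" and dh: "dual_bases Q J X Y h"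
    and closed_h: "\<And>x y. x \<in> h \<Longrightarrow> y \<in> h \<Longrightarrow> br x y \<in> h"
    and pos: "\<And>x. x \<in> derived \<Longrightarrow> x \<noteq> 0 \<Longrightarrow> Q x x > 0"
    and eq: "(\<Sum>a\<in>I. \<Sum>b\<in>I. Q (br (e a) (e b)) (br (f a) (f b))) =
             (\<Sum>a\<in>J. \<Sum>b\<in>J. Q (br (X a) (X b)) (br (Y a) (Y b)))"
  shows "derived \<subseteq> h"
proof -
  have sh: "subspace h" using dh unfolding dual_bases_def by (metis subspace_span)
  define V1 where "V1 = span {br x y |x y. x \<in> h \<and> y \<in> h}"
  define V2 where "V2 = {x\<in>derived. \<forall>y\<in>V1. Q x y = 0}"
  have V1d: "V1 \<subseteq> derived" unfolding V1_def by (rule span_minimal[OF _ subspace_derived]) auto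
  have V1h: "V1 \<subseteq> h" unfolding V1_def by (rule span_minimal[OF _ sh]) (auto intro: closed_h)
  have s1: "subspace V1" unfolding V1_def by (rule subspace_span)
  have s2: "subspace V2" unfolding V2_def subspace_def using subspace_derived
    by (auto simp: Qs subspace_0 subspace_add subspace_scale)
  obtain D1 where D1: "finite D1" "span D1 = V1" "\<forall>u\<in>D1. \<forall>v\<in>D1. Q u v = (if u = v then 1 else 0)"
    using orthonormal_basis_exists[OF Q_bil Q_sym s1] pos V1d by blast
  obtain D2 where D2: "finite D2" "span D2 = V2" "\<forall>u\<in>D2. \<forall>v\<in>D2. Q u v = (if u = v then 1 else 0)"
    using orthonormal_basis_exists[OF Q_bil Q_sym s2] pos unfolding V2_def by blast
  have D1V: "D1 \<subseteq> V1" and D2V: "D2 \<subseteq> V2" using D1(2) D2(2) span_superset by blast+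
  have orth: "Q u v = 0" "Q v u = 0" if "u \<in> V1" "v \<in> V2" for u v
    using that Q_sym[of u v] unfolding V2_def by auto
  have disj: "D1 \<inter> D2 = {}" using orth D1V D2V D1(3) by fastforce
  let ?D = "D1 \<union> D2"
  have fD: "finite ?D" using D1(1) D2(1) by simp
  have onD: "\<forall>u\<in>?D. \<forall>v\<in>?D. Q u v = (if u = v then 1 else 0)"
  proof (intro ballI)
    fix u v assume "u \<in> ?D" "v \<in> ?D"
    then show "Q u v = (if u = v then 1 else 0)"
      using D1(3) D2(3) orth[OF subsetD[OF D1V] subsetD[OF D2V]] disj by (elim UnE) auto
  qed
  have rest: "Q (x - (\<Sum>d\<in>D. Q x d *\<^sub>R d)) v = 0"
    if "finite D" "\<forall>u\<in>D. \<forall>v\<in>D. Q u v = (if u = v then 1 else 0)" "v \<in> span D" for D x v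
    using that(3)
  proof (induction rule: span_induct_alt)
    case (step c u y)
    have "(\<Sum>d\<in>D. Q x d * Q d u) = (\<Sum>d\<in>D. if d = u then Q x d else 0)"
      by (rule sum.cong) (use that(2) step(1) in auto)
    then show ?case using step that(1) by (simp add: Qs)
  qed (simp add: Qs)
  \<comment> \<open>The remainder w is Q-orthogonal to [h,h], so [w, y] is Q-orthogonal to h by
    invariance. Since [w, y] lies in h, where Q has dual bases, it is zero.\<close>
  have p1: "br x y = br (\<Sum>d\<in>D1. Q x d *\<^sub>R d) y" if "x \<in> h" "y \<in> h" for x y
  proof -
    let ?w = "x - (\<Sum>d\<in>D1. Q x d *\<^sub>R d)"
    have w: "?w \<in> h" using that(1) D1V V1h sh by (intro subspace_diff subspace_sum subspace_scale) auto
    have "Q (br ?w y) v = 0" if v: "v \<in> h" for v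
    proof -
      have "br y v \<in> span D1" unfolding D1(2) V1_def by (rule span_base) (use v \<open>y \<in> h\<close> in blast)
      from rest[OF D1(1,3) this] show ?thesis by (simp add: Q_inv')
    qed
    then have "\<And>i. i \<in> J \<Longrightarrow> Q (br ?w y) (Y i) = 0" using dual_bases_mem[OF dh] by blast
    then have "br ?w y = 0"
      using dual_bases_expand_left[OF Q_bil dh closed_h[OF w that(2)]] by simp
    then show ?thesis by (simp add: brs)
  qed
  have spanD: "derived \<subseteq> span ?D"
  proof
    fix x assume x: "x \<in> derived"
    let ?p = "\<Sum>d\<in>D1. Q x d *\<^sub>R d"
    have pd: "?p \<in> span D1" by (intro span_sum span_scale span_base)
    then have "?p \<in> derived" using D1(2) V1d by blast
    then have "x - ?p \<in> V2" unfolding V2_def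
      using x subspace_derived rest[OF D1(1,3)] D1(2) by (auto simp: subspace_diff)
    then have "x - ?p \<in> span ?D" using D2(2) span_mono[of D2 ?D] by auto
    moreover have "?p \<in> span ?D" using pd span_mono[of D1 ?D] by auto
    ultimately show "x \<in> span ?D" using span_add[of "x - ?p" ?D ?p] by simp
  qed
  have p2: "br x y = br (\<Sum>d\<in>?D. Q x d *\<^sub>R d) y" for x y
  proof -
    have "central (x - (\<Sum>d\<in>?D. Q x d *\<^sub>R d))"
      by (rule orth_derived_central) (use rest[OF fD onD] spanD in blast)
    then show ?thesis by (simp add: central_def brs)
  qed
  \<comment> \<open>Both sides of \<open>eq\<close> are now sums over orthonormal vectors. Removing
    the part over D1 leaves only the terms with an index in D2, all of them non-negative.\<close>
  have "(\<Sum>u\<in>?D. \<Sum>v\<in>?D. Q (br u v) (br u v)) = (\<Sum>u\<in>D1. \<Sum>v\<in>D1. Q (br u v) (br u v))"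
    using eq bracket_square_projection[OF dg fD subset_UNIV onD p2]
      bracket_square_projection[OF dh D1(1) _ D1(3) p1] D1V V1h by auto
  then have z: "(\<Sum>u\<in>D1. \<Sum>v\<in>D2. Q (br u v) (br u v)) + (\<Sum>u\<in>D2. \<Sum>v\<in>?D. Q (br u v) (br u v)) = 0"
    by (simp add: sum.union_disjoint[OF D1(1) D2(1) disj] sum.distrib)
  have nn: "Q (br u v) (br u v) \<ge> 0" for u v
    using pos[of "br u v"] by (cases "br u v = 0") (auto simp: Qs)
  have "(\<Sum>u\<in>D2. \<Sum>v\<in>?D. Q (br u v) (br u v)) = 0"
    using z sum_nonneg[of D1 "\<lambda>u. \<Sum>v\<in>D2. Q (br u v) (br u v)"] sum_nonneg[of D2 "\<lambda>u. \<Sum>v\<in>?D. Q (br u v) (br u v)"] nn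
    by (smt (verit) sum_nonneg)
  then have zero: "Q (br u v) (br u v) = 0" if "u \<in> D2" "v \<in> ?D" for u v
    using that nn D2(1) fD by (simp add: sum_nonneg_eq_0_iff sum_nonneg)
  have br0: "br u v = 0" if "u \<in> D2" "v \<in> ?D" for u v
    using zero[OF that] pos[of "br u v"] by force
  have "central u" if u: "u \<in> D2" for u
    unfolding central_def
  proof
    fix y
    have "br u y = - br (\<Sum>d\<in>?D. Q y d *\<^sub>R d) u" using p2[of y u] br_anti[of u y] by simp
    also have "\<dots> = 0" unfolding brs using br0[OF u] br_anti[of _ u] by simp
    finally show "br u y = 0" .
  qed
  moreover have "u \<in> derived" if "u \<in> D2" for u using that D2V unfolding V2_def by auto
  ultimately have "u = 0" if "u \<in> D2" for u using that central_derived_0 by blast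
  then have "D2 = {}" using D2(3) by (force simp: Qs)
  then show ?thesis using spanD D1(2) V1h by auto
qed

end

subsection \<open>Clifford relations\<close>

lemma scaleR_numeral_expand:
  "numeral (num.Bit0 n) *\<^sub>R x = numeral n *\<^sub>R x + numeral n *\<^sub>R (x :: 'a::real_vector)"
  "numeral (num.Bit1 n) *\<^sub>R x = numeral n *\<^sub>R x + numeral n *\<^sub>R x + x"
  by (simp_all only: numeral_Bit0 numeral_Bit1 scaleR_left_distrib scaleR_one)

locale clifford_relations =
  fixes z :: "nat \<Rightarrow> 'c::real_algebra_1" and I :: "nat set"
  assumes fin: "finite I"
    and rel: "i \<in> I \<Longrightarrow> j \<in> I \<Longrightarrow> z i * z j + z j * z i = (if i = j then (- 2) *\<^sub>R 1 else 0)"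
begin

lemma swap: "i \<in> I \<Longrightarrow> j \<in> I \<Longrightarrow> z j * z i = - (z i * z j) - (if i = j then 2 *\<^sub>R 1 else 0)"
  using rel[of i j] by (simp add: algebra_simps eq_neg_iff_add_eq_0 split: if_splits)

lemma anticomm: "i \<in> I \<Longrightarrow> j \<in> I \<Longrightarrow> i \<noteq> j \<Longrightarrow> z j * z i = - (z i * z j)"
  using swap[of i j] by simp

lemma square: "i \<in> I \<Longrightarrow> z i * z i = - 1"
proof -
  assume i: "i \<in> I"
  have "2 *\<^sub>R (z i * z i) = 2 *\<^sub>R (- 1 :: 'c)"
    using rel[OF i i] by (simp add: scaleR_2)
  then show ?thesis by (rule scaleR_left_imp_eq[rotated]) simp
qed

lemma square_left [simp]: "i \<in> I \<Longrightarrow> z i * (z i * x) = - x"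
  by (simp add: mult.assoc[symmetric] square)

lemma swap_left:
  assumes "i \<in> I" "j \<in> I"
  shows "z j * (z i * x) = - (z i * (z j * x)) - (if i = j then 2 *\<^sub>R x else 0)"
proof -
  have "z j * (z i * x) = z j * z i * x" by (simp add: mult.assoc)
  also have "\<dots> = (- (z i * z j) - (if i = j then 2 *\<^sub>R 1 else 0)) * x" by (simp only: swap[OF assms])
  also have "\<dots> = - (z i * (z j * x)) - (if i = j then 2 *\<^sub>R x else 0)"
    by (simp add: left_diff_distrib mult.assoc)
  finally show ?thesis .
qed

text \<open>Averaging over the exchange of i and j produces the anticommutator, of which only the
  diagonal survives.\<close>

lemma sum_symmetric:
  assumes "\<And>i j. i \<in> I \<Longrightarrow> j \<in> I \<Longrightarrow> M i j = (M j i :: real)"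
  shows "(\<Sum>i\<in>I. \<Sum>j\<in>I. M i j *\<^sub>R (z i * z j)) = - (\<Sum>i\<in>I. M i i) *\<^sub>R 1"
proof -
  let ?S = "\<Sum>i\<in>I. \<Sum>j\<in>I. M i j *\<^sub>R (z i * z j)"
  have "?S = (\<Sum>i\<in>I. \<Sum>j\<in>I. M i j *\<^sub>R (z j * z i))"
    by (subst sum.swap, intro sum.cong refl) (simp add: assms)
  then have "?S + ?S = (\<Sum>i\<in>I. \<Sum>j\<in>I. M i j *\<^sub>R (z i * z j + z j * z i))"
    by (simp add: scaleR_add_right sum.distrib)
  also have "\<dots> = (\<Sum>i\<in>I. \<Sum>j\<in>I. if i = j then (- 2 * M i j) *\<^sub>R 1 else 0)"
    by (intro sum.cong refl) (simp add: rel)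
  also have "\<dots> = (\<Sum>i\<in>I. (- 2 * M i i) *\<^sub>R 1)" using fin by simp
  also have "\<dots> = 2 *\<^sub>R (- (\<Sum>i\<in>I. M i i) *\<^sub>R (1 :: 'c))"
    by (simp only: scaleR_sum_left[symmetric] sum_distrib_left[symmetric] scaleR_scaleR) simp
  finally have "2 *\<^sub>R ?S = 2 *\<^sub>R (- (\<Sum>i\<in>I. M i i) *\<^sub>R (1 :: 'c))" by (simp only: scaleR_2)
  then show ?thesis by (rule scaleR_left_imp_eq[rotated]) simp
qed

text \<open>Moving z l through two generators changes the sign twice, so the commutator consists of
  contractions only. It is again a vector and sees just the skew part of b.\<close>

lemma bivector_z:
  assumes l: "l \<in> I"
  shows "(\<Sum>j\<in>I. \<Sum>k\<in>I. b j k *\<^sub>R (z j * z k)) * z l = z l * (\<Sum>j\<in>I. \<Sum>k\<in>I. b j k *\<^sub>R (z j * z k)) + 2 *\<^sub>R ((\<Sum>k\<in>I. b l k *\<^sub>R z k) - (\<Sum>j\<in>I. b j l *\<^sub>R z j))"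
proof -
  have w: "z j * z k * z l = z l * (z j * z k) + (if j = l then 2 *\<^sub>R z k else 0) - (if k = l then 2 *\<^sub>R z j else 0)"
    if "j \<in> I" "k \<in> I" for j k
  proof -
    have "z j * z k * z l = z j * (z k * z l)" by (simp add: mult.assoc)
    also have "z k * z l = - (z l * z k) - (if l = k then 2 *\<^sub>R 1 else 0)" by (rule swap[OF l that(2)])
    also have "z j * (- (z l * z k) - (if l = k then 2 *\<^sub>R 1 else 0)) = - (z j * (z l * z k)) - (if k = l then 2 *\<^sub>R z j else 0)"
      by (simp add: algebra_simps)
    also have "z j * (z l * z k) = - (z l * (z j * z k)) - (if l = j then 2 *\<^sub>R z k else 0)"
      by (rule swap_left[OF l that(1)])
    finally show ?thesis by auto
  qed
  have "(\<Sum>j\<in>I. \<Sum>k\<in>I. b j k *\<^sub>R (z j * z k)) * z l = (\<Sum>j\<in>I. \<Sum>k\<in>I. b j k *\<^sub>R (z l * (z j * z k)) +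
      (if j = l then 2 *\<^sub>R b j k *\<^sub>R z k else 0) - (if k = l then 2 *\<^sub>R b j k *\<^sub>R z j else 0))"
    unfolding sum_distrib_right mult_scaleR_left
    by (intro sum.cong refl) (simp add: w scaleR_add_right scaleR_diff_right mult.commute[of _ 2])
  also have "\<dots> = z l * (\<Sum>j\<in>I. \<Sum>k\<in>I. b j k *\<^sub>R (z j * z k)) + (\<Sum>j\<in>I. \<Sum>k\<in>I. if j = l then 2 *\<^sub>R b j k *\<^sub>R z k else 0)
     - (\<Sum>j\<in>I. \<Sum>k\<in>I. if k = l then 2 *\<^sub>R b j k *\<^sub>R z j else 0)"
    by (simp add: sum.distrib sum_subtractf sum_distrib_left)
  also have "(\<Sum>j\<in>I. \<Sum>k\<in>I. if j = l then 2 *\<^sub>R b j k *\<^sub>R z k else 0) = (\<Sum>k\<in>I. 2 *\<^sub>R b l k *\<^sub>R z k)"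
    by (subst sum.swap) (use fin l in simp)
  also have "(\<Sum>j\<in>I. \<Sum>k\<in>I. if k = l then 2 *\<^sub>R b j k *\<^sub>R z j else 0) = (\<Sum>j\<in>I. 2 *\<^sub>R b j l *\<^sub>R z j)"
    using fin l by simp
  finally show ?thesis by (simp add: scaleR_diff_right scaleR_sum_right)
qed

end

locale three_form = clifford_relations z I
  for z :: "nat \<Rightarrow> 'c::real_algebra_1" and I :: "nat set" +
  fixes c :: "nat \<Rightarrow> nat \<Rightarrow> nat \<Rightarrow> real"
  assumes c12: "i \<in> I \<Longrightarrow> j \<in> I \<Longrightarrow> k \<in> I \<Longrightarrow> c j i k = - c i j k"
    and c23: "i \<in> I \<Longrightarrow> j \<in> I \<Longrightarrow> k \<in> I \<Longrightarrow> c i k j = - c i j k"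
begin

lemma c_cyc: "i \<in> I \<Longrightarrow> j \<in> I \<Longrightarrow> k \<in> I \<Longrightarrow> c j k i = c i j k"
  using c12[of i j k] c23[of j i k] by simp

lemma c_same [simp]: "i \<in> I \<Longrightarrow> j \<in> I \<Longrightarrow> c i i j = 0" "i \<in> I \<Longrightarrow> j \<in> I \<Longrightarrow> c i j j = 0" "i \<in> I \<Longrightarrow> j \<in> I \<Longrightarrow> c j i j = 0"
  using c12[of i i j] c23[of i j j] c12[of i j j] by simp_all

text \<open>\<open>T6\<close> is six times the Clifford element of the form, \<open>t i\<close> twice that of its contraction with \<open>z i\<close>.\<close>

definition t :: "nat \<Rightarrow> 'c" where "t i = (\<Sum>j\<in>I. \<Sum>k\<in>I. c i j k *\<^sub>R (z j * z k))"
definition T6 :: 'c where "T6 = (\<Sum>i\<in>I. z i * t i)"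
definition C2 :: real where "C2 = (\<Sum>i\<in>I. \<Sum>j\<in>I. \<Sum>k\<in>I. (c i j k)\<^sup>2)"

lemma t_alt: "i \<in> I \<Longrightarrow> (\<Sum>j\<in>I. \<Sum>k\<in>I. c j k i *\<^sub>R (z j * z k)) = t i"
  unfolding t_def by (intro sum.cong refl) (simp add: c_cyc)

lemma t_alt2: "i \<in> I \<Longrightarrow> (\<Sum>j\<in>I. \<Sum>k\<in>I. c j i k *\<^sub>R (z j * z k)) = - t i"
  unfolding t_def sum_negf[symmetric] by (intro sum.cong refl) (simp add: c12[of _ i])

lemma T6_eq: "T6 = (\<Sum>i\<in>I. \<Sum>j\<in>I. \<Sum>k\<in>I. c i j k *\<^sub>R (z i * z j * z k))"
  unfolding T6_def t_def by (simp add: sum_distrib_left mult.assoc)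

lemma t_comm: "i \<in> I \<Longrightarrow> l \<in> I \<Longrightarrow> t i * z l = z l * t i + 4 *\<^sub>R (\<Sum>k\<in>I. c i l k *\<^sub>R z k)"
proof -
  assume i: "i \<in> I" and l: "l \<in> I"
  have "(\<Sum>j\<in>I. c i j l *\<^sub>R z j) = - (\<Sum>j\<in>I. c i l j *\<^sub>R z j)"
    unfolding sum_negf[symmetric] by (intro sum.cong refl) (simp add: c23[OF i l])
  then show ?thesis unfolding t_def bivector_z[OF l] by (simp add: scaleR_2[symmetric])
qed

text \<open>The 6 is 2, from moving z l past z i, plus 4, from \<open>t_comm\<close>.\<close>

lemma T6_z:
  assumes l: "l \<in> I"
  shows "T6 * z l = - (z l * T6) - 6 *\<^sub>R t l"
proof -
  have "T6 * z l = (\<Sum>i\<in>I. z i * (t i * z l))"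
    unfolding T6_def sum_distrib_right by (simp only: mult.assoc)
  also have "\<dots> = (\<Sum>i\<in>I. z i * (z l * t i) + 4 *\<^sub>R (\<Sum>k\<in>I. c i l k *\<^sub>R (z i * z k)))"
    by (intro sum.cong refl) (simp only: t_comm l distrib_left mult_scaleR_right sum_distrib_left)
  also have "\<dots> = (\<Sum>i\<in>I. z i * (z l * t i)) + 4 *\<^sub>R (\<Sum>i\<in>I. \<Sum>k\<in>I. c i l k *\<^sub>R (z i * z k))"
    by (simp only: sum.distrib scaleR_sum_right)
  also have "(\<Sum>i\<in>I. z i * (z l * t i)) = (\<Sum>i\<in>I. - (z l * (z i * t i)) - (if l = i then 2 *\<^sub>R t i else 0))"
    by (intro sum.cong refl) (simp only: swap_left[OF l])
  also have "\<dots> = - (z l * T6) - 2 *\<^sub>R t l"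
    unfolding T6_def using fin l by (simp add: sum_subtractf sum_negf sum_distrib_left)
  also have "(\<Sum>i\<in>I. \<Sum>k\<in>I. c i l k *\<^sub>R (z i * z k)) = - t l" by (rule t_alt2[OF l])
  finally have e: "T6 * z l = - (z l * T6) - 2 *\<^sub>R t l + 4 *\<^sub>R - t l" .
  show ?thesis unfolding e by (simp add: algebra_simps scaleR_numeral_expand)
qed

text \<open>\<open>T6\<close> is moved past both factors of each term by \<open>T6_z\<close>. The
  two correction terms, 6 each, combine to 12 by skewness once z k is moved in front of t j; this
  last move costs 6 * 4 = 24.\<close>

lemma T6_t:
  assumes i: "i \<in> I"
  shows "T6 * t i = t i * T6 + 12 *\<^sub>R (\<Sum>j\<in>I. \<Sum>k\<in>I. c i j k *\<^sub>R (z j * t k))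
     - 24 *\<^sub>R (\<Sum>j\<in>I. \<Sum>k\<in>I. \<Sum>l\<in>I. (c i j k * c j k l) *\<^sub>R z l)"
proof -
  have 1: "T6 * (z j * z k) = z j * z k * T6 + 6 *\<^sub>R (z j * t k) - 6 *\<^sub>R (t j * z k)" if "j \<in> I" "k \<in> I" for j k
  proof -
    have "T6 * (z j * z k) = - (z j * (T6 * z k)) - 6 *\<^sub>R (t j * z k)"
      using T6_z[OF that(1)] by (simp add: mult.assoc[symmetric]) (simp add: left_diff_distrib mult.assoc)
    also have "\<dots> = z j * z k * T6 + 6 *\<^sub>R (z j * t k) - 6 *\<^sub>R (t j * z k)"
      unfolding T6_z[OF that(2)] by (simp add: algebra_simps)
    finally show ?thesis .
  qed
  have "T6 * t i = (\<Sum>j\<in>I. \<Sum>k\<in>I. c i j k *\<^sub>R (T6 * (z j * z k)))"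
    unfolding t_def by (simp add: sum_distrib_left)
  also have "\<dots> = (\<Sum>j\<in>I. \<Sum>k\<in>I. c i j k *\<^sub>R (z j * z k) * T6 + 6 *\<^sub>R (c i j k *\<^sub>R (z j * t k)) - 6 *\<^sub>R (c i j k *\<^sub>R (t j * z k)))"
    by (intro sum.cong refl) (simp add: 1 scaleR_diff_right scaleR_add_right mult.commute)
  also have "\<dots> = t i * T6 + 6 *\<^sub>R (\<Sum>j\<in>I. \<Sum>k\<in>I. c i j k *\<^sub>R (z j * t k)) - 6 *\<^sub>R (\<Sum>j\<in>I. \<Sum>k\<in>I. c i j k *\<^sub>R (t j * z k))"
    unfolding t_def[of i] by (simp add: sum.distrib sum_subtractf scaleR_sum_right sum_distrib_right)
  also have "(\<Sum>j\<in>I. \<Sum>k\<in>I. c i j k *\<^sub>R (t j * z k)) = (\<Sum>j\<in>I. \<Sum>k\<in>I. c i j k *\<^sub>R (z k * t j)) + 4 *\<^sub>R (\<Sum>j\<in>I. \<Sum>k\<in>I. \<Sum>l\<in>I. (c i j k * c j k l) *\<^sub>R z l)"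
    unfolding scaleR_sum_right sum.distrib[symmetric]
    by (intro sum.cong refl) (simp add: t_comm scaleR_add_right scaleR_sum_right mult_ac)
  also have "(\<Sum>j\<in>I. \<Sum>k\<in>I. c i j k *\<^sub>R (z k * t j)) = - (\<Sum>j\<in>I. \<Sum>k\<in>I. c i j k *\<^sub>R (z j * t k))"
    unfolding sum_negf[symmetric] by (subst sum.swap, intro sum.cong refl) (metis c23[OF i] scaleR_minus_left)
  finally show ?thesis by (simp add: algebra_simps scaleR_numeral_expand)
qed

text \<open>The sum U of z i T6 t i is evaluated twice. Moving T6 left past z i gives -T6^2 - 6 S,
  moving it right past t i gives T6^2 + 12 S + 24 C2, with S the sum of the squares of the t i.
  Comparing both determines T6^2.\<close>

lemma T6_square: "T6 * T6 = - 9 *\<^sub>R (\<Sum>i\<in>I. t i * t i) - (12 * C2) *\<^sub>R 1"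
proof -
  let ?S = "\<Sum>i\<in>I. t i * t i"
  let ?U = "\<Sum>i\<in>I. z i * (T6 * t i)"
  have 1: "T6 * T6 = - ?U - 6 *\<^sub>R ?S"
  proof -
    have "T6 * T6 = (\<Sum>i\<in>I. (T6 * z i) * t i)"
      by (subst (2) T6_def) (simp only: sum_distrib_left mult.assoc)
    also have "\<dots> = (\<Sum>i\<in>I. - (z i * (T6 * t i)) - 6 *\<^sub>R (t i * t i))"
      by (intro sum.cong refl) (simp add: T6_z algebra_simps)
    finally show ?thesis by (simp add: sum_subtractf sum_negf scaleR_sum_right)
  qed
  have 2: "?U = T6 * T6 + 12 *\<^sub>R ?S + (24 * C2) *\<^sub>R 1"
  proof -
    have "?U = (\<Sum>i\<in>I. z i * t i * T6) + 12 *\<^sub>R (\<Sum>i\<in>I. \<Sum>j\<in>I. \<Sum>k\<in>I. c i j k *\<^sub>R (z i * z j * t k))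
        - 24 *\<^sub>R (\<Sum>i\<in>I. \<Sum>j\<in>I. \<Sum>k\<in>I. \<Sum>l\<in>I. (c i j k * c j k l) *\<^sub>R (z i * z l))"
    proof -
      have "?U = (\<Sum>i\<in>I. z i * t i * T6 + 12 *\<^sub>R (\<Sum>j\<in>I. \<Sum>k\<in>I. c i j k *\<^sub>R (z i * z j * t k))
        - 24 *\<^sub>R (\<Sum>j\<in>I. \<Sum>k\<in>I. \<Sum>l\<in>I. (c i j k * c j k l) *\<^sub>R (z i * z l)))"
        by (intro sum.cong refl)
           (simp only: T6_t distrib_left right_diff_distrib mult_scaleR_right sum_distrib_left mult.assoc)
      then show ?thesis by (simp only: sum.distrib sum_subtractf scaleR_sum_right)
    qed
    also have "(\<Sum>i\<in>I. z i * t i * T6) = T6 * T6" unfolding T6_def by (simp add: sum_distrib_right)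
    also have "(\<Sum>i\<in>I. \<Sum>j\<in>I. \<Sum>k\<in>I. c i j k *\<^sub>R (z i * z j * t k)) = ?S"
    proof -
      have "(\<Sum>i\<in>I. \<Sum>j\<in>I. \<Sum>k\<in>I. c i j k *\<^sub>R (z i * z j * t k)) = (\<Sum>i\<in>I. \<Sum>k\<in>I. \<Sum>j\<in>I. c i j k *\<^sub>R (z i * z j * t k))"
        by (intro sum.cong refl sum.swap)
      also have "\<dots> = (\<Sum>k\<in>I. \<Sum>i\<in>I. \<Sum>j\<in>I. c i j k *\<^sub>R (z i * z j * t k))" by (rule sum.swap)
      also have "\<dots> = (\<Sum>k\<in>I. (\<Sum>i\<in>I. \<Sum>j\<in>I. c i j k *\<^sub>R (z i * z j)) * t k)" by (simp add: sum_distrib_right)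
      also have "\<dots> = ?S" by (intro sum.cong refl) (simp add: t_alt)
      finally show ?thesis .
    qed
    \<comment> \<open>Contracted over j and k, the coefficients are symmetric in i and l, so by
      \<open>sum_symmetric\<close> only their trace C2 remains.\<close>
    also have "(\<Sum>i\<in>I. \<Sum>j\<in>I. \<Sum>k\<in>I. \<Sum>l\<in>I. (c i j k * c j k l) *\<^sub>R (z i * z l)) = - C2 *\<^sub>R 1"
    proof -
      define M where "M i l = (\<Sum>j\<in>I. \<Sum>k\<in>I. c i j k * c l j k)" for i l
      have "(\<Sum>j\<in>I. \<Sum>k\<in>I. \<Sum>l\<in>I. (c i j k * c j k l) *\<^sub>R (z i * z l)) = (\<Sum>l\<in>I. M i l *\<^sub>R (z i * z l))" if "i \<in> I" for i
      proof -
        have "(\<Sum>j\<in>I. \<Sum>k\<in>I. \<Sum>l\<in>I. (c i j k * c j k l) *\<^sub>R (z i * z l)) = (\<Sum>j\<in>I. \<Sum>l\<in>I. \<Sum>k\<in>I. (c i j k * c j k l) *\<^sub>R (z i * z l))"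
          by (intro sum.cong refl sum.swap)
        also have "\<dots> = (\<Sum>l\<in>I. \<Sum>j\<in>I. \<Sum>k\<in>I. (c i j k * c j k l) *\<^sub>R (z i * z l))" by (rule sum.swap)
        also have "\<dots> = (\<Sum>l\<in>I. M i l *\<^sub>R (z i * z l))"
          unfolding M_def scaleR_sum_left by (intro sum.cong refl) (simp add: c_cyc)
        finally show ?thesis .
      qed
      then have "(\<Sum>i\<in>I. \<Sum>j\<in>I. \<Sum>k\<in>I. \<Sum>l\<in>I. (c i j k * c j k l) *\<^sub>R (z i * z l)) = (\<Sum>i\<in>I. \<Sum>l\<in>I. M i l *\<^sub>R (z i * z l))"
        by (simp cong: sum.cong)
      also have "\<dots> = - (\<Sum>i\<in>I. M i i) *\<^sub>R 1"
        by (rule sum_symmetric) (simp add: M_def mult.commute)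
      also have "(\<Sum>i\<in>I. M i i) = C2" unfolding M_def C2_def by (simp add: power2_eq_square)
      finally show ?thesis .
    qed
    finally show ?thesis by simp
  qed
  have "2 *\<^sub>R (T6 * T6) = 2 *\<^sub>R (- 9 *\<^sub>R ?S - (12 * C2) *\<^sub>R 1)"
  proof -
    have "2 *\<^sub>R (T6 * T6) = - ?U - 6 *\<^sub>R ?S + (?U - 12 *\<^sub>R ?S - (24 * C2) *\<^sub>R 1)"
    proof -
      have "T6 * T6 = ?U - 12 *\<^sub>R ?S - (24 * C2) *\<^sub>R 1" using 2 by simp
      from arg_cong2[OF 1 this, of "(+)"] show ?thesis by (simp only: scaleR_2)
    qed
    also have "\<dots> = 2 *\<^sub>R (- 9 *\<^sub>R ?S - (12 * C2) *\<^sub>R 1)"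
      by (simp add: scaleR_diff_right) (simp add: scaleR_numeral_expand)
    finally show ?thesis .
  qed
  then show ?thesis by (rule scaleR_left_imp_eq[rotated]) simp
qed

text \<open>If \<open>T6 v = 0\<close> and \<open>T6 t\<^sub>i v = 0\<close>, then \<open>z\<^sub>i T6 + T6 z\<^sub>i = -6 t\<^sub>i\<close> kills the sum of the squares of the \<open>t\<^sub>i\<close>.\<close>

lemma T6_sum: "(\<Sum>i\<in>I. z i * (T6 * t i)) + T6 * T6 = - 6 *\<^sub>R (\<Sum>i\<in>I. t i * t i)"
proof -
  have "T6 * T6 = (\<Sum>i\<in>I. (T6 * z i) * t i)"
    by (subst (2) T6_def) (simp only: sum_distrib_left mult.assoc)
  also have "\<dots> = (\<Sum>i\<in>I. - (z i * (T6 * t i)) - 6 *\<^sub>R (t i * t i))"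
    by (intro sum.cong refl) (simp add: T6_z algebra_simps)
  finally show ?thesis by (simp add: sum_subtractf sum_negf scaleR_sum_right)
qed

end

section \<open>Clifford contraction of tensors with curvature symmetries\<close>

context clifford_relations
begin

text \<open>As in the Lichnerowicz formula: by the Bianchi identity the three cyclic rearrangements
  of z j z k z l cancel in total, and restoring the order in two of them costs only contractions. So
  3 U i = 6 V i with V i the Ricci contraction, which is symmetric by pair symmetry and contracts to
  a scalar.\<close>

lemma curvature_sum:
  fixes R :: "nat \<Rightarrow> nat \<Rightarrow> nat \<Rightarrow> nat \<Rightarrow> real"
  assumes a1: "\<And>i j k l. {i, j, k, l} \<subseteq> I \<Longrightarrow> R j i k l = - R i j k l"
    and a2: "\<And>i j k l. {i, j, k, l} \<subseteq> I \<Longrightarrow> R i j l k = - R i j k l"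
    and s: "\<And>i j k l. {i, j, k, l} \<subseteq> I \<Longrightarrow> R k l i j = R i j k l"
    and b: "\<And>i j k l. {i, j, k, l} \<subseteq> I \<Longrightarrow> R i j k l + R i k l j + R i l j k = 0"
  shows "(\<Sum>i\<in>I. \<Sum>j\<in>I. \<Sum>k\<in>I. \<Sum>l\<in>I. R i j k l *\<^sub>R (z i * z j * z k * z l)) = (- 2 * (\<Sum>i\<in>I. \<Sum>j\<in>I. R i j i j)) *\<^sub>R 1"
proof -
  define U where "U i = (\<Sum>j\<in>I. \<Sum>k\<in>I. \<Sum>l\<in>I. R i j k l *\<^sub>R (z j * z k * z l))" for i
  define V where "V i = (\<Sum>j\<in>I. \<Sum>k\<in>I. R i j k j *\<^sub>R z k)" for i
  have U: "U i = 2 *\<^sub>R V i" if i: "i \<in> I" for i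
  proof -
    define A where "A = (\<Sum>j\<in>I. \<Sum>k\<in>I. \<Sum>l\<in>I. R i j k l *\<^sub>R (z l * z j * z k))"
    define A' where "A' = (\<Sum>j\<in>I. \<Sum>k\<in>I. \<Sum>l\<in>I. R i j k l *\<^sub>R (z k * z l * z j))"
    have "A = (\<Sum>j\<in>I. \<Sum>k\<in>I. \<Sum>l\<in>I. R i k l j *\<^sub>R (z j * z k * z l))"
    proof -
      have "A = (\<Sum>j\<in>I. \<Sum>l\<in>I. \<Sum>k\<in>I. R i j k l *\<^sub>R (z l * z j * z k))" unfolding A_def by (intro sum.cong refl sum.swap)
      also have "\<dots> = (\<Sum>l\<in>I. \<Sum>j\<in>I. \<Sum>k\<in>I. R i j k l *\<^sub>R (z l * z j * z k))" by (rule sum.swap)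
      finally show ?thesis .
    qed
    moreover have "A' = (\<Sum>j\<in>I. \<Sum>k\<in>I. \<Sum>l\<in>I. R i l j k *\<^sub>R (z j * z k * z l))"
    proof -
      have "A' = (\<Sum>k\<in>I. \<Sum>j\<in>I. \<Sum>l\<in>I. R i j k l *\<^sub>R (z k * z l * z j))" unfolding A'_def by (rule sum.swap)
      also have "\<dots> = (\<Sum>k\<in>I. \<Sum>l\<in>I. \<Sum>j\<in>I. R i j k l *\<^sub>R (z k * z l * z j))" by (intro sum.cong refl sum.swap)
      finally show ?thesis .
    qed
    ultimately have "U i + A + A' = (\<Sum>j\<in>I. \<Sum>k\<in>I. \<Sum>l\<in>I. (R i j k l + R i k l j + R i l j k) *\<^sub>R (z j * z k * z l))"
      unfolding U_def by (simp add: sum.distrib scaleR_add_left)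
    also have "\<dots> = 0" by (intro sum.neutral ballI) (use b i in simp)
    finally have UA: "U i + A + A' = 0" .
    have w1: "z l * z j * z k = z j * z k * z l + (if k = l then 2 *\<^sub>R z j else 0) - (if j = l then 2 *\<^sub>R z k else 0)"
      if "j \<in> I" "k \<in> I" "l \<in> I" for j k l
    proof -
      have "z l * z j * z k = - (z j * (z l * z k)) - (if j = l then 2 *\<^sub>R z k else 0)"
        using swap_left[OF that(1,3), of "z k"] by (simp add: mult.assoc)
      also have "z l * z k = - (z k * z l) - (if k = l then 2 *\<^sub>R 1 else 0)" by (rule swap[OF that(2,3)])
      finally show ?thesis by (simp add: algebra_simps)
    qed
    have w2: "z k * z l * z j = z j * z k * z l + (if j = k then 2 *\<^sub>R z l else 0) - (if j = l then 2 *\<^sub>R z k else 0)"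
      if "j \<in> I" "k \<in> I" "l \<in> I" for j k l
    proof -
      have "z k * z l * z j = z k * (z l * z j)" by (simp add: mult.assoc)
      also have "z l * z j = - (z j * z l) - (if j = l then 2 *\<^sub>R 1 else 0)" by (rule swap[OF that(1,3)])
      also have "z k * (- (z j * z l) - (if j = l then 2 *\<^sub>R 1 else 0)) = - (z k * (z j * z l)) - (if j = l then 2 *\<^sub>R z k else 0)"
        by (simp add: algebra_simps)
      also have "z k * (z j * z l) = - (z j * (z k * z l)) - (if j = k then 2 *\<^sub>R z l else 0)"
        by (rule swap_left[OF that(1,2)])
      finally show ?thesis by (simp add: mult.assoc)
    qed
    have kk: "R i j k k = 0" if "j \<in> I" "k \<in> I" for j k using a2[of i j k k] that i by simp
    have v1: "(\<Sum>j\<in>I. \<Sum>k\<in>I. \<Sum>l\<in>I. R i j k l *\<^sub>R (if k = l then 2 *\<^sub>R z j else 0)) = 0"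
      by (intro sum.neutral ballI) (use kk in simp)
    have v2: "(\<Sum>j\<in>I. \<Sum>k\<in>I. \<Sum>l\<in>I. R i j k l *\<^sub>R (if j = l then 2 *\<^sub>R z k else 0)) = 2 *\<^sub>R V i"
    proof -
      have "(\<Sum>l\<in>I. R i j k l *\<^sub>R (if j = l then 2 *\<^sub>R z k else 0)) = 2 *\<^sub>R R i j k j *\<^sub>R z k" if "j \<in> I" for j k
      proof -
        have "(\<Sum>l\<in>I. R i j k l *\<^sub>R (if j = l then 2 *\<^sub>R z k else 0)) = (\<Sum>l\<in>I. if j = l then 2 *\<^sub>R R i j k l *\<^sub>R z k else 0)"
          by (intro sum.cong refl) simp
        then show ?thesis using fin that by simp
      qed
      then show ?thesis unfolding V_def by (simp add: scaleR_sum_right cong: sum.cong)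
    qed
    have v3: "(\<Sum>j\<in>I. \<Sum>k\<in>I. \<Sum>l\<in>I. R i j k l *\<^sub>R (if j = k then 2 *\<^sub>R z l else 0)) = - 2 *\<^sub>R V i"
    proof -
      have "(\<Sum>k\<in>I. \<Sum>l\<in>I. R i j k l *\<^sub>R (if j = k then 2 *\<^sub>R z l else 0)) = (\<Sum>l\<in>I. - 2 *\<^sub>R R i j l j *\<^sub>R z l)" if j: "j \<in> I" for j
      proof -
        have "(\<Sum>k\<in>I. \<Sum>l\<in>I. R i j k l *\<^sub>R (if j = k then 2 *\<^sub>R z l else 0)) = (\<Sum>l\<in>I. \<Sum>k\<in>I. if j = k then 2 *\<^sub>R R i j k l *\<^sub>R z l else 0)"
          by (subst sum.swap) (intro sum.cong refl, simp)
        also have "\<dots> = (\<Sum>l\<in>I. 2 *\<^sub>R R i j j l *\<^sub>R z l)" using fin j by simp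
        also have "\<dots> = (\<Sum>l\<in>I. - 2 *\<^sub>R R i j l j *\<^sub>R z l)"
        proof (intro sum.cong refl)
          fix l assume "l \<in> I"
          then have "R i j j l = - R i j l j" using a2[of i j l j] i j by simp
          then show "2 *\<^sub>R R i j j l *\<^sub>R z l = - 2 *\<^sub>R R i j l j *\<^sub>R z l" by simp
        qed
        finally show ?thesis .
      qed
      then show ?thesis unfolding V_def by (simp add: scaleR_sum_right cong: sum.cong)
    qed
    have A1: "A = U i + 0 - 2 *\<^sub>R V i"
    proof -
      have "A = (\<Sum>j\<in>I. \<Sum>k\<in>I. \<Sum>l\<in>I. R i j k l *\<^sub>R (z j * z k * z l) +
          R i j k l *\<^sub>R (if k = l then 2 *\<^sub>R z j else 0) - R i j k l *\<^sub>R (if j = l then 2 *\<^sub>R z k else 0))"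
        unfolding A_def by (intro sum.cong refl) (subst w1, assumption+, simp only: scaleR_add_right scaleR_diff_right)
      then show ?thesis by (simp only: U_def[symmetric] sum.distrib sum_subtractf v1 v2)
    qed
    have A2: "A' = U i + - 2 *\<^sub>R V i - 2 *\<^sub>R V i"
    proof -
      have "A' = (\<Sum>j\<in>I. \<Sum>k\<in>I. \<Sum>l\<in>I. R i j k l *\<^sub>R (z j * z k * z l) +
          R i j k l *\<^sub>R (if j = k then 2 *\<^sub>R z l else 0) - R i j k l *\<^sub>R (if j = l then 2 *\<^sub>R z k else 0))"
        unfolding A'_def by (intro sum.cong refl) (subst w2, assumption+, simp only: scaleR_add_right scaleR_diff_right)
      then show ?thesis by (simp only: U_def[symmetric] sum.distrib sum_subtractf v3 v2)
    qed
    have "3 *\<^sub>R U i = 3 *\<^sub>R (2 *\<^sub>R V i)"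
    proof -
      have "3 *\<^sub>R U i - 3 *\<^sub>R (2 *\<^sub>R V i) = U i + A + A'"
        unfolding A1 A2 by (simp add: algebra_simps scaleR_numeral_expand)
      then show ?thesis using UA by (simp only: right_minus_eq)
    qed
    then show ?thesis by (rule scaleR_left_imp_eq[rotated]) simp
  qed
  have "(\<Sum>i\<in>I. \<Sum>j\<in>I. \<Sum>k\<in>I. \<Sum>l\<in>I. R i j k l *\<^sub>R (z i * z j * z k * z l)) = (\<Sum>i\<in>I. z i * U i)"
    unfolding U_def by (simp add: sum_distrib_left mult.assoc)
  also have "\<dots> = (\<Sum>i\<in>I. 2 *\<^sub>R (z i * V i))" by (intro sum.cong refl) (simp add: U)
  also have "\<dots> = 2 *\<^sub>R (\<Sum>i\<in>I. \<Sum>j\<in>I. \<Sum>k\<in>I. R i j k j *\<^sub>R (z i * z k))"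
    unfolding V_def by (simp add: sum_distrib_left scaleR_sum_right)
  also have "(\<Sum>i\<in>I. \<Sum>j\<in>I. \<Sum>k\<in>I. R i j k j *\<^sub>R (z i * z k)) = (\<Sum>i\<in>I. \<Sum>k\<in>I. (\<Sum>j\<in>I. R i j k j) *\<^sub>R (z i * z k))"
    unfolding scaleR_sum_left by (intro sum.cong refl sum.swap)
  also have "\<dots> = - (\<Sum>i\<in>I. \<Sum>j\<in>I. R i j i j) *\<^sub>R 1"
  proof (rule sum_symmetric)
    fix i k assume "i \<in> I" "k \<in> I"
    then show "(\<Sum>j\<in>I. R i j k j) = (\<Sum>j\<in>I. R k j i j)" by (intro sum.cong refl) (use s in simp)
  qed
  finally show ?thesis by simp
qed

end

context three_form
begin

lemma t_square_sum:
  "(\<Sum>m\<in>I. t m * t m) = (\<Sum>i\<in>I. \<Sum>j\<in>I. \<Sum>k\<in>I. \<Sum>l\<in>I. (\<Sum>m\<in>I. c i j m * c k l m) *\<^sub>R (z i * z j * z k * z l))"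
proof -
  have tm: "t m * t m = (\<Sum>i\<in>I. \<Sum>j\<in>I. \<Sum>k\<in>I. \<Sum>l\<in>I. (c i j m * c k l m) *\<^sub>R (z i * z j * z k * z l))" if m: "m \<in> I" for m
    unfolding t_alt[OF m, symmetric] sum_distrib_right unfolding sum_distrib_left
    by (simp only: mult_scaleR_left mult_scaleR_right scaleR_scaleR mult.assoc mult.commute[of "c _ _ m" "c _ _ m"])
  have "(\<Sum>m\<in>I. t m * t m) = (\<Sum>m\<in>I. \<Sum>i\<in>I. \<Sum>j\<in>I. \<Sum>k\<in>I. \<Sum>l\<in>I. (c i j m * c k l m) *\<^sub>R (z i * z j * z k * z l))"
    by (intro sum.cong refl tm)
  also have "\<dots> = (\<Sum>i\<in>I. \<Sum>m\<in>I. \<Sum>j\<in>I. \<Sum>k\<in>I. \<Sum>l\<in>I. (c i j m * c k l m) *\<^sub>R (z i * z j * z k * z l))"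
    by (rule sum.swap)
  also have "\<dots> = (\<Sum>i\<in>I. \<Sum>j\<in>I. \<Sum>m\<in>I. \<Sum>k\<in>I. \<Sum>l\<in>I. (c i j m * c k l m) *\<^sub>R (z i * z j * z k * z l))"
    by (intro sum.cong refl sum.swap)
  also have "\<dots> = (\<Sum>i\<in>I. \<Sum>j\<in>I. \<Sum>k\<in>I. \<Sum>m\<in>I. \<Sum>l\<in>I. (c i j m * c k l m) *\<^sub>R (z i * z j * z k * z l))"
    by (intro sum.cong refl sum.swap)
  also have "\<dots> = (\<Sum>i\<in>I. \<Sum>j\<in>I. \<Sum>k\<in>I. \<Sum>l\<in>I. \<Sum>m\<in>I. (c i j m * c k l m) *\<^sub>R (z i * z j * z k * z l))"
    by (intro sum.cong refl sum.swap)
  finally show ?thesis by (simp only: scaleR_sum_left)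
qed

text \<open>Neither summand of R need satisfy the Bianchi identity by itself. In the application q
  is the h-part and the sum over m the m-part of the pairing of two brackets, and the identity holds
  for the total.\<close>

lemma curvature_t_square_sum:
  fixes q :: "nat \<Rightarrow> nat \<Rightarrow> nat \<Rightarrow> nat \<Rightarrow> real"
  defines "R \<equiv> \<lambda>i j k l. q i j k l + (\<Sum>m\<in>I. c i j m * c k l m)"
  assumes "\<And>i j k l. {i, j, k, l} \<subseteq> I \<Longrightarrow> R j i k l = - R i j k l"
    and "\<And>i j k l. {i, j, k, l} \<subseteq> I \<Longrightarrow> R i j l k = - R i j k l"
    and "\<And>i j k l. {i, j, k, l} \<subseteq> I \<Longrightarrow> R k l i j = R i j k l"
    and "\<And>i j k l. {i, j, k, l} \<subseteq> I \<Longrightarrow> R i j k l + R i k l j + R i l j k = 0"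
  shows "(\<Sum>i\<in>I. \<Sum>j\<in>I. \<Sum>k\<in>I. \<Sum>l\<in>I. q i j k l *\<^sub>R (z i * z j * z k * z l)) + (\<Sum>m\<in>I. t m * t m) =
    (- 2 * ((\<Sum>i\<in>I. \<Sum>j\<in>I. q i j i j) + C2)) *\<^sub>R 1"
proof -
  have "(\<Sum>i\<in>I. \<Sum>j\<in>I. \<Sum>k\<in>I. \<Sum>l\<in>I. q i j k l *\<^sub>R (z i * z j * z k * z l)) + (\<Sum>m\<in>I. t m * t m) =
    (\<Sum>i\<in>I. \<Sum>j\<in>I. \<Sum>k\<in>I. \<Sum>l\<in>I. R i j k l *\<^sub>R (z i * z j * z k * z l))"
    unfolding t_square_sum R_def by (simp only: sum.distrib scaleR_add_left)
  also have "\<dots> = (- 2 * (\<Sum>i\<in>I. \<Sum>j\<in>I. R i j i j)) *\<^sub>R 1" by (rule curvature_sum) fact+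
  also have "(\<Sum>i\<in>I. \<Sum>j\<in>I. R i j i j) = (\<Sum>i\<in>I. \<Sum>j\<in>I. q i j i j) + C2"
    unfolding R_def C2_def by (simp add: sum.distrib power2_eq_square)
  finally show ?thesis .
qed

end

text \<open>Links the torsion, a sum over i < j < k, to the sums over all triples in which
  contractions are computed.\<close>

lemma sum_ordered_triples:
  fixes f :: "nat \<Rightarrow> nat \<Rightarrow> nat \<Rightarrow> 'b::real_vector"
  assumes fin: "finite I"
    and f12: "\<And>i j k. {i, j, k} \<subseteq> I \<Longrightarrow> f j i k = f i j k" and f23: "\<And>i j k. {i, j, k} \<subseteq> I \<Longrightarrow> f i k j = f i j k"
    and same: "\<And>i j. {i, j} \<subseteq> I \<Longrightarrow> f i i j = 0"
  shows "(\<Sum>i\<in>I. \<Sum>j\<in>I. \<Sum>k\<in>I. f i j k) = 6 *\<^sub>R (\<Sum>(i, j, k)\<in>{(i, j, k). i \<in> I \<and> j \<in> I \<and> k \<in> I \<and> i < j \<and> j < k}. f i j k)"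
proof -
  let ?g = "\<lambda>(i, j, k). f i j k"
  let ?X = "\<lambda>P. {(i, j, k). i \<in> I \<and> j \<in> I \<and> k \<in> I \<and> P i j k}"
  let ?S = "sum ?g (?X (\<lambda>i j k. i < j \<and> j < k))"
  have finX: "finite (?X P)" for P :: "nat \<Rightarrow> nat \<Rightarrow> nat \<Rightarrow> bool"
    by (rule finite_subset[of _ "I \<times> I \<times> I"]) (use fin in auto)
  have same2: "f i j j = 0" "f j i j = 0" if "{i, j} \<subseteq> I" for i j
    using same[of j i] f12[of i j j] f23[of j j i] that by auto
  have "(\<Sum>i\<in>I. \<Sum>j\<in>I. \<Sum>k\<in>I. f i j k) = sum ?g (I \<times> I \<times> I)"
    by (simp add: sum.cartesian_product)
  also have "\<dots> = sum ?g (?X (\<lambda>i j k. i \<noteq> j \<and> j \<noteq> k \<and> i \<noteq> k))"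
    by (rule sum.mono_neutral_right) (use fin same same2 in auto)
  also have "?X (\<lambda>i j k. i \<noteq> j \<and> j \<noteq> k \<and> i \<noteq> k) = ?X (\<lambda>i j k. i < j \<and> j < k) \<union> (?X (\<lambda>i j k. i < k \<and> k < j) \<union>
      (?X (\<lambda>i j k. j < i \<and> i < k) \<union> (?X (\<lambda>i j k. j < k \<and> k < i) \<union> (?X (\<lambda>i j k. k < i \<and> i < j) \<union> ?X (\<lambda>i j k. k < j \<and> j < i)))))"
    by auto
  also have "sum ?g \<dots> = ?S + (sum ?g (?X (\<lambda>i j k. i < k \<and> k < j)) + (sum ?g (?X (\<lambda>i j k. j < i \<and> i < k)) +
      (sum ?g (?X (\<lambda>i j k. j < k \<and> k < i)) + (sum ?g (?X (\<lambda>i j k. k < i \<and> i < j)) + sum ?g (?X (\<lambda>i j k. k < j \<and> j < i))))))"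
    by (subst sum.union_disjoint, (rule finX | rule finite_UnI)+, force)+ (rule refl)
  also have "sum ?g (?X (\<lambda>i j k. i < k \<and> k < j)) = ?S"
    by (rule sum.reindex_bij_witness[of _ "\<lambda>(i, j, k). (i, k, j)" "\<lambda>(i, j, k). (i, k, j)"]) (use f23 in auto)
  also have "sum ?g (?X (\<lambda>i j k. j < i \<and> i < k)) = ?S"
    by (rule sum.reindex_bij_witness[of _ "\<lambda>(i, j, k). (j, i, k)" "\<lambda>(i, j, k). (j, i, k)"]) (use f12 in auto)
  also have "sum ?g (?X (\<lambda>i j k. j < k \<and> k < i)) = ?S"
  proof (rule sum.reindex_bij_witness[of _ "\<lambda>(i, j, k). (k, i, j)" "\<lambda>(i, j, k). (j, k, i)"], goal_cases)
    case (5 a) then show ?case using f12[of "fst a" "fst (snd a)" "snd (snd a)"] f23[of "fst (snd a)" "fst a" "snd (snd a)"] by auto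
  qed auto
  also have "sum ?g (?X (\<lambda>i j k. k < i \<and> i < j)) = ?S"
  proof (rule sum.reindex_bij_witness[of _ "\<lambda>(i, j, k). (j, k, i)" "\<lambda>(i, j, k). (k, i, j)"], goal_cases)
    case (5 a) then show ?case using f23[of "fst a" "fst (snd a)" "snd (snd a)"] f12[of "fst a" "snd (snd a)" "fst (snd a)"] by auto
  qed auto
  also have "sum ?g (?X (\<lambda>i j k. k < j \<and> j < i)) = ?S"
  proof (rule sum.reindex_bij_witness[of _ "\<lambda>(i, j, k). (k, j, i)" "\<lambda>(i, j, k). (k, j, i)"], goal_cases)
    case (5 a) then show ?case using f12[of "fst a" "fst (snd a)" "snd (snd a)"] f23[of "fst (snd a)" "fst a" "snd (snd a)"]
        f12[of "fst (snd a)" "snd (snd a)" "fst a"] by auto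
  qed auto
  finally show ?thesis by (simp add: scaleR_numeral_expand add.assoc)
qed

context three_form
begin

lemma T6_ordered:
  "T6 = 6 *\<^sub>R (\<Sum>(i, j, k)\<in>{(i, j, k). i \<in> I \<and> j \<in> I \<and> k \<in> I \<and> i < j \<and> j < k}. c i j k *\<^sub>R (z i * z j * z k))"
  unfolding T6_eq
proof (rule sum_ordered_triples[OF fin])
  fix i j k assume I: "{i, j, k} \<subseteq> I"
  show "c j i k *\<^sub>R (z j * z i * z k) = c i j k *\<^sub>R (z i * z j * z k)"
    by (cases "i = j") (use I c12[of i j k] anticomm[of i j] in simp_all)
  show "c i k j *\<^sub>R (z i * z k * z j) = c i j k *\<^sub>R (z i * z j * z k)"
    by (cases "j = k") (use I c23[of i j k] anticomm[of j k] in \<open>simp_all add: mult.assoc\<close>)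
qed simp

end

subsection \<open>The monomial basis\<close>

context clifford_relations
begin

definition lmon :: "nat list \<Rightarrow> 'c" where "lmon L = prod_list (map z L)"
definition mon :: "nat set \<Rightarrow> 'c" where "mon A = lmon (sorted_list_of_set A)"

lemma lmon_simps [simp]: "lmon [] = 1" "lmon (i # L) = z i * lmon L"
  unfolding lmon_def by simp_all

lemma mon_empty [simp]: "mon {} = 1"
  unfolding mon_def by simp

text \<open>The sign for moving z i across the monomial of A: one change for each generator in A,
  except z i itself, which commutes with itself.\<close>

definition sgn1 :: "nat set \<Rightarrow> nat \<Rightarrow> real" where
  "sgn1 A i = (- 1) ^ card A * (if i \<in> A then - 1 else 1)"

lemma lmon_comm:
  assumes "i \<in> I" "set L \<subseteq> I" "distinct L"
  shows "lmon L * z i = sgn1 (set L) i *\<^sub>R (z i * lmon L)"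
  using assms(2,3)
proof (induction L)
  case (Cons j L)
  have IH: "lmon L * z i = sgn1 (set L) i *\<^sub>R (z i * lmon L)" using Cons by simp
  have "lmon (j # L) * z i = sgn1 (set L) i *\<^sub>R (z j * (z i * lmon L))" using IH by (simp add: mult.assoc)
  also have "\<dots> = sgn1 (set (j # L)) i *\<^sub>R (z i * lmon (j # L))"
  proof (cases "i = j")
    case True
    then show ?thesis using Cons.prems by (simp add: sgn1_def)
  next
    case False
    have "z j * (z i * lmon L) = - (z i * (z j * lmon L))" using swap_left[of i j "lmon L"] assms(1) Cons.prems False by simp
    then show ?thesis using Cons.prems False by (simp add: sgn1_def)
  qed
  finally show ?case .
qed (simp add: sgn1_def)

lemma mon_comm:
  assumes "i \<in> I" "A \<subseteq> I"
  shows "mon A * z i = sgn1 A i *\<^sub>R (z i * mon A)"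
  using lmon_comm[OF assms(1), of "sorted_list_of_set A"] assms(2) finite_subset[OF assms(2) fin]
  unfolding mon_def by simp

lemma lmon_insort:
  assumes "i \<in> I" "set L \<subseteq> I" "i \<notin> set L"
  shows "\<exists>s\<in>{1, - 1 :: real}. z i * lmon L = s *\<^sub>R lmon (insort i L)"
  using assms(2,3)
proof (induction L)
  case (Cons j L)
  show ?case
  proof (cases "i \<le> j")
    case False
    have "set L \<subseteq> I" "i \<notin> set L" using Cons.prems False by auto
    then obtain s where s: "s \<in> {1, - 1 :: real}" "z i * lmon L = s *\<^sub>R lmon (insort i L)" using Cons.IH by blast
    have "z i * lmon (j # L) = (- s) *\<^sub>R lmon (insort i (j # L))"
      using swap_left[of j i "lmon L"] Cons.prems assms(1) s(2) False by auto
    then show ?thesis by (rule bexI) (use s(1) in auto)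
  qed auto
qed auto

lemma lmon_remove:
  assumes "i \<in> I" "set L \<subseteq> I" "i \<in> set L"
  shows "\<exists>s\<in>{1, - 1 :: real}. z i * lmon L = s *\<^sub>R lmon (remove1 i L)"
  using assms(2,3)
proof (induction L)
  case (Cons j L)
  show ?case
  proof (cases "i = j")
    case True
    then show ?thesis using assms(1) by auto
  next
    case False
    have "set L \<subseteq> I" "i \<in> set L" using Cons.prems False by auto
    then obtain s where s: "s \<in> {1, - 1 :: real}" "z i * lmon L = s *\<^sub>R lmon (remove1 i L)" using Cons.IH by blast
    have "z i * lmon (j # L) = (- s) *\<^sub>R lmon (remove1 i (j # L))"
      using swap_left[of j i "lmon L"] Cons.prems assms(1) s(2) False by auto
    then show ?thesis by (rule bexI) (use s(1) in auto)
  qed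
qed auto

definition flip :: "nat \<Rightarrow> nat set \<Rightarrow> nat set" where "flip i A = (if i \<in> A then A - {i} else insert i A)"

lemma flip_flip [simp]: "flip i (flip i A) = A"
  unfolding flip_def by auto

lemma flip_subset: "i \<in> I \<Longrightarrow> A \<subseteq> I \<Longrightarrow> flip i A \<subseteq> I"
  unfolding flip_def by auto

lemma even_card_flip: "finite A \<Longrightarrow> even (card (flip i A)) \<longleftrightarrow> odd (card A)"
  unfolding flip_def by (auto simp: card_Diff_singleton card_gt_0_iff)

text \<open>Up to sign a generator permutes the monomials. This makes the average \<open>H\<close>
  invariant and lets generators exchange the two parities.\<close>

lemma z_mon:
  assumes "i \<in> I" "A \<subseteq> I"
  shows "\<exists>s\<in>{1, - 1 :: real}. z i * mon A = s *\<^sub>R mon (flip i A)"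
proof -
  have f: "finite A" by (rule finite_subset[OF assms(2) fin])
  show ?thesis
  proof (cases "i \<in> A")
    case True
    then show ?thesis
      using lmon_remove[OF assms(1), of "sorted_list_of_set A"] f assms(2)
      by (simp add: mon_def flip_def sorted_list_of_set_remove)
  next
    case False
    then show ?thesis
      using lmon_insort[OF assms(1), of "sorted_list_of_set A"] f assms(2)
      by (simp add: mon_def flip_def sorted_list_of_set_insert)
  qed
qed

definition parity_span :: "bool \<Rightarrow> 'c set" where
  "parity_span e = span {mon A |A. A \<subseteq> I \<and> even (card A) = e}"

lemma one_parity: "1 \<in> parity_span True"
  unfolding parity_span_def by (rule span_base) (rule CollectI, rule exI[of _ "{}"], simp)

lemma z_parity:
  assumes "i \<in> I" "x \<in> parity_span e"
  shows "z i * x \<in> parity_span (\<not> e)"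
  using assms(2) unfolding parity_span_def[of e]
proof (induction rule: span_induct_alt)
  case base
  then show ?case by (simp add: parity_span_def span_zero)
next
  case (step c x y)
  then obtain A where A: "x = mon A" "A \<subseteq> I" "even (card A) = e" by blast
  obtain s where s: "z i * mon A = s *\<^sub>R mon (flip i A)" using z_mon[OF assms(1) A(2)] by blast
  have "mon (flip i A) \<in> parity_span (\<not> e)"
    unfolding parity_span_def
    by (rule span_base) (use A assms(1) flip_subset even_card_flip[OF finite_subset[OF A(2) fin]] in blast)
  then have "c *\<^sub>R (s *\<^sub>R mon (flip i A)) + z i * y \<in> parity_span (\<not> e)"
    using step(2) unfolding parity_span_def by (intro span_add span_scale)
  then show ?case by (simp add: distrib_left A s)
qed

lemma vector_parity:
  assumes "v \<in> span (z ` I)" "x \<in> parity_span e"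
  shows "v * x \<in> parity_span (\<not> e)"
  using assms(1)
proof (induction rule: span_induct_alt)
  case base
  then show ?case by (simp add: parity_span_def span_zero)
next
  case (step c u y)
  then show ?case using z_parity[OF _ assms(2)]
    unfolding parity_span_def by (auto simp: distrib_right intro!: span_add span_scale)
qed

lemma prod_list_parity:
  assumes "set vs \<subseteq> span (z ` I)"
  shows "prod_list vs \<in> parity_span (even (length vs))"
  using assms
proof (induction vs)
  case Nil
  then show ?case using one_parity by simp
next
  case (Cons v vs)
  then show ?case using vector_parity[of v "prod_list vs" "even (length vs)"] by simp
qed

text \<open>The projection onto the commutant of \<open>z i\<close>.\<close>

definition proj1 :: "nat \<Rightarrow> 'c \<Rightarrow> 'c" where "proj1 i x = (1/2) *\<^sub>R (x - z i * x * z i)"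

definition projs :: "nat list \<Rightarrow> 'c \<Rightarrow> 'c" where "projs js = foldr proj1 js"

lemma projs_simps [simp]: "projs [] x = x" "projs (j # js) x = proj1 j (projs js x)"
  unfolding projs_def by simp_all

lemma proj1_linear: "linear (proj1 i)"
  unfolding proj1_def by (rule linearI) (simp_all add: algebra_simps)

lemma projs_linear: "linear (projs js)"
proof (induction js)
  case Nil
  then show ?case by (auto intro!: linearI)
next
  case (Cons j js)
  then show ?case using linear_compose[OF Cons proj1_linear[of j]] by (simp add: o_def)
qed

lemma proj1_mon:
  assumes "i \<in> I" "A \<subseteq> I" "even (card A)"
  shows "proj1 i (mon A) = (if i \<in> A then 0 else mon A)"
proof -
  have "z i * mon A * z i = z i * (mon A * z i)" by (simp add: mult.assoc)
  also have "\<dots> = - (if i \<in> A then - 1 else 1) *\<^sub>R mon A"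
    unfolding mon_comm[OF assms(1,2)] using assms by (simp add: sgn1_def)
  finally have e: "z i * mon A * z i = - (if i \<in> A then - 1 else 1) *\<^sub>R mon A" .
  show ?thesis unfolding proj1_def e by (simp add: scaleR_2[symmetric])
qed

lemma projs_mon:
  assumes "set js \<subseteq> I" "A \<subseteq> I" "even (card A)"
  shows "projs js (mon A) = (if set js \<inter> A = {} then mon A else 0)"
  using assms(1)
proof (induction js)
  case (Cons j js)
  then show ?case using proj1_mon[of j A] assms linear_0[OF proj1_linear[of j]] by auto
qed simp

text \<open>Among even elements only scalars commute with all generators. Parity matters: with an
  odd number of generators their full product is an odd element that all the projections
  fix.\<close>

lemma projs_parity:
  assumes "set js = I" "x \<in> parity_span True"
  shows "\<exists>r. projs js x = r *\<^sub>R 1"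
  using assms(2) unfolding parity_span_def
proof (induction rule: span_induct_alt)
  case base
  then show ?case using linear_0[OF projs_linear] by (intro exI[of _ 0]) simp
next
  case (step c x y)
  then obtain A where A: "x = mon A" "A \<subseteq> I" "even (card A)" by blast
  obtain r where r: "projs js y = r *\<^sub>R 1" using step(2) by blast
  have "projs js x = (if A = {} then 1 else 0) *\<^sub>R 1"
    using projs_mon[of js A] A assms(1) by (auto simp: Int_absorb2 Int_absorb1)
  then have "projs js (c *\<^sub>R x + y) = (c * (if A = {} then 1 else 0) + r) *\<^sub>R 1"
    by (simp add: linear_add[OF projs_linear] linear_scale[OF projs_linear] r scaleR_add_left)
  then show ?case by blast
qed

lemma projs_bivector:
  assumes "set js = I" "\<And>i. i \<in> I \<Longrightarrow> b i i = 0"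
  shows "projs js (\<Sum>i\<in>I. \<Sum>j\<in>I. b i j *\<^sub>R (z i * z j)) = 0"
proof -
  have "b i j *\<^sub>R projs js (z i * z j) = 0" if ij: "i \<in> I" "j \<in> I" for i j
  proof (cases "i = j")
    case False
    have "mon {j} = z j" by (simp add: mon_def)
    then have "\<exists>s\<in>{1, - 1 :: real}. z i * z j = s *\<^sub>R mon {i, j}"
      using z_mon[of i "{j}"] ij False by (simp add: flip_def)
    then obtain s where s: "z i * z j = s *\<^sub>R mon {i, j}" by blast
    have "projs js (mon {i, j}) = 0" using projs_mon[of js "{i, j}"] assms(1) ij False by auto
    then show ?thesis unfolding s by (simp add: linear_scale[OF projs_linear])
  qed (use assms(2) ij in simp)
  then show ?thesis unfolding linear_sum[OF projs_linear] linear_scale[OF projs_linear]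
    by (intro sum.neutral ballI) simp
qed

end

subsection \<open>Clifford modules\<close>

locale clifford_module = clifford_relations z I
  for z :: "nat \<Rightarrow> 'c::real_algebra_1" and I :: "nat set" +
  fixes act :: "'c \<Rightarrow> 'v::euclidean_space \<Rightarrow> 'v"
  assumes act_add_left: "act (x + y) v = act x v + act y v"
    and act_scale_left: "act (r *\<^sub>R x) v = r *\<^sub>R act x v"
    and act_add_right: "act x (v + w) = act x v + act x w"
    and act_scale_right: "act x (r *\<^sub>R v) = r *\<^sub>R act x v"
    and act_mult: "act (x * y) v = act x (act y v)"
    and act_one: "act 1 v = v"
begin

lemma act_linear: "linear (act x)"
  by (rule linearI) (simp_all add: act_add_right act_scale_right)

lemma act_linear_left: "linear (\<lambda>x. act x v)"
  by (rule linearI) (simp_all add: act_add_left act_scale_left)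

lemmas act_simps = act_add_left act_scale_left act_mult act_one
  linear_add[OF act_linear] linear_scale[OF act_linear] linear_diff[OF act_linear] linear_neg[OF act_linear]
  linear_0[OF act_linear] linear_sum[OF act_linear]
  linear_diff[OF act_linear_left] linear_neg[OF act_linear_left]
  linear_0[OF act_linear_left] linear_sum[OF act_linear_left]

lemma act_tendsto:
  "(f \<longlongrightarrow> l) F \<Longrightarrow> ((\<lambda>s. act x (f s)) \<longlongrightarrow> act x l) F"
  by (rule bounded_linear.tendsto[OF linear_conv_bounded_linear[THEN iffD1, OF act_linear]])

lemma act_z_z: "i \<in> I \<Longrightarrow> act (z i) (act (z i) v) = - v"
  unfolding act_mult[symmetric] by (simp add: square act_simps)

text \<open>Averaging over the finite group generated by the \<open>z i\<close>.\<close>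

definition H :: "'v \<Rightarrow> 'v \<Rightarrow> real" where
  "H u v = (\<Sum>A\<in>Pow I. act (mon A) u \<bullet> act (mon A) v)"

lemma H_bilinear: "bilinear H"
  unfolding H_def bilinear_def
  by (auto intro!: linearI simp: act_simps inner_add_left inner_add_right sum.distrib sum_distrib_left)

lemma H_sym: "H u v = H v u"
  unfolding H_def by (simp add: inner_commute)

lemma H_pos: "v \<noteq> 0 \<Longrightarrow> H v v > 0"
proof -
  assume v: "v \<noteq> 0"
  have "act (mon {}) v \<bullet> act (mon {}) v \<le> H v v"
    unfolding H_def by (rule member_le_sum) (use fin in auto)
  moreover have "act (mon {}) v \<bullet> act (mon {}) v > 0" using v by (simp add: act_one)
  ultimately show ?thesis by linarith
qed

lemma H_isometry:
  assumes i: "i \<in> I"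
  shows "H (act (z i) u) (act (z i) v) = H u v"
proof -
  have "act (mon A) (act (z i) u) \<bullet> act (mon A) (act (z i) v) = act (mon (flip i A)) u \<bullet> act (mon (flip i A)) v"
    if A: "A \<subseteq> I" for A
  proof -
    obtain s where s: "s \<in> {1, - 1 :: real}" "z i * mon A = s *\<^sub>R mon (flip i A)" using z_mon[OF i A] by blast
    have "sgn1 A i * sgn1 A i = 1" unfolding sgn1_def by (simp add: power_mult_distrib[symmetric])
    moreover have "act (mon A) (act (z i) w) = (sgn1 A i * s) *\<^sub>R act (mon (flip i A)) w" for w
      unfolding act_mult[symmetric] mon_comm[OF i A] s(2) by (simp add: act_simps)
    ultimately show ?thesis using s(1) by (auto simp: mult.assoc[symmetric])
  qed
  then have "H (act (z i) u) (act (z i) v) = (\<Sum>A\<in>Pow I. act (mon (flip i A)) u \<bullet> act (mon (flip i A)) v)"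
    unfolding H_def by (intro sum.cong) auto
  also have "\<dots> = H u v" unfolding H_def
    by (rule sum.reindex_bij_witness[of _ "flip i" "flip i"]) (use flip_subset[OF i] in auto)
  finally show ?thesis .
qed

lemma H_skew: "i \<in> I \<Longrightarrow> H (act (z i) u) v = - H u (act (z i) v)"
  using H_isometry[of i u "act (z i) v"] by (simp add: act_z_z bilinear_simps[OF H_bilinear])

text \<open>For i different from j, z i z j is a product of two anticommuting H-skew maps and is
  therefore itself H-skew.\<close>

lemma H_bivector:
  assumes "\<And>i. i \<in> I \<Longrightarrow> b i i = (0::real)"
  shows "H (act (\<Sum>i\<in>I. \<Sum>j\<in>I. b i j *\<^sub>R (z i * z j)) v) v = 0"
proof -
  have "b i j * H (act (z i) (act (z j) v)) v = 0" if ij: "i \<in> I" "j \<in> I" for i j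
  proof (cases "i = j")
    case False
    have "H (act (z i) (act (z j) v)) v = H v (act (z j) (act (z i) v))"
      by (simp add: H_skew ij)
    also have "act (z j) (act (z i) v) = - act (z i) (act (z j) v)"
      unfolding act_mult[symmetric] anticomm[OF ij False] by (simp add: act_simps)
    also have "H v (- act (z i) (act (z j) v)) = - H (act (z i) (act (z j) v)) v"
      by (simp add: bilinear_simps[OF H_bilinear] H_sym)
    finally show ?thesis by simp
  qed (use assms ij in simp)
  then show ?thesis unfolding act_simps bilinear_simps[OF H_bilinear] by (intro sum.neutral ballI) simp
qed

text \<open>As z j squares to -1, the part removed by the projection is half of z j times the
  commutator of x with z j; this lets commutators control x.\<close>

lemma act_proj1: "j \<in> I \<Longrightarrow> act (x - proj1 j x) w = (1/2) *\<^sub>R act (z j) (act x (act (z j) w) - act (z j) (act x w))"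
proof -
  assume j: "j \<in> I"
  have "x - proj1 j x = (1/2) *\<^sub>R (x + z j * x * z j)" 
    proof -
    have "x = (1/2) *\<^sub>R x + (1/2) *\<^sub>R x" by (simp add: scaleR_left_distrib[symmetric])
    then show ?thesis unfolding proj1_def scaleR_diff_right scaleR_add_right by (simp add: algebra_simps)
  qed
  then show ?thesis using j by (simp add: act_simps act_z_z)
qed

text \<open>A curve of even elements near the identity is determined to first order, up to a scalar, by
  its commutators with the generators.\<close>

lemma projs_derivative:
  fixes x :: "real \<Rightarrow> 'c"
  assumes comm: "\<And>j w. j \<in> I \<Longrightarrow> ((\<lambda>s. (1 / s) *\<^sub>R (act (x s) (act (z j) w) - act (z j) (act (x s) w))) \<longlongrightarrow>
      act (B * z j - z j * B) w) (at 0)"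
    and js: "set js \<subseteq> I"
  shows "((\<lambda>s. (1 / s) *\<^sub>R act (x s - projs js (x s)) w) \<longlongrightarrow> act (B - projs js B) w) (at 0)"
  using js
proof (induction js arbitrary: w)
  case Nil
  then show ?case by (simp add: act_simps)
next
  case (Cons j js)
  then have j: "j \<in> I" by simp
  \<comment> \<open>What all projections remove is what the last one removes, a commutator with z j,
    plus the projection by z j of what the earlier ones remove; the induction hypothesis covers the
    latter.\<close>
  have split: "act (y - projs (j # js) y) w = (1/2) *\<^sub>R act (z j) (act y (act (z j) w) - act (z j) (act y w)) +
     (1/2) *\<^sub>R (act (y - projs js y) w - act (z j) (act (y - projs js y) (act (z j) w)))" for y
  proof -
    have "y - projs (j # js) y = (y - proj1 j y) + proj1 j (y - projs js y)"
      by (simp add: linear_diff[OF proj1_linear])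
    then have "act (y - projs (j # js) y) w = act (y - proj1 j y) w + act (proj1 j (y - projs js y)) w"
      by (simp only: act_add_left)
    also have "act (proj1 j (y - projs js y)) w = (1/2) *\<^sub>R (act (y - projs js y) w - act (z j) (act (y - projs js y) (act (z j) w)))"
      unfolding proj1_def by (simp only: act_simps)
    finally show ?thesis using act_proj1[OF j] by simp
  qed
  have "((\<lambda>s. (1/2) *\<^sub>R act (z j) ((1 / s) *\<^sub>R (act (x s) (act (z j) w) - act (z j) (act (x s) w))) +
     (1/2) *\<^sub>R ((1 / s) *\<^sub>R act (x s - projs js (x s)) w - act (z j) ((1 / s) *\<^sub>R act (x s - projs js (x s)) (act (z j) w))))
     \<longlongrightarrow> (1/2) *\<^sub>R act (z j) (act (B * z j - z j * B) w) +
     (1/2) *\<^sub>R (act (B - projs js B) w - act (z j) (act (B - projs js B) (act (z j) w)))) (at 0)"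
    by (intro tendsto_intros act_tendsto comm j Cons.IH) (use Cons.prems in auto)
  also have "(1/2) *\<^sub>R act (z j) (act (B * z j - z j * B) w) +
     (1/2) *\<^sub>R (act (B - projs js B) w - act (z j) (act (B - projs js B) (act (z j) w))) = act (B - projs (j # js) B) w"
    unfolding split[of B] by (simp only: act_simps)
  also have "(\<lambda>s. (1/2) *\<^sub>R act (z j) ((1 / s) *\<^sub>R (act (x s) (act (z j) w) - act (z j) (act (x s) w))) +
     (1/2) *\<^sub>R ((1 / s) *\<^sub>R act (x s - projs js (x s)) w - act (z j) ((1 / s) *\<^sub>R act (x s - projs js (x s)) (act (z j) w)))) =
     (\<lambda>s. (1 / s) *\<^sub>R act (x s - projs (j # js) (x s)) w)"
    unfolding split by (rule ext) (simp only: act_simps scaleR_add_right scaleR_diff_right scaleR_scaleR mult.commute)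
  finally show ?case .
qed

text \<open>With the scalar part r of x split off, the rest has first order term B, which has no
  scalar part. On the fixed vector this rest is (1 - r) psi, so B psi is a limit of multiples of
  psi. But B is H-skew, so H(B psi, psi) = 0 and the multiples tend to 0.\<close>

lemma bivector_annihilates_fixed:
  fixes x :: "real \<Rightarrow> 'c" and b :: "nat \<Rightarrow> nat \<Rightarrow> real"
  defines "B \<equiv> \<Sum>i\<in>I. \<Sum>j\<in>I. b i j *\<^sub>R (z i * z j)"
  assumes even: "\<And>s. x s \<in> parity_span True" and fixed: "\<And>s. act (x s) \<psi> = \<psi>"
    and b: "\<And>i. i \<in> I \<Longrightarrow> b i i = 0"
    and comm: "\<And>j w. j \<in> I \<Longrightarrow> ((\<lambda>s. (1 / s) *\<^sub>R (act (x s) (act (z j) w) - act (z j) (act (x s) w))) \<longlongrightarrow>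
      act (B * z j - z j * B) w) (at 0)"
  shows "act B \<psi> = 0"
proof (cases "\<psi> = 0")
  case False
  define js where "js = sorted_list_of_set I"
  have js: "set js = I" using fin by (simp add: js_def)
  obtain r where r: "\<And>s. projs js (x s) = r s *\<^sub>R 1" using projs_parity[OF js even] by metis
  have "projs js B = 0" unfolding B_def by (rule projs_bivector[OF js b])
  moreover have "(1 / s) *\<^sub>R act (x s - projs js (x s)) \<psi> = ((1 - r s) / s) *\<^sub>R \<psi>" for s
    unfolding r by (simp add: act_simps fixed scaleR_diff_left diff_divide_distrib scaleR_diff_right)
  ultimately have lim: "((\<lambda>s. ((1 - r s) / s) *\<^sub>R \<psi>) \<longlongrightarrow> act B \<psi>) (at 0)"
    using projs_derivative[OF comm, of js \<psi>] js by simp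
  have blH: "bounded_linear (\<lambda>v. H v \<psi>)"
    using H_bilinear linear_conv_bounded_linear by (auto simp: bilinear_def)
  have p: "H \<psi> \<psi> > 0" by (rule H_pos[OF False])
  have "((\<lambda>s. H (((1 - r s) / s) *\<^sub>R \<psi>) \<psi>) \<longlongrightarrow> H (act B \<psi>) \<psi>) (at 0)"
    by (rule bounded_linear.tendsto[OF blH lim])
  then have "((\<lambda>s. (1 - r s) / s * H \<psi> \<psi>) \<longlongrightarrow> 0) (at 0)"
    using H_bivector[where b = b and v = \<psi>, OF b] unfolding B_def by (simp add: bilinear_simps[OF H_bilinear])
  then have "((\<lambda>s. (1 - r s) / s * H \<psi> \<psi> / H \<psi> \<psi>) \<longlongrightarrow> 0 / H \<psi> \<psi>) (at 0)"
    by (rule tendsto_divide[OF _ tendsto_const]) (use p in simp)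
  then have "((\<lambda>s. (1 - r s) / s) \<longlongrightarrow> 0) (at 0)" using p by simp
  then have "((\<lambda>s. ((1 - r s) / s) *\<^sub>R \<psi>) \<longlongrightarrow> 0 *\<^sub>R \<psi>) (at 0)" by (intro tendsto_intros)
  with lim show ?thesis using LIM_unique by fastforce
qed (simp add: act_simps)

end

subsection \<open>The reductive decomposition\<close>

context naturally_reductive
begin

sublocale G: lie_group "Grp M"
  by (rule lie_group)

abbreviation br :: "'e \<Rightarrow> 'e \<Rightarrow> 'e" where "br \<equiv> bracket (Grp M)"
abbreviation Q :: "'e \<Rightarrow> 'e \<Rightarrow> real" where "Q \<equiv> Qf M"
abbreviation Iz :: "nat set" where "Iz \<equiv> {1..dim_m M}"
abbreviation Ih :: "nat set" where "Ih \<equiv> {1..dim_h M}"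

lemmas brs = bilinear_simps[OF G.bracket_bilinear] and Qs = bilinear_simps[OF Q_form(1)]

lemma subspace_hh: "subspace (hh M)"
  unfolding XY_bases(1)[symmetric] by (rule subspace_span)

lemma Q_m_h: "X \<in> mm M \<Longrightarrow> Y \<in> hh M \<Longrightarrow> Q X Y = 0"
  using Q_h_m[of Y X] Q_form(2)[of X Y] by simp

definition pm :: "'e \<Rightarrow> 'e" where "pm X = (THE W. W \<in> mm M \<and> X - W \<in> hh M)"

lemma decomposition_unique:
  assumes "W \<in> mm M" "X - W \<in> hh M" "W' \<in> mm M" "X - W' \<in> hh M"
  shows "W = W'"
proof -
  have "W - W' \<in> mm M" using assms reductive(1) by (simp add: subspace_diff)
  moreover have "(X - W') - (X - W) \<in> hh M" by (rule subspace_diff[OF subspace_hh assms(4,2)])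
  then have "W - W' \<in> hh M" by simp
  ultimately have "W - W' \<in> {0}" unfolding reductive(2)[symmetric] by (rule IntI[rotated])
  then show ?thesis by simp
qed

lemma pm_eqI: "W \<in> mm M \<Longrightarrow> X - W \<in> hh M \<Longrightarrow> pm X = W"
  unfolding pm_def by (rule the_equality) (auto intro: decomposition_unique)

lemma pm_props: "pm X \<in> mm M" "X - pm X \<in> hh M"
proof -
  obtain A B where "X = A + B" "A \<in> hh M" "B \<in> mm M" using reductive(3) by blast
  then have "B \<in> mm M \<and> X - B \<in> hh M" by simp
  moreover from this have "pm X = B" using pm_eqI by blast
  ultimately show "pm X \<in> mm M" "X - pm X \<in> hh M" by auto
qed

lemma pm_mm [simp]: "X \<in> mm M \<Longrightarrow> pm X = X"
  by (rule pm_eqI) (auto simp: subspace_0[OF subspace_hh])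

lemma pm_hh: "X \<in> hh M \<Longrightarrow> pm X = 0"
  by (rule pm_eqI) (auto simp: subspace_0[OF reductive(1)])

lemma pm_linear: "linear pm"
proof (rule linearI)
  show "pm (X + Y) = pm X + pm Y" for X Y
  proof (rule pm_eqI)
    have "(X - pm X) + (Y - pm Y) \<in> hh M" by (intro subspace_add[OF subspace_hh] pm_props)
    then show "X + Y - (pm X + pm Y) \<in> hh M" by (simp add: algebra_simps)
  qed (intro subspace_add[OF reductive(1)] pm_props)
  show "pm (c *\<^sub>R X) = c *\<^sub>R pm X" for c X
  proof (rule pm_eqI)
    have "c *\<^sub>R (X - pm X) \<in> hh M" by (intro subspace_scale[OF subspace_hh] pm_props)
    then show "c *\<^sub>R X - c *\<^sub>R pm X \<in> hh M" by (simp add: scaleR_diff_right)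
  qed (intro subspace_scale[OF reductive(1)] pm_props)
qed

lemma brm_eq: "brm M X Y = pm (br X Y)"
  unfolding brm_def pm_def ..

lemma Q_pm: "Y \<in> mm M \<Longrightarrow> Q (pm X) Y = Q X Y"
  using Q_h_m[OF pm_props(2)[of X], of Y] by (simp add: Qs)

text \<open>Q is definite on m, so h is the full Q-orthogonal complement of m. The stability of h
  under its own bracket and under Ad of H is derived from this description.\<close>

lemma hh_iff: "X \<in> hh M \<longleftrightarrow> (\<forall>Y\<in>mm M. Q X Y = 0)"
proof
  assume a: "\<forall>Y\<in>mm M. Q X Y = 0"
  have "Q (pm X) (pm X) = 0" using a pm_props(1)[of X] by (simp add: Q_pm)
  then have "pm X = 0"
    using pm_props(1)[of X] Q_m[of "pm X" "pm X"] ip_inner_product(4)[of "pm X"] by fastforce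
  then show "X \<in> hh M" using pm_props(2)[of X] by simp
qed (use Q_h_m in blast)

lemma Z_mem: "i \<in> Iz \<Longrightarrow> Zb M i \<in> mm M"
  using Z_basis(1) span_base[of "Zb M i" "Zb M ` Iz"] by auto

lemma dual_Z: "dual_bases Q Iz (Zb M) (Zb M) (mm M)"
  unfolding dual_bases_def using Z_basis by (auto simp: Q_m Z_mem)

lemma dual_XY: "dual_bases Q Ih (Xb M) (Yb M) (hh M)"
  unfolding dual_bases_def using XY_bases by auto

lemma mm_expand: "X \<in> mm M \<Longrightarrow> X = (\<Sum>i\<in>Iz. Q X (Zb M i) *\<^sub>R Zb M i)"
  by (rule dual_bases_expand_left[OF Q_form(1) dual_Z])

lemma pm_expand: "pm X = (\<Sum>i\<in>Iz. Q X (Zb M i) *\<^sub>R Zb M i)"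
  using mm_expand[OF pm_props(1)[of X]] by (simp add: Q_pm Z_mem)

definition Ig :: "(nat + nat) set" where "Ig = Inl ` Iz \<union> Inr ` Ih"
definition Eb :: "nat + nat \<Rightarrow> 'e" where "Eb = case_sum (Zb M) (Xb M)"
definition Fb :: "nat + nat \<Rightarrow> 'e" where "Fb = case_sum (Zb M) (Yb M)"

lemma sum_Ig: "(\<Sum>i\<in>Ig. f i) = (\<Sum>i\<in>Iz. f (Inl i)) + (\<Sum>i\<in>Ih. f (Inr i))"
  unfolding Ig_def by (subst sum.union_disjoint) (auto simp: sum.reindex)

lemma dual_EF: "dual_bases Q Ig Eb Fb UNIV"
proof -
  have X: "Xb M i \<in> hh M" "Yb M i \<in> hh M" if "i \<in> Ih" for i
    using dual_bases_mem[OF dual_XY that] by auto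
  have sp: "span (Zb M ` Iz \<union> V ` Ih) = UNIV" if V: "span (V ` Ih) = hh M" for V
  proof -
    have "x \<in> span (Zb M ` Iz \<union> V ` Ih)" for x
    proof -
      have "pm x \<in> span (Zb M ` Iz \<union> V ` Ih)" "x - pm x \<in> span (Zb M ` Iz \<union> V ` Ih)"
        using pm_props[of x] V Z_basis(1) span_mono[of "Zb M ` Iz" "Zb M ` Iz \<union> V ` Ih"]
          span_mono[of "V ` Ih" "Zb M ` Iz \<union> V ` Ih"] by auto
      from span_add[OF this] show ?thesis by simp
    qed
    then show ?thesis by auto
  qed
  have im: "Eb ` Ig = Zb M ` Iz \<union> Xb M ` Ih" "Fb ` Ig = Zb M ` Iz \<union> Yb M ` Ih"
    unfolding Ig_def Eb_def Fb_def by (auto simp: image_Un image_image)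
  show ?thesis unfolding dual_bases_def
  proof (intro conjI ballI)
    show "finite Ig" unfolding Ig_def by simp
    show "span (Eb ` Ig) = UNIV" "span (Fb ` Ig) = UNIV" unfolding im using sp XY_bases by auto
    fix i j assume "i \<in> Ig" "j \<in> Ig"
    then show "Q (Eb i) (Fb j) = (if i = j then 1 else 0)"
    proof -
      have "Q (Zb M i) (Zb M j) = (if i = j then 1 else 0)" if "i \<in> Iz" "j \<in> Iz" for i j
        using dual_Z that unfolding dual_bases_def by blast
      moreover have "Q (Xb M i) (Yb M j) = (if i = j then 1 else 0)" if "i \<in> Ih" "j \<in> Ih" for i j
        using dual_XY that unfolding dual_bases_def by blast
      moreover have "Q (Xb M i) (Zb M j) = 0" if "i \<in> Ih" "j \<in> Iz" for i j
        using Q_h_m X(1) Z_mem that by blast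
      moreover have "Q (Zb M i) (Yb M j) = 0" if "i \<in> Iz" "j \<in> Ih" for i j
        using Q_m_h X(2) Z_mem that by blast
      ultimately show ?thesis
        using \<open>i \<in> Ig\<close> \<open>j \<in> Ig\<close> unfolding Ig_def Eb_def Fb_def
        by (auto simp del: atLeastAtMost_iff One_nat_def split: if_splits)
    qed
  qed
qed

section \<open>Infinitesimal invariance under G and the isotropy action of h\<close>

lemma Q_br: "Q (br W X) Y = - Q X (br W Y)"
proof -
  have bb: "bounded_bilinear Q" using Q_form(1) bilinear_conv_bounded_bilinear by blast
  have "lderiv (Grp M) W (\<lambda>b. Q (Ad (Grp M) b X) (Ad (Grp M) b Y)) \<one>\<^bsub>Grp M\<^esub> = Q X (br W Y) + Q (br W X) Y"
    using G.lderiv_bilinear[OF bb open_UNIV G.Ad_smooth G.Ad_smooth UNIV_I, of W X Y "\<one>\<^bsub>Grp M\<^esub>"]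
    by (simp add: G.lderiv_eq bracket_def G.e0_def)
  then show ?thesis by (simp add: Q_form(4))
qed

lemma has_vector_derivative_in_subspace:
  fixes f :: "real \<Rightarrow> 'b::euclidean_space"
  assumes "(f has_vector_derivative D) (at 0)" "subspace V" "\<And>s. f s \<in> V"
  shows "D \<in> V"
proof -
  have d: "((\<lambda>h. norm (f (0 + h) - f 0 - h *\<^sub>R D) / norm h) \<longlongrightarrow> 0) (at 0)"
    using assms(1) unfolding has_vector_derivative_def has_derivative_at by blast
  have "((\<lambda>h. norm ((1 / h) *\<^sub>R (f h - f 0) - D)) \<longlongrightarrow> 0) (at 0)"
  proof (rule Lim_transform_eventually[OF d])
    have "norm (f (0 + h) - f 0 - h *\<^sub>R D) / norm h = norm ((1 / h) *\<^sub>R (f h - f 0) - D)" if h: "h \<noteq> 0" for h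
    proof -
      have "f (0 + h) - f 0 - h *\<^sub>R D = h *\<^sub>R ((1 / h) *\<^sub>R (f h - f 0) - D)" using h by (simp add: scaleR_diff_right)
      then show ?thesis using h by (simp only: norm_scaleR real_norm_def nonzero_mult_div_cancel_left abs_eq_0 not_False_eq_True)
    qed
    then show "\<forall>\<^sub>F h in at 0. norm (f (0 + h) - f 0 - h *\<^sub>R D) / norm h = norm ((1 / h) *\<^sub>R (f h - f 0) - D)"
      unfolding eventually_at_filter by (intro always_eventually allI impI)
  qed
  then have lim: "((\<lambda>h. (1 / h) *\<^sub>R (f h - f 0)) \<longlongrightarrow> D) (at 0)"
    by (rule LIM_zero_cancel[OF tendsto_norm_zero_cancel])
  show ?thesis
    by (rule Lim_in_closed_set[OF closed_subspace[OF assms(2)] _ _ lim])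
       (auto intro!: always_eventually subspace_scale[OF assms(2)] subspace_diff[OF assms(2)] assms(3))
qed

lemma hhE:
  assumes "Y \<in> hh M"
  obtains \<gamma> :: "real \<Rightarrow> 'g" where "continuous_on UNIV \<gamma>" "\<And>s u. \<gamma> (s + u) = \<gamma> s \<otimes>\<^bsub>Grp M\<^esub> \<gamma> u"
    "\<And>s. \<gamma> s \<in> Sub M" "((\<lambda>s. coord (Grp M) (\<gamma> s)) has_vector_derivative Y) (at 0)" "\<gamma> 0 = \<one>\<^bsub>Grp M\<^esub>"
  using assms G.hom_zero unfolding hh_def lie_sub_def by blast

lemma curve_Ad:
  assumes "continuous_on UNIV \<gamma>" "((\<lambda>s. coord (Grp M) (\<gamma> s)) has_vector_derivative Y) (at 0)" "\<gamma> 0 = \<one>\<^bsub>Grp M\<^esub>"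
  shows "((\<lambda>s. Ad (Grp M) (\<gamma> s) X) has_vector_derivative br Y X) (at (0::real))"
  using G.curve_derivative[OF assms(1,3,2) open_UNIV G.Ad_smooth[of X] UNIV_I, where a = "\<one>\<^bsub>Grp M\<^esub>"]
  by (simp add: G.lderiv_eq bracket_def G.e0_def)

lemma br_h_m: "Y \<in> hh M \<Longrightarrow> X \<in> mm M \<Longrightarrow> br Y X \<in> mm M"
proof (erule hhE)
  fix \<gamma> :: "real \<Rightarrow> 'g"
  assume X: "X \<in> mm M" and g: "continuous_on UNIV \<gamma>" "\<And>s. \<gamma> s \<in> Sub M"
    "((\<lambda>s. coord (Grp M) (\<gamma> s)) has_vector_derivative Y) (at 0)" "\<gamma> 0 = \<one>\<^bsub>Grp M\<^esub>"
  show "br Y X \<in> mm M"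
    by (rule has_vector_derivative_in_subspace[OF curve_Ad[OF g(1,3,4)] reductive(1)]) (rule reductive(4)[OF g(2) X])
qed

lemma br_m_h: "X \<in> mm M \<Longrightarrow> Y \<in> hh M \<Longrightarrow> br X Y \<in> mm M"
  using br_h_m[of Y X] G.bracket_antisym[of X Y] subspace_neg[OF reductive(1)] by simp

lemma br_h_h: "Y \<in> hh M \<Longrightarrow> Y' \<in> hh M \<Longrightarrow> br Y Y' \<in> hh M"
  unfolding hh_iff[of "br Y Y'"] using Q_br[of Y Y'] Q_h_m[of Y'] br_h_m[of Y] by simp

lemma br_hh_pm: "Y \<in> hh M \<Longrightarrow> br Y (pm X) = pm (br Y X)"
  using br_h_h[OF _ pm_props(2)[of X], of Y] br_h_m[OF _ pm_props(1)[of X], of Y]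
  by (intro pm_eqI[symmetric]) (simp_all add: brs)

lemma Ad_hh:
  assumes "a \<in> Sub M" "X \<in> hh M"
  shows "Ad (Grp M) a X \<in> hh M"
  unfolding hh_iff
proof
  fix Y assume "Y \<in> mm M"
  have inv: "inv\<^bsub>Grp M\<^esub> a \<in> Sub M" using subgroup.m_inv_closed[OF subgroup(1) assms(1)] .
  have "Q (Ad (Grp M) a X) Y = Q (Ad (Grp M) (inv\<^bsub>Grp M\<^esub> a) (Ad (Grp M) a X)) (Ad (Grp M) (inv\<^bsub>Grp M\<^esub> a) Y)"
    by (simp only: Q_form(4))
  also have "\<dots> = 0" using Q_h_m[OF assms(2) reductive(4)[OF inv \<open>Y \<in> mm M\<close>]] by simp
  finally show "Q (Ad (Grp M) a X) Y = 0" .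
qed

lemma pm_Ad: "a \<in> Sub M \<Longrightarrow> pm (Ad (Grp M) a X) = Ad (Grp M) a (pm X)"
  using Ad_hh[OF _ pm_props(2)[of X], of a] reductive(4)[OF _ pm_props(1)[of X], of a]
  by (intro pm_eqI) (simp_all add: linear_diff[OF G.Ad_linear])

section \<open>Derivatives of fields and functions on M, and the Levi-Civita case\<close>

lemma lderiv_in_mm:
  assumes "smooth_map (Grp M) Y" "\<And>a. Y a \<in> mm M"
  shows "lderiv (Grp M) X Y a \<in> mm M"
proof -
  have s: "G.smooth_from UNIV Y" using assms(1) by (simp add: G.smooth_map_iff)
  have "lderiv (Grp M) X (\<lambda>b. pm (Y b)) a = pm (lderiv (Grp M) X Y a)"
    by (rule G.lderiv_linear_comp[OF linear_conv_bounded_linear[THEN iffD1, OF pm_linear] open_UNIV s UNIV_I])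
  moreover have "(\<lambda>b. pm (Y b)) = Y" using assms(2) by simp
  ultimately have "lderiv (Grp M) X Y a = pm (lderiv (Grp M) X Y a)" by simp
  then show ?thesis using pm_props(1)[of "lderiv (Grp M) X Y a"] by (simp only:)
qed

lemma lderiv_hh_invariant:
  assumes "smooth_map (Grp M) f" "\<And>a h. h \<in> Sub M \<Longrightarrow> f (a \<otimes>\<^bsub>Grp M\<^esub> h) = f a" "Y \<in> hh M"
  shows "lderiv (Grp M) Y f a = 0"
proof (rule hhE[OF assms(3)])
  fix \<gamma> :: "real \<Rightarrow> 'g"
  assume g: "continuous_on UNIV \<gamma>" "\<And>s. \<gamma> s \<in> Sub M" "((\<lambda>s. coord (Grp M) (\<gamma> s)) has_vector_derivative Y) (at 0)" "\<gamma> 0 = \<one>\<^bsub>Grp M\<^esub>"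
  have "((\<lambda>s. f (a \<otimes>\<^bsub>Grp M\<^esub> \<gamma> s)) has_vector_derivative lderiv (Grp M) Y f a) (at 0)"
    by (rule G.curve_derivative[OF g(1,4,3) open_UNIV _ UNIV_I]) (use assms(1) in \<open>simp add: G.smooth_map_iff\<close>)
  then have "((\<lambda>s. f a) has_vector_derivative lderiv (Grp M) Y f a) (at 0)" using assms(2) g(2) by simp
  then show ?thesis using vector_derivative_unique_at[OF _ has_vector_derivative_const] by blast
qed

text \<open>The direction Y b moves with the point. Expanding it in \<open>Basis\<close> and
  applying the product rule isolates the derivative of the field.\<close>

lemma lderiv_lderiv_field:
  fixes f :: "'g \<Rightarrow> real"
  assumes f: "G.smooth_from UNIV f" and Y: "G.smooth_from UNIV Y"
  shows "lderiv (Grp M) x (\<lambda>b. lderiv (Grp M) (Y b) f b) a =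
    lderiv (Grp M) x (lderiv (Grp M) (Y a) f) a + lderiv (Grp M) (lderiv (Grp M) x Y a) f a"
proof -
  let ?L = "\<lambda>X. lderiv (Grp M) X"
  have lin: "?L v f b = (\<Sum>c\<in>Basis. (v \<bullet> c) *\<^sub>R ?L c f b)" for v b
  proof -
    note l = G.lderiv_linear[OF open_UNIV f UNIV_I, of b]
    show ?thesis by (subst euclidean_representation[of v, symmetric]) (simp only: linear_sum[OF l] linear_scale[OF l])
  qed
  note sc = G.lderiv_smooth[OF open_UNIV f]
  have si: "G.smooth_from UNIV (\<lambda>b. Y b \<bullet> c)" for c
    by (rule G.smooth_from_linear[OF bounded_linear_inner_left open_UNIV Y])
  have st: "G.smooth_from UNIV (\<lambda>b. (Y b \<bullet> c) *\<^sub>R ?L c f b)" for c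
    by (rule G.smooth_from_bilinear[OF bounded_bilinear_scaleR open_UNIV si sc])
  have 1: "?L x (\<lambda>b. ?L (Y b) f b) a = (\<Sum>c\<in>Basis. ?L x (\<lambda>b. (Y b \<bullet> c) *\<^sub>R ?L c f b) a)"
    unfolding lin[of "Y _"]
    by (rule G.lderiv_eqI[where X = x], rule has_derivative_sum) (rule G.lderiv_has_derivative[OF open_UNIV st UNIV_I])
  have 2: "?L x (\<lambda>b. (Y b \<bullet> c) *\<^sub>R ?L c f b) a = (Y a \<bullet> c) *\<^sub>R ?L x (?L c f) a + (?L x Y a \<bullet> c) *\<^sub>R ?L c f a" for c
    using G.lderiv_bilinear[OF bounded_bilinear_scaleR open_UNIV si sc UNIV_I, of x c c a]
      G.lderiv_linear_comp[OF bounded_linear_inner_left open_UNIV Y UNIV_I, of x c a] by simp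
  have 3: "?L x (?L v f) a = (\<Sum>c\<in>Basis. (v \<bullet> c) *\<^sub>R ?L x (?L c f) a)" for v
    unfolding lin[of v, abs_def]
    by (rule G.lderiv_eqI[where X = x], rule has_derivative_sum, rule has_derivative_scaleR_right)
       (rule G.lderiv_has_derivative[OF open_UNIV sc UNIV_I])
  show ?thesis unfolding 1 2 sum.distrib 3[of "Y a"] lin[of "?L x Y a" a] ..
qed

text \<open>The connection is metric because the bracket term is skew by natural reductivity.
  Torsion-freeness amounts to 2 t [X,Y]_m = [X,Y]_m, which both alternatives of the hypothesis
  provide.\<close>

lemma levi_civita:
  assumes t: "t = 1/2 \<or> (\<forall>X\<in>mm M. \<forall>Y\<in>mm M. brm M X Y = 0)"
  shows "is_levi_civita M (nabla M t)"
  unfolding is_levi_civita_def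
proof (intro conjI allI impI)
  let ?L = "\<lambda>X. lderiv (Grp M) X"
  fix X Y W a
  assume "vector_field M X \<and> vector_field M Y \<and> vector_field M W"
  then have m: "\<And>b. X b \<in> mm M" "\<And>b. Y b \<in> mm M" "\<And>b. W b \<in> mm M"
    and s: "smooth_map (Grp M) Y" "smooth_map (Grp M) W" unfolding vector_field_def by auto
  have bb: "bounded_bilinear Q" using Q_form(1) bilinear_conv_bounded_bilinear by blast
  have L: "?L (X a) Y a \<in> mm M" "?L (X a) W a \<in> mm M" using lderiv_in_mm s m by auto
  have b: "brm M (X a) (Y a) \<in> mm M" "brm M (X a) (W a) \<in> mm M" unfolding brm_eq by (rule pm_props)+
  have sc: "t *\<^sub>R brm M (X a) (Y a) \<in> mm M" "t *\<^sub>R brm M (X a) (W a) \<in> mm M"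
    using b reductive(1) by (auto intro: subspace_scale)
  have "vderiv M X (\<lambda>b. ip M (Y b) (W b)) a = ?L (X a) (\<lambda>b. Q (Y b) (W b)) a"
    unfolding vderiv_def by (simp add: Q_m m)
  also have "\<dots> = Q (Y a) (?L (X a) W a) + Q (?L (X a) Y a) (W a)"
    by (rule G.lderiv_bilinear[OF bb open_UNIV _ _ UNIV_I]) (use s in \<open>simp_all add: G.smooth_map_iff\<close>)
  also have "\<dots> = ip M (nabla M t X Y a) (W a) + ip M (Y a) (nabla M t X W a)"
  proof -
    have "ip M (brm M (X a) (Y a)) (W a) + ip M (Y a) (brm M (X a) (W a)) = 0" by (rule nat_reductive) (rule m)+
    then have "Q (brm M (X a) (Y a)) (W a) + Q (Y a) (brm M (X a) (W a)) = 0" by (simp add: Q_m b m)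
    then have "t * Q (brm M (X a) (Y a)) (W a) + t * Q (Y a) (brm M (X a) (W a)) = 0"
      by (simp add: distrib_left[symmetric])
    moreover have "nabla M t X Y a \<in> mm M" "nabla M t X W a \<in> mm M"
      unfolding nabla_def vderiv_def using L sc reductive(1) by (auto intro: subspace_add)
    then have "ip M (nabla M t X Y a) (W a) = Q (nabla M t X Y a) (W a)" "ip M (Y a) (nabla M t X W a) = Q (Y a) (nabla M t X W a)"
      by (simp_all add: Q_m m)
    ultimately show ?thesis by (simp add: nabla_def vderiv_def Qs)
  qed
  finally show "vderiv M X (\<lambda>b. ip M (Y b) (W b)) a = ip M (nabla M t X Y a) (W a) + ip M (Y a) (nabla M t X W a)" .
next
  let ?L = "\<lambda>X. lderiv (Grp M) X"
  fix X Y f a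
  assume "vector_field M X \<and> vector_field M Y \<and> smooth_function M f"
  then have m: "\<And>b. X b \<in> mm M" "\<And>b. Y b \<in> mm M"
    and s: "G.smooth_from UNIV X" "G.smooth_from UNIV Y" "G.smooth_from UNIV f"
    and f: "\<And>b h. h \<in> Sub M \<Longrightarrow> f (b \<otimes>\<^bsub>Grp M\<^esub> h) = f b"
    unfolding vector_field_def smooth_function_def by (auto simp: G.smooth_map_iff)
  let ?x = "X a" and ?y = "Y a"
  have lin: "linear (\<lambda>v. ?L v f a)" by (rule G.lderiv_linear[OF open_UNIV s(3) UNIV_I])
  \<comment> \<open>The h-component of the bracket differentiates a function on M to zero.\<close>
  have h: "?L (br ?x ?y) f a = ?L (brm M ?x ?y) f a"
  proof -
    have "?L (br ?x ?y - pm (br ?x ?y)) f a = 0"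
      by (rule lderiv_hh_invariant[OF _ f pm_props(2)]) (use s(3) in \<open>simp_all add: G.smooth_map_iff\<close>)
    then show ?thesis by (simp add: linear_diff[OF lin] brm_eq)
  qed
  have anti: "brm M ?y ?x = - brm M ?x ?y"
    unfolding brm_eq G.bracket_antisym[of ?y ?x] by (simp add: linear_neg[OF pm_linear])
  have two: "(2 * t) *\<^sub>R brm M ?x ?y = brm M ?x ?y"
    using t
  proof
    assume "t = 1/2"
    then have "2 * t = 1" by simp
    then show ?thesis by (simp only: scaleR_one)
  qed (use m in auto)
  have D: "nabla M t X Y a - nabla M t Y X a = ?L ?x Y a - ?L ?y X a + brm M ?x ?y"
  proof -
    have "nabla M t X Y a - nabla M t Y X a = ?L ?x Y a - ?L ?y X a + (2 * t) *\<^sub>R brm M ?x ?y"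
      unfolding nabla_def vderiv_def anti by (simp add: algebra_simps scaleR_2[symmetric])
    then show ?thesis by (simp only: two)
  qed
  have "vderiv M X (vderiv M Y f) a - vderiv M Y (vderiv M X f) a =
      ?L ?x (?L ?y f) a + ?L (?L ?x Y a) f a - (?L ?y (?L ?x f) a + ?L (?L ?y X a) f a)"
    unfolding vderiv_def[abs_def] lderiv_lderiv_field[OF s(3,2)] lderiv_lderiv_field[OF s(3,1)] ..
  also have "?L ?x (?L ?y f) a = ?L ?y (?L ?x f) a + ?L (brm M ?x ?y) f a"
    using G.lderiv_commutator[OF open_UNIV s(3) UNIV_I, of ?x ?y a] h by simp
  finally show "vderiv M (\<lambda>b. nabla M t X Y b - nabla M t Y X b) f a =
      vderiv M X (vderiv M Y f) a - vderiv M Y (vderiv M X f) a"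
    unfolding vderiv_def[of M "\<lambda>b. nabla M t X Y b - nabla M t Y X b"] D
    by (simp add: linear_add[OF lin] linear_diff[OF lin])
qed

lemma brm_zero_if_basis:
  assumes "\<And>i j. i \<in> Iz \<Longrightarrow> j \<in> Iz \<Longrightarrow> brm M (Zb M i) (Zb M j) = 0" "X \<in> mm M" "Y \<in> mm M"
  shows "brm M X Y = 0"
proof -
  have "brm M X Y = pm (br (\<Sum>i\<in>Iz. Q X (Zb M i) *\<^sub>R Zb M i) (\<Sum>j\<in>Iz. Q Y (Zb M j) *\<^sub>R Zb M j))"
    unfolding brm_eq mm_expand[OF assms(2), symmetric] mm_expand[OF assms(3), symmetric] ..
  also have "\<dots> = 0"
    unfolding brs linear_sum[OF pm_linear] linear_scale[OF pm_linear]
    using assms(1)[unfolded brm_eq] by (auto intro!: sum.neutral)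
  finally show ?thesis .
qed

text \<open>The same contraction with h occurs three times, whence the 3: from the h-component of
  [Z_i,Z_j], from [Z_i,X_a] and from [X_a,Z_i]. Invariance of Q identifies them.\<close>

lemma bracket_square_sum:
  "(\<Sum>a\<in>Ig. \<Sum>b\<in>Ig. Q (br (Eb a) (Eb b)) (br (Fb a) (Fb b))) =
   3 * (\<Sum>i\<in>Iz. \<Sum>j\<in>Iz. \<Sum>a\<in>Ih. Q (Xb M a) (br (Zb M i) (Zb M j)) * Q (Yb M a) (br (Zb M i) (Zb M j)))
   + (\<Sum>i\<in>Iz. \<Sum>j\<in>Iz. \<Sum>k\<in>Iz. (Q (br (Zb M i) (Zb M j)) (Zb M k))\<^sup>2)
   + (\<Sum>a\<in>Ih. \<Sum>b\<in>Ih. Q (br (Xb M a) (Xb M b)) (br (Yb M a) (Yb M b)))"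
proof -
  let ?Z = "Zb M" and ?X = "Xb M" and ?Y = "Yb M"
  let ?q = "\<lambda>i j. \<Sum>a\<in>Ih. Q (?X a) (br (?Z i) (?Z j)) * Q (?Y a) (br (?Z i) (?Z j))"
  let ?N = "\<Sum>a\<in>Ih. \<Sum>b\<in>Ih. Q (br (?X a) (?X b)) (br (?Y a) (?Y b))"
  have mem: "?X a \<in> hh M" "?Y a \<in> hh M" if "a \<in> Ih" for a using dual_bases_mem[OF dual_XY that] by auto
  have ZZ: "Q (br (?Z i) (?Z j)) (br (?Z i) (?Z j)) = (\<Sum>k\<in>Iz. (Q (br (?Z i) (?Z j)) (?Z k))\<^sup>2) + ?q i j" for i j
    by (subst dual_bases_form_left[OF Q_form(1) dual_EF UNIV_I])
       (simp add: sum_Ig Eb_def Fb_def power2_eq_square Q_form(2)[of _ "br (?Z i) (?Z j)"] mult.commute)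
  have XZ: "(\<Sum>a\<in>Ih. Q (br (?X a) (?Z i)) (br (?Y a) (?Z i))) = (\<Sum>j\<in>Iz. ?q i j)" if i: "i \<in> Iz" for i
  proof -
    have "Q (br (?X a) (?Z i)) (br (?Y a) (?Z i)) = (\<Sum>j\<in>Iz. Q (?X a) (br (?Z i) (?Z j)) * Q (?Y a) (br (?Z i) (?Z j)))"
      if a: "a \<in> Ih" for a
    proof -
      have inv: "Q (br A (?Z i)) (?Z j) = Q A (br (?Z i) (?Z j))" for A j
        using Q_br[of "?Z i" A "?Z j"] G.bracket_antisym[of A "?Z i"] by (simp add: Qs)
      have "Q (br (?X a) (?Z i)) (br (?Y a) (?Z i)) = (\<Sum>j\<in>Iz. Q (br (?X a) (?Z i)) (?Z j) * Q (?Z j) (br (?Y a) (?Z i)))"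
        by (rule dual_bases_form_left[OF Q_form(1) dual_Z br_h_m[OF mem(1)[OF a] Z_mem[OF i]]])
      then show ?thesis by (simp add: inv Q_form(2)[of "?Z _"])
    qed
    then have "(\<Sum>a\<in>Ih. Q (br (?X a) (?Z i)) (br (?Y a) (?Z i))) =
        (\<Sum>a\<in>Ih. \<Sum>j\<in>Iz. Q (?X a) (br (?Z i) (?Z j)) * Q (?Y a) (br (?Z i) (?Z j)))" by simp
    then show ?thesis by (subst (asm) sum.swap)
  qed
  have ZX: "Q (br (?Z i) (?X a)) (br (?Z i) (?Y a)) = Q (br (?X a) (?Z i)) (br (?Y a) (?Z i))" for i a
    using G.bracket_antisym[of "?Z i"] by (simp add: Qs)
  have "(\<Sum>a\<in>Ig. \<Sum>b\<in>Ig. Q (br (Eb a) (Eb b)) (br (Fb a) (Fb b))) =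
     (\<Sum>i\<in>Iz. (\<Sum>j\<in>Iz. Q (br (?Z i) (?Z j)) (br (?Z i) (?Z j))) + (\<Sum>a\<in>Ih. Q (br (?Z i) (?X a)) (br (?Z i) (?Y a)))) +
     (\<Sum>a\<in>Ih. (\<Sum>i\<in>Iz. Q (br (?X a) (?Z i)) (br (?Y a) (?Z i))) + (\<Sum>b\<in>Ih. Q (br (?X a) (?X b)) (br (?Y a) (?Y b))))"
    by (simp add: sum_Ig Eb_def Fb_def)
  also have "\<dots> = (\<Sum>i\<in>Iz. \<Sum>j\<in>Iz. \<Sum>k\<in>Iz. (Q (br (?Z i) (?Z j)) (?Z k))\<^sup>2) + (\<Sum>i\<in>Iz. \<Sum>j\<in>Iz. ?q i j)
     + (\<Sum>i\<in>Iz. \<Sum>j\<in>Iz. ?q i j) + (\<Sum>a\<in>Ih. \<Sum>i\<in>Iz. Q (br (?X a) (?Z i)) (br (?Y a) (?Z i))) + ?N"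
  proof -
    have "(\<Sum>i\<in>Iz. \<Sum>a\<in>Ih. Q (br (?X a) (?Z i)) (br (?Y a) (?Z i))) = (\<Sum>i\<in>Iz. \<Sum>j\<in>Iz. ?q i j)"
      by (intro sum.cong refl XZ)
    then show ?thesis by (simp only: sum.distrib ZZ ZX add.assoc)
  qed
  also have "(\<Sum>a\<in>Ih. \<Sum>i\<in>Iz. Q (br (?X a) (?Z i)) (br (?Y a) (?Z i))) = (\<Sum>i\<in>Iz. \<Sum>j\<in>Iz. ?q i j)"
    by (rule trans[OF sum.swap]) (intro sum.cong refl XZ)
  finally show ?thesis by simp
qed

text \<open>Compactness bounds the orbit of each vector in \<open>Basis\<close> and so Ad(G)
  uniformly, which yields an Ad-invariant inner product. Differentiating its invariance makes ad
  skew.\<close>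

lemma invariant_product:
  assumes "compact (UNIV :: 'g set)"
  shows "\<exists>B. quadratic_lie_algebra br Q B"
proof -
  have "\<exists>C. \<forall>a x. norm (Ad (Grp M) a x) \<le> C * norm x"
  proof -
    have "\<exists>K. \<forall>a. norm (Ad (Grp M) a b) \<le> K" for b
    proof -
      have "compact ((\<lambda>a. Ad (Grp M) a b) ` UNIV)"
        by (rule compact_continuous_image[OF G.smooth_from_continuous[OF open_UNIV G.Ad_smooth] assms])
      then show ?thesis using compact_imp_bounded bounded_iff by (metis rangeI)
    qed
    then obtain K where K: "\<And>a b. norm (Ad (Grp M) a b) \<le> K b" by metis
    have "norm (Ad (Grp M) a x) \<le> (\<Sum>b\<in>Basis. K b) * norm x" for a x
    proof -
      have "Ad (Grp M) a x = (\<Sum>b\<in>Basis. (x \<bullet> b) *\<^sub>R Ad (Grp M) a b)"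
        by (subst euclidean_representation[of x, symmetric]) (simp only: linear_sum[OF G.Ad_linear] linear_scale[OF G.Ad_linear])
      also have "norm \<dots> \<le> (\<Sum>b\<in>Basis. K b * norm x)"
      proof (rule sum_norm_le)
        fix b :: 'e assume "b \<in> Basis"
        then have "\<bar>x \<bullet> b\<bar> * norm (Ad (Grp M) a b) \<le> norm x * K b"
          by (intro mult_mono Basis_le_norm K) auto
        then show "norm ((x \<bullet> b) *\<^sub>R Ad (Grp M) a b) \<le> K b * norm x" by (simp add: mult.commute)
      qed
      finally show ?thesis by (simp add: sum_distrib_right)
    qed
    then show ?thesis by blast
  qed
  then obtain C where C: "\<And>a x. norm (Ad (Grp M) a x) \<le> C * norm x" by blast
  have "\<exists>B. bilinear B \<and> (\<forall>x y. B x y = B y x) \<and> (\<forall>x. x \<noteq> 0 \<longrightarrow> B x x > (0::real)) \<and>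
    (\<forall>A\<in>range (Ad (Grp M)). \<forall>x y. B (A x) (A y) = B x y)"
  proof (rule invariant_inner_product[of _ C])
    show "(\<lambda>x. x) \<in> range (Ad (Grp M))" by (rule range_eqI[of _ _ "\<one>\<^bsub>Grp M\<^esub>"]) (simp add: fun_eq_iff)
    show "A \<circ> A' \<in> range (Ad (Grp M))" if "A \<in> range (Ad (Grp M))" "A' \<in> range (Ad (Grp M))" for A A'
    proof -
      from that obtain a b where "A = Ad (Grp M) a" "A' = Ad (Grp M) b" by blast
      then have "A \<circ> A' = Ad (Grp M) (a \<otimes>\<^bsub>Grp M\<^esub> b)" by (simp add: fun_eq_iff G.Ad_mult)
      then show ?thesis by blast
    qed
    show "\<exists>A'\<in>range (Ad (Grp M)). A \<circ> A' = (\<lambda>x. x)" if A: "A \<in> range (Ad (Grp M))" for A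
    proof -
      from A obtain a where "A = Ad (Grp M) a" by blast
      then have "A \<circ> Ad (Grp M) (inv\<^bsub>Grp M\<^esub> a) = (\<lambda>x. x)" by (simp add: fun_eq_iff)
      then show ?thesis by blast
    qed
  qed (use C G.Ad_linear in auto)
  then obtain B where B: "bilinear B" "\<And>x y. B x y = B y x" "\<And>x. x \<noteq> 0 \<Longrightarrow> B x x > (0::real)"
    "\<And>a x y. B (Ad (Grp M) a x) (Ad (Grp M) a y) = B x y" by blast
  have Bbr: "B (br W X) Y = - B X (br W Y)" for W X Y
  proof -
    have bb: "bounded_bilinear B" using B(1) bilinear_conv_bounded_bilinear by blast
    have "lderiv (Grp M) W (\<lambda>b. B (Ad (Grp M) b X) (Ad (Grp M) b Y)) \<one>\<^bsub>Grp M\<^esub> = B X (br W Y) + B (br W X) Y"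
      using G.lderiv_bilinear[OF bb open_UNIV G.Ad_smooth G.Ad_smooth UNIV_I, of W X Y "\<one>\<^bsub>Grp M\<^esub>"]
      by (simp add: G.lderiv_eq bracket_def G.e0_def)
    then show ?thesis by (simp add: B(4))
  qed
  have "quadratic_lie_algebra br Q B"
    by unfold_locales (fact G.bracket_bilinear G.bracket_antisym G.jacobi Q_form Q_br B Bbr)+
  then show ?thesis by blast
qed

end

subsection \<open>Spinors\<close>

lemma scaleR_matrix_vector:
  "(r *\<^sub>R A) *v x = r *\<^sub>R (A *v x)" "A *v (r *\<^sub>R x) = r *\<^sub>R (A *v x)"
  for A :: "complex^'n^'m" and x :: "complex^'n"
  by (simp_all add: matrix_vector_mult_def vec_eq_iff scaleR_sum_right)

context naturally_reductive_spin
begin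

declare One_nat_def [simp del]

definition zc :: "nat \<Rightarrow> 'c" where "zc i = cl M (Zb M i)"
definition act :: "'c \<Rightarrow> complex^'s \<Rightarrow> complex^'s" where "act x v = rep M x *v v"
definition c3 :: "nat \<Rightarrow> nat \<Rightarrow> nat \<Rightarrow> real" where "c3 i j k = Q (br (Zb M i) (Zb M j)) (Zb M k)"

lemma cl_zero [simp]: "cl M 0 = 0"
  using cl_linear(2)[of 0 0] subspace_0[OF reductive(1)] by simp

lemma cl_sum: "(\<And>i. i \<in> A \<Longrightarrow> f i \<in> mm M) \<Longrightarrow> cl M (\<Sum>i\<in>A. f i) = (\<Sum>i\<in>A. cl M (f i))"
proof (induction A rule: infinite_finite_induct)
  case (insert x F)
  then show ?case using cl_linear(1)[of "f x" "sum f F"] subspace_sum[OF reductive(1), of F f] by simp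
qed simp_all

text \<open>\<open>cl\<close> is specified on \<open>mm M\<close> only; composed with
  \<open>pm\<close> it becomes linear on the whole Lie algebra.\<close>

lemma cl_pm_linear: "linear (\<lambda>X. cl M (pm X))"
  by (rule linearI) (simp_all add: linear_add[OF pm_linear] linear_scale[OF pm_linear] cl_linear pm_props)

lemma cl_pm_expand: "cl M (pm X) = (\<Sum>i\<in>Iz. Q X (Zb M i) *\<^sub>R zc i)"
proof -
  have "cl M (Q X (Zb M i) *\<^sub>R Zb M i) = Q X (Zb M i) *\<^sub>R zc i" if "i \<in> Iz" for i
    unfolding zc_def by (rule cl_linear(2)[OF Z_mem[OF that]])
  then show ?thesis
    unfolding pm_expand by (subst cl_sum) (auto intro!: subspace_scale[OF reductive(1)] Z_mem sum.cong)
qed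

lemma cl_expand: "X \<in> mm M \<Longrightarrow> cl M X = (\<Sum>i\<in>Iz. Q X (Zb M i) *\<^sub>R zc i)"
  using cl_pm_expand[of X] by simp

sublocale cm: clifford_module zc Iz act
proof
  show "finite Iz" by simp
  show "zc i * zc j + zc j * zc i = (if i = j then (- 2) *\<^sub>R 1 else 0)" if "i \<in> Iz" "j \<in> Iz" for i j
    unfolding zc_def cl_relations[OF Z_mem[OF that(1)] Z_mem[OF that(2)]] Z_basis(2)[OF that] of_real_def by simp
  show "act (x + y) v = act x v + act y v" for x y v
    unfolding act_def by (simp add: linear_add[OF rep_hom(1)] matrix_vector_mult_add_rdistrib)
  show "act (r *\<^sub>R x) v = r *\<^sub>R act x v" for r x v
    unfolding act_def by (simp add: linear_scale[OF rep_hom(1)] scaleR_matrix_vector)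
  show "act x (v + w) = act x v + act x w" "act x (r *\<^sub>R v) = r *\<^sub>R act x v" for x v w r
    unfolding act_def by (simp_all add: matrix_vector_right_distrib scaleR_matrix_vector)
  show "act (x * y) v = act x (act y v)" for x y v
    unfolding act_def by (simp add: rep_hom(3) matrix_vector_mul_assoc)
  show "act 1 v = v" for v unfolding act_def by (simp add: rep_hom(2))
qed

lemma c3_12: "c3 j i k = - c3 i j k"
  unfolding c3_def using G.bracket_antisym[of "Zb M j"] by (simp add: Qs)

lemma c3_23: "c3 i k j = - c3 i j k"
  unfolding c3_def using Q_br[of "Zb M i" "Zb M k" "Zb M j"] Q_form(2)[of "Zb M k"] by simp

sublocale tf: three_form zc Iz c3
  by unfold_locales (rule c3_12 c3_23)+

lemma ip_brm: "k \<in> Iz \<Longrightarrow> ip M (brm M X Y) (Zb M k) = Q (br X Y) (Zb M k)"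
  unfolding brm_eq by (simp add: Q_m[symmetric] pm_props Z_mem Q_pm)

lemma nabla_spinor_basis:
  assumes "i \<in> Iz"
  shows "nabla_spinor M t (Zb M i) \<psi> a = lderiv (Grp M) (Zb M i) \<psi> a + (t / 4) *\<^sub>R act (tf.t i) (\<psi> a)"
proof -
  have "(\<Sum>j = 1..dim_m M. \<Sum>k = 1..dim_m M. ip M (brm M (Zb M i) (Zb M j)) (Zb M k) *\<^sub>R (cl M (Zb M j) * cl M (Zb M k))) = tf.t i"
    unfolding tf.t_def c3_def zc_def by (intro sum.cong refl) (simp only: ip_brm)
  then show ?thesis unfolding nabla_spinor_def by (simp only: act_def[symmetric] cm.act_simps)
qed

lemma torsion_eq: "torsion M t = ((2 * t - 1) / 6) *\<^sub>R tf.T6"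
proof -
  have "(\<Sum>(i, j, k)\<in>{(i, j, k). 1 \<le> i \<and> i < j \<and> j < k \<and> k \<le> dim_m M}.
        ip M (brm M (Zb M i) (Zb M j)) (Zb M k) *\<^sub>R (cl M (Zb M i) * cl M (Zb M j) * cl M (Zb M k))) =
     (\<Sum>(i, j, k)\<in>{(i, j, k). i \<in> Iz \<and> j \<in> Iz \<and> k \<in> Iz \<and> i < j \<and> j < k}. c3 i j k *\<^sub>R (zc i * zc j * zc k))"
    by (rule sum.cong) (auto simp: ip_brm c3_def zc_def)
  then show ?thesis unfolding torsion_def tf.T6_ordered by simp
qed

lemma act_matrix: "rep M x *v v = act x v"
  unfolding act_def ..

lemma spinor_smooth: "spinor_field M \<psi> \<Longrightarrow> G.smooth_from UNIV \<psi>"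
  unfolding spinor_field_def by (simp add: G.smooth_map_iff)

lemma act_bounded: "bounded_linear (act x)"
  using cm.act_linear linear_conv_bounded_linear by blast

lemma lderiv_act:
  "G.smooth_from UNIV \<psi> \<Longrightarrow> lderiv (Grp M) X (\<lambda>b. act x (\<psi> b)) a = act x (lderiv (Grp M) X \<psi> a)"
  by (rule G.lderiv_linear_comp[OF act_bounded open_UNIV _ UNIV_I])

lemma brm_zero_if_C2_zero:
  assumes "tf.C2 = 0" "X \<in> mm M" "Y \<in> mm M"
  shows "brm M X Y = 0"
proof (rule brm_zero_if_basis[OF _ assms(2,3)])
  fix i j assume ij: "i \<in> Iz" "j \<in> Iz"
  have "(\<Sum>i\<in>Iz. \<Sum>j\<in>Iz. \<Sum>k\<in>Iz. (c3 i j k)\<^sup>2) = 0" using assms(1) unfolding tf.C2_def .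
  then have "\<forall>i\<in>Iz. (\<Sum>j\<in>Iz. \<Sum>k\<in>Iz. (c3 i j k)\<^sup>2) = 0"
    by (subst (asm) sum_nonneg_eq_0_iff) (auto intro!: sum_nonneg)
  then have "(\<Sum>j\<in>Iz. \<Sum>k\<in>Iz. (c3 i j k)\<^sup>2) = 0" using ij by blast
  then have "\<forall>j\<in>Iz. (\<Sum>k\<in>Iz. (c3 i j k)\<^sup>2) = 0"
    by (subst (asm) sum_nonneg_eq_0_iff) (auto intro!: sum_nonneg)
  then have "(\<Sum>k\<in>Iz. (c3 i j k)\<^sup>2) = 0" using ij by blast
  then have "\<forall>k\<in>Iz. (c3 i j k)\<^sup>2 = 0"
    by (subst (asm) sum_nonneg_eq_0_iff) auto
  then show "brm M (Zb M i) (Zb M j) = 0"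
    unfolding brm_eq pm_expand c3_def by (auto intro!: sum.neutral)
qed

lemma parallel_nonzero_t:
  assumes sp: "spinor_field M \<psi>" and a: "\<psi> a \<noteq> 0" and t: "t \<noteq> 0"
    and par: "\<And>i b. i \<in> Iz \<Longrightarrow> nabla_spinor M t (Zb M i) \<psi> b = 0"
    and T: "\<And>b. act tf.T6 (\<psi> b) = 0"
  shows "tf.C2 = 0"
proof -
  have ti: "act tf.T6 (act (tf.t i) (\<psi> a)) = 0" if i: "i \<in> Iz" for i
  proof -
    have "lderiv (Grp M) (Zb M i) \<psi> a = - (t / 4) *\<^sub>R act (tf.t i) (\<psi> a)"
      using par[OF i, of a] unfolding nabla_spinor_basis[OF i] by (simp add: eq_neg_iff_add_eq_0)
    moreover have "act tf.T6 (lderiv (Grp M) (Zb M i) \<psi> a) = 0"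
      using lderiv_act[OF spinor_smooth[OF sp], of "Zb M i" tf.T6 a] by (simp add: T)
    ultimately show ?thesis using t by (simp add: cm.act_simps)
  qed
  let ?S = "\<Sum>i\<in>Iz. tf.t i * tf.t i"
  have TT: "act (tf.T6 * tf.T6) (\<psi> a) = 0" by (simp add: cm.act_simps T)
  have "act ((\<Sum>i\<in>Iz. zc i * (tf.T6 * tf.t i)) + tf.T6 * tf.T6) (\<psi> a) = 0"
    using ti by (simp add: cm.act_simps T)
  then have S: "act ?S (\<psi> a) = 0" unfolding tf.T6_sum cm.act_simps(2) by simp
  have "act (- 9 *\<^sub>R ?S - (12 * tf.C2) *\<^sub>R 1) (\<psi> a) = 0" using TT unfolding tf.T6_square .
  moreover have "act (- 9 *\<^sub>R ?S - (12 * tf.C2) *\<^sub>R 1) (\<psi> a) = - 9 *\<^sub>R act ?S (\<psi> a) - (12 * tf.C2) *\<^sub>R \<psi> a"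
    by (simp only: cm.act_simps)
  ultimately show ?thesis using a S by simp
qed

subsection \<open>Spinors that are constant along the horizontal directions\<close>

text \<open>The derivative along a bracket is a commutator of derivatives, so vanishing along m
  extends to [m,m], hence to g = m + [m,m].\<close>

lemma lderiv_zero:
  assumes sp: "G.smooth_from UNIV \<psi>" and Z: "\<And>i b. i \<in> Iz \<Longrightarrow> lderiv (Grp M) (Zb M i) \<psi> b = (0 :: complex^'s)"
  shows "lderiv (Grp M) X \<psi> a = 0"
proof -
  note lin = G.lderiv_linear[OF open_UNIV sp UNIV_I]
  have m: "lderiv (Grp M) A \<psi> b = 0" if "A \<in> mm M" for A b
    by (subst mm_expand[OF that]) (simp add: linear_sum[OF lin] linear_scale[OF lin] Z)
  obtain A B where X: "X = A + B" "A \<in> mm M" "B \<in> span {br A B |A B. A \<in> mm M \<and> B \<in> mm M}"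
    using generated by blast
  from X(3) have "lderiv (Grp M) B \<psi> a = 0"
  proof (induction rule: span_induct_alt)
    case base
    then show ?case by (rule linear_0[OF lin])
  next
    case (step c x y)
    then obtain A B where x: "x = br A B" "A \<in> mm M" "B \<in> mm M" by blast
    have "lderiv (Grp M) A \<psi> = (\<lambda>_. 0)" "lderiv (Grp M) B \<psi> = (\<lambda>_. 0)" using m x by auto
    then have "lderiv (Grp M) x \<psi> a = 0"
      using G.lderiv_commutator[OF open_UNIV sp UNIV_I, of A B a] by (simp add: x)
    then show ?case using step by (simp add: linear_add[OF lin] linear_scale[OF lin])
  qed
  then show ?thesis using m[OF X(2)] by (simp add: X(1) linear_add[OF lin])
qed

lemma bracket_expand_ad:
  assumes Y: "Y \<in> hh M" and i: "i \<in> Iz"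
  shows "ad_spin M Y * zc i - zc i * ad_spin M Y = cl M (br Y (Zb M i))"
    and "ad_spin M Y = (\<Sum>i\<in>Iz. \<Sum>j\<in>Iz. (Q (br Y (Zb M i)) (Zb M j) / 4) *\<^sub>R (zc i * zc j))"
proof -
  let ?b = "\<lambda>i j. Q (br Y (Zb M i)) (Zb M j)"
  show e: "ad_spin M Y = (\<Sum>i\<in>Iz. \<Sum>j\<in>Iz. (?b i j / 4) *\<^sub>R (zc i * zc j))"
    unfolding ad_spin_def zc_def scaleR_sum_right
    by (intro sum.cong refl) (simp add: Q_m[symmetric] Z_mem br_h_m[OF Y])
  have anti: "?b j i = - ?b i j" for i j using Q_br[of Y "Zb M j" "Zb M i"] Q_form(2)[of "Zb M j"] by simp
  have "ad_spin M Y * zc i - zc i * ad_spin M Y =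
     2 *\<^sub>R ((\<Sum>k\<in>Iz. (?b i k / 4) *\<^sub>R zc k) - (\<Sum>j\<in>Iz. (?b j i / 4) *\<^sub>R zc j))"
    unfolding e using cm.bivector_z[OF i, of "\<lambda>i j. ?b i j / 4"] by (simp only: add_diff_cancel_left')
  also have "(\<Sum>j\<in>Iz. (?b j i / 4) *\<^sub>R zc j) = - (\<Sum>j\<in>Iz. (?b i j / 4) *\<^sub>R zc j)"
    unfolding sum_negf[symmetric] by (intro sum.cong refl) (simp add: anti[of _ i])
  also have "2 *\<^sub>R ((\<Sum>k\<in>Iz. (?b i k / 4) *\<^sub>R zc k) - - (\<Sum>j\<in>Iz. (?b i j / 4) *\<^sub>R zc j)) = (\<Sum>k\<in>Iz. ?b i k *\<^sub>R zc k)"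
    by (simp add: scaleR_2[symmetric] scaleR_sum_right)
  also have "\<dots> = cl M (br Y (Zb M i))" by (rule cl_expand[OF br_h_m[OF Y Z_mem[OF i]], symmetric])
  finally show "ad_spin M Y * zc i - zc i * ad_spin M Y = cl M (br Y (Zb M i))" .
qed

text \<open>Infinitesimal form of \<open>lift_covers\<close>. Once \<open>ad_spin M Y\<close> kills
  psi, it acts on a Clifford product of v with psi through the bracket on v alone.\<close>

lemma ad_spin_cl:
  assumes Y: "Y \<in> hh M" and v: "v \<in> mm M"
  shows "ad_spin M Y * cl M v = cl M v * ad_spin M Y + cl M (br Y v)"
proof -
  have "ad_spin M Y * cl M v - cl M v * ad_spin M Y = (\<Sum>i\<in>Iz. Q v (Zb M i) *\<^sub>R (ad_spin M Y * zc i - zc i * ad_spin M Y))"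
    unfolding cl_expand[OF v] by (simp add: sum_distrib_left sum_distrib_right sum_subtractf scaleR_diff_right)
  also have "\<dots> = (\<Sum>i\<in>Iz. cl M (pm (Q v (Zb M i) *\<^sub>R br Y (Zb M i))))"
    by (intro sum.cong refl) (simp add: bracket_expand_ad(1)[OF Y] linear_scale[OF pm_linear] cl_linear(2) br_h_m[OF Y] Z_mem)
  also have "\<dots> = cl M (pm (br Y v))"
    unfolding linear_sum[OF cl_pm_linear, symmetric] by (subst (2) mm_expand[OF v]) (simp add: brs)
  finally show ?thesis using br_h_m[OF Y v] by (simp add: algebra_simps)
qed

lemma cl_span: "v \<in> mm M \<Longrightarrow> cl M v \<in> span (zc ` Iz)"
  by (simp only: cl_expand) (intro span_sum span_scale span_base imageI)

lemma Spin_parity: "x \<in> Spin M \<Longrightarrow> x \<in> cm.parity_span True"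
proof -
  assume "x \<in> Spin M"
  then obtain vs where vs: "x = prod_list (map (cl M) vs)" "even (length vs)" "\<forall>v\<in>set vs. v \<in> mm M"
    unfolding Spin_def by blast
  have "set (map (cl M) vs) \<subseteq> span (zc ` Iz)" using vs(3) cl_span by auto
  from cm.prod_list_parity[OF this] show ?thesis using vs(1,2) by simp
qed

lemma cl_monomial_eq: "cl_monomial M A = cm.mon A"
  unfolding cl_monomial_def cm.mon_def cm.lmon_def zc_def ..

text \<open>Irreducibility refers to the whole algebra. The monomials span it, so stability under
  the generators is enough.\<close>

lemma complex_subspace_UNIV:
  assumes "vec.subspace W" "\<And>i w. i \<in> Iz \<Longrightarrow> w \<in> W \<Longrightarrow> act (zc i) w \<in> W" "w0 \<in> W" "w0 \<noteq> 0"
  shows "W = UNIV"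
proof -
  have sub: "subspace W"
  proof (rule subspaceI)
    show "0 \<in> W" "x \<in> W \<Longrightarrow> y \<in> W \<Longrightarrow> x + y \<in> W" for x y
      using assms(1) by (auto simp: vec.subspace_def)
    show "r *\<^sub>R x \<in> W" if "x \<in> W" for r x
    proof -
      have "r *\<^sub>R x = complex_of_real r *s x" by (simp add: vec_eq_iff scaleR_conv_of_real[where 'a = complex])
      then show ?thesis using assms(1) that by (simp add: vec.subspace_def)
    qed
  qed
  have lmon: "act (cm.lmon L) w \<in> W" if "set L \<subseteq> Iz" "w \<in> W" for L w
    using that by (induction L arbitrary: w) (auto simp: cm.act_simps assms(2))
  have "act x w \<in> W" if w: "w \<in> W" for x w
  proof -
    have "x \<in> span (cl_monomial M ` Pow Iz)" using cl_basis(3) by auto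
    then show ?thesis
    proof (induction rule: span_induct_alt)
      case base
      then show ?case using subspace_0[OF sub] by (simp add: cm.act_simps)
    next
      case (step c x y)
      then obtain A where A: "A \<subseteq> Iz" "x = cm.mon A" by (auto simp: cl_monomial_eq)
      have "set (sorted_list_of_set A) \<subseteq> Iz" using A(1) finite_subset[OF A(1)] by simp
      then have "act x w \<in> W" unfolding A(2) cm.mon_def using lmon w by blast
      then show ?case using step sub by (simp add: cm.act_simps subspace_add subspace_scale)
    qed
  qed
  then have "W = {0} \<or> W = UNIV" using rep_irreducible[OF assms(1)] by (simp add: act_def)
  then show ?thesis using assms(3,4) by auto
qed

text \<open>The lift of a one-parameter subgroup of \<open>H\<close> fixes the spinor; irreducibility turns this into
  strong convergence of its action to the identity.\<close>

lemma ad_spin_annihilates: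
  assumes sp: "spinor_field M \<psi>" and L: "\<And>X b. lderiv (Grp M) X \<psi> b = 0" and Y: "Y \<in> hh M"
  shows "act (ad_spin M Y) (\<psi> a) = 0"
proof (cases "\<psi> a = 0")
  case True
  then show ?thesis by (simp add: cm.act_simps)
next
  case False
  obtain \<gamma> :: "real \<Rightarrow> 'g" where g: "continuous_on UNIV \<gamma>" "\<And>s u. \<gamma> (s + u) = \<gamma> s \<otimes>\<^bsub>Grp M\<^esub> \<gamma> u"
    "\<And>s. \<gamma> s \<in> Sub M" "((\<lambda>s. coord (Grp M) (\<gamma> s)) has_vector_derivative Y) (at 0)" "\<gamma> 0 = \<one>\<^bsub>Grp M\<^esub>"
    by (rule hhE[OF Y]) (rule that; assumption)
  note sm = spinor_smooth[OF sp]
  \<comment> \<open>\<open>G.curve_derivative\<close> differentiates at parameter 0 only; the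
    homomorphism property of the curve moves this to an arbitrary s0.\<close>
  have const: "\<psi> (a \<otimes>\<^bsub>Grp M\<^esub> \<gamma> s) = \<psi> a" for s
  proof -
    have "((\<lambda>s. \<psi> (a \<otimes>\<^bsub>Grp M\<^esub> \<gamma> s)) has_vector_derivative 0) (at s0)" for s0
    proof -
      have "((\<lambda>s. \<psi> (a \<otimes>\<^bsub>Grp M\<^esub> \<gamma> s0 \<otimes>\<^bsub>Grp M\<^esub> \<gamma> s)) has_vector_derivative 0) (at (s0 + - s0))"
        using G.curve_derivative[OF g(1,5,4) open_UNIV sm UNIV_I, of "a \<otimes>\<^bsub>Grp M\<^esub> \<gamma> s0"] by (simp add: L)
      moreover have "((\<lambda>s. s + - s0) has_vector_derivative 1) (at s0)"
        by (auto intro!: derivative_eq_intros)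
      ultimately have "((\<lambda>s. \<psi> (a \<otimes>\<^bsub>Grp M\<^esub> \<gamma> s0 \<otimes>\<^bsub>Grp M\<^esub> \<gamma> (s + - s0))) has_vector_derivative 0) (at s0)"
        using vector_diff_chain_at[of "\<lambda>s. s + - s0" 1 s0 "\<lambda>s. \<psi> (a \<otimes>\<^bsub>Grp M\<^esub> \<gamma> s0 \<otimes>\<^bsub>Grp M\<^esub> \<gamma> s)" 0] by (simp add: o_def)
      moreover have "a \<otimes>\<^bsub>Grp M\<^esub> \<gamma> s0 \<otimes>\<^bsub>Grp M\<^esub> \<gamma> (s + - s0) = a \<otimes>\<^bsub>Grp M\<^esub> \<gamma> s" for s
        using g(2)[of s0 "s + - s0"] by (simp add: G.m_assoc)
      ultimately show ?thesis by simp
    qed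
    then have "\<exists>k. \<forall>s\<in>UNIV. \<psi> (a \<otimes>\<^bsub>Grp M\<^esub> \<gamma> s) = k"
      using has_vector_derivative_zero_constant[of UNIV "\<lambda>s. \<psi> (a \<otimes>\<^bsub>Grp M\<^esub> \<gamma> s)"] by (metis convex_UNIV)
    then show ?thesis using g(5) by (metis G.in_carrier G.r_one UNIV_I)
  qed
  define x where "x s = lift M (\<gamma> s)" for s
  have inv: "inv\<^bsub>Grp M\<^esub> (\<gamma> s) = \<gamma> (- s)" for s
    using g(2)[of "- s" s] g(5) by (intro G.inv_equality) auto
  have fixed: "act (x s) (\<psi> a) = \<psi> a" for s
  proof -
    have "\<psi> (a \<otimes>\<^bsub>Grp M\<^esub> \<gamma> (- s)) = rep M (lift M (inv\<^bsub>Grp M\<^esub> (\<gamma> (- s)))) *v \<psi> a"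
      using sp g(3) unfolding spinor_field_def by blast
    then show ?thesis unfolding inv const by (simp add: x_def act_def)
  qed
  have even: "x s \<in> cm.parity_span True" for s
    unfolding x_def by (rule Spin_parity[OF lift_Spin[OF g(3)]])
  \<comment> \<open>Matrix entries of Ad along the curve in the basis Z. They are differentiable at
    0, and \<open>lift_covers\<close> turns this into first order information on the commutators of
    x s with the generators.\<close>
  define r where "r i k s = Q (Ad (Grp M) (\<gamma> s) (Zb M i)) (Zb M k)" for i k s
  have r0: "r i k 0 = Q (Zb M i) (Zb M k)" for i k unfolding r_def g(5) by simp
  have dr: "(r i k has_real_derivative Q (br Y (Zb M i)) (Zb M k)) (at 0)" for i k
  proof -
    have "bounded_linear (\<lambda>X. Q X (Zb M k))"
      using Q_form(1) linear_conv_bounded_linear by (auto simp: bilinear_def)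
    from bounded_linear.has_vector_derivative[OF this curve_Ad[OF g(1,4,5)], of "Zb M i"]
    show ?thesis unfolding r_def[abs_def] has_real_derivative_iff_has_vector_derivative .
  qed
  have rc: "(r i k \<longlongrightarrow> Q (Zb M i) (Zb M k)) (at 0)" for i k
    using DERIV_isCont[OF dr] unfolding isCont_def r0 .
  have rq: "((\<lambda>s. (r i k s - Q (Zb M i) (Zb M k)) / s) \<longlongrightarrow> Q (br Y (Zb M i)) (Zb M k)) (at 0)" for i k
    using dr[of i k] unfolding DERIV_def r0 by simp
  have conj: "act (x s) (act (zc i) w) = (\<Sum>k\<in>Iz. r i k s *\<^sub>R act (zc k) (act (x s) w))" if i: "i \<in> Iz" for i s w
  proof -
    have "x s * zc i = cl M (Ad (Grp M) (\<gamma> s) (Zb M i)) * x s"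
      unfolding x_def zc_def by (rule lift_covers[OF g(3) Z_mem[OF i]])
    also have "\<dots> = (\<Sum>k\<in>Iz. r i k s *\<^sub>R (zc k * x s))"
      unfolding cl_expand[OF reductive(4)[OF g(3) Z_mem[OF i]]] r_def by (simp add: sum_distrib_right)
    finally show ?thesis unfolding cm.act_mult[symmetric] by (simp add: cm.act_simps)
  qed
  have zsum: "(\<Sum>k\<in>Iz. Q (Zb M i) (Zb M k) *\<^sub>R act (zc k) w) = act (zc i) w" if "i \<in> Iz" for i w
    using cl_expand[OF Z_mem[OF that]] unfolding zc_def[symmetric] by (simp add: cm.act_simps)
  have lim: "((\<lambda>s. act (x s) w) \<longlongrightarrow> w) (at 0)" for w
  proof -
    \<comment> \<open>W contains psi a by \<open>fixed\<close> and is stable under the generators by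
      \<open>conj\<close>.\<close>
    define W where "W = {w. ((\<lambda>s. act (x s) w) \<longlongrightarrow> w) (at 0)}"
    have "W = UNIV"
    proof (rule complex_subspace_UNIV)
      show "vec.subspace W"
        unfolding vec.subspace_def
      proof (intro conjI ballI allI)
        show "0 \<in> W" unfolding W_def by (simp add: cm.act_simps)
        show "u + v \<in> W" if "u \<in> W" "v \<in> W" for u v
          using that unfolding W_def by (auto simp: cm.act_simps intro: tendsto_add)
        show "c *s v \<in> W" if "v \<in> W" for c v
        proof -
          have "act (x s) (c *s v) = c *s act (x s) v" for s
            unfolding act_def by (simp add: vector_scalar_commute)
          moreover have "((\<lambda>s. c *s act (x s) v) \<longlongrightarrow> c *s v) (at 0)"
            using that unfolding W_def vector_scalar_mult_def
            by (auto intro!: tendsto_vec_lambda tendsto_mult tendsto_vec_nth)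
          ultimately show ?thesis unfolding W_def by simp
        qed
      qed
      show "act (zc i) w \<in> W" if "i \<in> Iz" "w \<in> W" for i w
      proof -
        have "((\<lambda>s. \<Sum>k\<in>Iz. r i k s *\<^sub>R act (zc k) (act (x s) w)) \<longlongrightarrow> (\<Sum>k\<in>Iz. Q (Zb M i) (Zb M k) *\<^sub>R act (zc k) w)) (at 0)"
          by (intro tendsto_sum tendsto_scaleR rc cm.act_tendsto) (use that(2) in \<open>simp add: W_def\<close>)
        then show ?thesis unfolding W_def by (simp add: conj[OF that(1)] zsum[OF that(1)])
      qed
      show "\<psi> a \<in> W" unfolding W_def by (simp add: fixed)
      show "\<psi> a \<noteq> 0" by (rule False)
    qed
    then show ?thesis unfolding W_def by blast
  qed
  let ?b = "\<lambda>i j. Q (br Y (Zb M i)) (Zb M j) / 4"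
  have "act (\<Sum>i\<in>Iz. \<Sum>j\<in>Iz. ?b i j *\<^sub>R (zc i * zc j)) (\<psi> a) = 0"
  proof (rule cm.bivector_annihilates_fixed[OF even fixed])
    show "?b i i = 0" for i
      using Q_br[of Y "Zb M i" "Zb M i"] Q_form(2)[of "Zb M i"] by simp
    show "((\<lambda>s. (1 / s) *\<^sub>R (act (x s) (act (zc j) w) - act (zc j) (act (x s) w))) \<longlongrightarrow>
      act ((\<Sum>i\<in>Iz. \<Sum>j\<in>Iz. ?b i j *\<^sub>R (zc i * zc j)) * zc j - zc j * (\<Sum>i\<in>Iz. \<Sum>j\<in>Iz. ?b i j *\<^sub>R (zc i * zc j))) w) (at 0)"
      if j: "j \<in> Iz" for j w
    proof -
      have "((\<lambda>s. \<Sum>k\<in>Iz. ((r j k s - Q (Zb M j) (Zb M k)) / s) *\<^sub>R act (zc k) (act (x s) w)) \<longlongrightarrow>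
         (\<Sum>k\<in>Iz. Q (br Y (Zb M j)) (Zb M k) *\<^sub>R act (zc k) w)) (at 0)"
        by (intro tendsto_sum tendsto_scaleR rq cm.act_tendsto lim)
      moreover have "(\<Sum>k\<in>Iz. ((r j k s - Q (Zb M j) (Zb M k)) / s) *\<^sub>R act (zc k) (act (x s) w)) =
         (1 / s) *\<^sub>R (act (x s) (act (zc j) w) - act (zc j) (act (x s) w))" for s
      proof -
        have "act (x s) (act (zc j) w) - act (zc j) (act (x s) w) =
           (\<Sum>k\<in>Iz. (r j k s - Q (Zb M j) (Zb M k)) *\<^sub>R act (zc k) (act (x s) w))"
          unfolding scaleR_diff_left sum_subtractf zsum[OF j] conj[OF j] ..
        then show ?thesis by (simp add: scaleR_sum_right)
      qed
      moreover have "(\<Sum>k\<in>Iz. Q (br Y (Zb M j)) (Zb M k) *\<^sub>R act (zc k) w) = act (cl M (br Y (Zb M j))) w"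
        unfolding cl_expand[OF br_h_m[OF Y Z_mem[OF j]]] by (simp only: cm.act_simps)
      ultimately show ?thesis
        unfolding bracket_expand_ad(2)[OF Y j, symmetric] bracket_expand_ad(1)[OF Y j] by simp
    qed
  qed
  moreover have "ad_spin M Y = (\<Sum>i\<in>Iz. \<Sum>j\<in>Iz. ?b i j *\<^sub>R (zc i * zc j))"
    unfolding ad_spin_def zc_def scaleR_sum_right
    by (intro sum.cong refl) (simp add: Q_m[symmetric] Z_mem br_h_m[OF Y])
  ultimately show ?thesis by simp
qed

text \<open>The factor 16 clears the two quarters in \<open>ad_spin\<close>. Up to sign the Casimir
  element then is the contraction of the h-part of Q([Z_i,Z_j],[Z_k,Z_l]); the squares of the t m
  supply the m-part, and for the full tensor the Jacobi identity gives Bianchi.\<close>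

lemma casimir_square_sum:
  "- 16 *\<^sub>R casimir_h M + (\<Sum>m\<in>Iz. tf.t m * tf.t m) =
   (- 2 * ((\<Sum>i\<in>Iz. \<Sum>j\<in>Iz. \<Sum>a\<in>Ih. Q (Xb M a) (br (Zb M i) (Zb M j)) * Q (Yb M a) (br (Zb M i) (Zb M j))) + tf.C2)) *\<^sub>R 1"
proof -
  let ?Z = "Zb M"
  let ?B = "\<lambda>i j. br (?Z i) (?Z j)"
  define q where "q i j k l = (\<Sum>a\<in>Ih. Q (Xb M a) (?B i j) * Q (Yb M a) (?B k l))" for i j k l
  have mem: "Xb M a \<in> hh M" "Yb M a \<in> hh M" if "a \<in> Ih" for a using dual_bases_mem[OF dual_XY that] by auto
  have inv: "Q (br Y (?Z i)) (?Z j) = Q Y (?B i j)" for Y i j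
    using Q_br[of "?Z i" Y "?Z j"] G.bracket_antisym[of Y "?Z i"] by (simp add: Qs)
  have ad: "ad_spin M Y = (1/4) *\<^sub>R (\<Sum>i\<in>Iz. \<Sum>j\<in>Iz. Q Y (?B i j) *\<^sub>R (zc i * zc j))" if "Y \<in> hh M" for Y
    unfolding ad_spin_def zc_def
    by (intro arg_cong[where f = "(*\<^sub>R) (1/4)"] sum.cong refl) (simp add: Q_m[symmetric] Z_mem br_h_m[OF that] inv)
  have ad2: "ad_spin M (Xb M a) * ad_spin M (Yb M a) = (1/16) *\<^sub>R (\<Sum>i\<in>Iz. \<Sum>j\<in>Iz. \<Sum>k\<in>Iz. \<Sum>l\<in>Iz.
      (Q (Xb M a) (?B i j) * Q (Yb M a) (?B k l)) *\<^sub>R (zc i * zc j * zc k * zc l))" if a: "a \<in> Ih" for a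
  proof -
    have "ad_spin M (Xb M a) * ad_spin M (Yb M a) = (1/16) *\<^sub>R
       ((\<Sum>i\<in>Iz. \<Sum>j\<in>Iz. Q (Xb M a) (?B i j) *\<^sub>R (zc i * zc j)) * (\<Sum>k\<in>Iz. \<Sum>l\<in>Iz. Q (Yb M a) (?B k l) *\<^sub>R (zc k * zc l)))"
      unfolding ad[OF mem(1)[OF a]] ad[OF mem(2)[OF a]] by simp
    also have "(\<Sum>i\<in>Iz. \<Sum>j\<in>Iz. Q (Xb M a) (?B i j) *\<^sub>R (zc i * zc j)) * (\<Sum>k\<in>Iz. \<Sum>l\<in>Iz. Q (Yb M a) (?B k l) *\<^sub>R (zc k * zc l)) =
       (\<Sum>i\<in>Iz. \<Sum>j\<in>Iz. \<Sum>k\<in>Iz. \<Sum>l\<in>Iz. (Q (Xb M a) (?B i j) * Q (Yb M a) (?B k l)) *\<^sub>R (zc i * zc j * zc k * zc l))"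
      unfolding sum_distrib_right unfolding sum_distrib_left
      by (intro sum.cong refl) (simp add: mult.assoc mult.commute[of "Q (Yb M a) _"])
    finally show ?thesis .
  qed
  have sw: "(\<Sum>a\<in>Ih. \<Sum>i\<in>Iz. \<Sum>j\<in>Iz. \<Sum>k\<in>Iz. \<Sum>l\<in>Iz. F a i j k l) = (\<Sum>i\<in>Iz. \<Sum>j\<in>Iz. \<Sum>k\<in>Iz. \<Sum>l\<in>Iz. \<Sum>a\<in>Ih. F a i j k l)"
    for F :: "nat \<Rightarrow> nat \<Rightarrow> nat \<Rightarrow> nat \<Rightarrow> nat \<Rightarrow> 'c"
  proof -
    have "(\<Sum>a\<in>Ih. \<Sum>i\<in>Iz. \<Sum>j\<in>Iz. \<Sum>k\<in>Iz. \<Sum>l\<in>Iz. F a i j k l) = (\<Sum>i\<in>Iz. \<Sum>a\<in>Ih. \<Sum>j\<in>Iz. \<Sum>k\<in>Iz. \<Sum>l\<in>Iz. F a i j k l)"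
      by (rule sum.swap)
    also have "\<dots> = (\<Sum>i\<in>Iz. \<Sum>j\<in>Iz. \<Sum>a\<in>Ih. \<Sum>k\<in>Iz. \<Sum>l\<in>Iz. F a i j k l)" by (intro sum.cong refl sum.swap)
    also have "\<dots> = (\<Sum>i\<in>Iz. \<Sum>j\<in>Iz. \<Sum>k\<in>Iz. \<Sum>a\<in>Ih. \<Sum>l\<in>Iz. F a i j k l)" by (intro sum.cong refl sum.swap)
    also have "\<dots> = (\<Sum>i\<in>Iz. \<Sum>j\<in>Iz. \<Sum>k\<in>Iz. \<Sum>l\<in>Iz. \<Sum>a\<in>Ih. F a i j k l)" by (intro sum.cong refl sum.swap)
    finally show ?thesis .
  qed
  have cas: "- 16 *\<^sub>R casimir_h M = (\<Sum>i\<in>Iz. \<Sum>j\<in>Iz. \<Sum>k\<in>Iz. \<Sum>l\<in>Iz. q i j k l *\<^sub>R (zc i * zc j * zc k * zc l))"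
  proof -
    have "- 16 *\<^sub>R casimir_h M = (\<Sum>a\<in>Ih. 16 *\<^sub>R (ad_spin M (Xb M a) * ad_spin M (Yb M a)))"
      unfolding casimir_h_def by (simp add: scaleR_sum_right sum_negf)
    also have "\<dots> = (\<Sum>a\<in>Ih. \<Sum>i\<in>Iz. \<Sum>j\<in>Iz. \<Sum>k\<in>Iz. \<Sum>l\<in>Iz.
      (Q (Xb M a) (?B i j) * Q (Yb M a) (?B k l)) *\<^sub>R (zc i * zc j * zc k * zc l))"
      by (intro sum.cong refl) (simp add: ad2)
    finally show ?thesis unfolding sw q_def scaleR_sum_left .
  qed
  have R: "q i j k l + (\<Sum>m\<in>Iz. c3 i j m * c3 k l m) = Q (?B i j) (?B k l)" for i j k l
    by (subst dual_bases_form_left[OF Q_form(1) dual_bases_sym[OF Q_form(2) dual_EF] UNIV_I, of "?B i j"])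
       (simp add: sum_Ig Eb_def Fb_def q_def c3_def Q_form(2)[of "?Z _" "br _ _"] Q_form(2)[of "br _ _" "Xb M _"])
  show ?thesis
    unfolding cas q_def[symmetric]
  proof (rule tf.curvature_t_square_sum, unfold R)
    fix i j k l
    show "Q (?B j i) (?B k l) = - Q (?B i j) (?B k l)" using G.bracket_antisym[of "?Z j"] by (simp add: Qs)
    show "Q (?B i j) (?B l k) = - Q (?B i j) (?B k l)" using G.bracket_antisym[of "?Z l"] by (simp add: Qs)
    show "Q (?B k l) (?B i j) = Q (?B i j) (?B k l)" by (rule Q_form(2))
    have "Q (?B i a) W = - Q (?Z i) (br W (?Z a)) " for a W
    proof -
      have "Q (?B i a) W = - Q (br (?Z a) (?Z i)) W" using G.bracket_antisym[of "?Z i"] by (simp add: Qs)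
      also have "\<dots> = Q (?Z i) (br (?Z a) W)" by (simp add: Q_br)
      finally show ?thesis using G.bracket_antisym[of "?Z a" W] by (simp add: Qs)
    qed
    then have "Q (?B i j) (?B k l) + Q (?B i k) (?B l j) + Q (?B i l) (?B j k) =
       - Q (?Z i) (br (?B k l) (?Z j) + br (?B l j) (?Z k) + br (?B j k) (?Z l))"
      by (simp add: Qs)
    also have "br (?B k l) (?Z j) + br (?B l j) (?Z k) + br (?B j k) (?Z l) = 0"
      using G.jacobi[of "?Z j" "?Z k" "?Z l"] G.bracket_antisym[of "?B k l" "?Z j"]
        G.bracket_antisym[of "?B l j" "?Z k"] G.bracket_antisym[of "?Z l" "?Z j"] by (simp add: brs)
    finally show "Q (?B i j) (?B k l) + Q (?B i k) (?B l j) + Q (?B i l) (?B j k) = 0" by (simp add: Qs)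
  qed
qed

text \<open>A negative eigenvector \<open>W\<close> of the Casimir operator gives the negative eigensection
  \<open>(Ad(b\<^sup>-\<^sup>1) W)\<^sub>m \<psi>\<close> of \<open>Omega\<close>.\<close>

lemma casimir_no_negative_eigenvector:
  assumes nonneg: "Omega_nonneg M" and qla: "quadratic_lie_algebra br Q B"
    and sp: "spinor_field M \<psi>" and a: "\<psi> a \<noteq> 0" and L: "\<And>X b. lderiv (Grp M) X \<psi> b = 0"
    and W: "W \<in> quadratic_lie_algebra.derived br" "\<mu> < 0" "quadratic_lie_algebra.casimir br Ig Eb Fb W = \<mu> *\<^sub>R W"
  shows "W = 0"
proof -
  interpret q: quadratic_lie_algebra br Q B by (rule qla)
  \<comment> \<open>The m-component of F is the Killing vector field generated by W, written as an
    equivariant function on G.\<close>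
  define F where "F b = Ad (Grp M) (inv\<^bsub>Grp M\<^esub> b) W" for b
  have Fs: "G.smooth_from UNIV F" unfolding F_def by (rule G.smooth_from_inv[OF G.Ad_smooth])
  have dF: "lderiv (Grp M) Z F b = - br Z (F b)" for Z b unfolding F_def by (rule G.lderiv_Ad_inv)
  \<comment> \<open>The Casimir operator commutes with Ad: by invariance of Q the image of a pair of
    dual bases is again dual.\<close>
  have EF: "q.casimir Ig Eb Fb (F b) = \<mu> *\<^sub>R F b" for b
  proof -
    let ?A = "Ad (Grp M) (inv\<^bsub>Grp M\<^esub> b)"
    have img: "span ((\<lambda>i. ?A (e i)) ` Ig) = UNIV" if "span (e ` Ig) = UNIV" for e
    proof -
      have "span (?A ` e ` Ig) = ?A ` UNIV" using linear_span_image[OF G.Ad_linear, of _ "e ` Ig"] that by simp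
      moreover have "?A ` UNIV = UNIV" using G.Ad_inv(1)[of b] by (metis surjI)
      ultimately show ?thesis by (simp add: image_image)
    qed
    have dA: "dual_bases Q Ig (\<lambda>i. ?A (Eb i)) (\<lambda>i. ?A (Fb i)) UNIV"
      using dual_EF img unfolding dual_bases_def Q_form(4) by blast
    have bil: "bilinear (\<lambda>x y. br x (br y (F b)))"
      unfolding bilinear_def by (auto intro!: linearI simp: brs)
    have "q.casimir Ig Eb Fb (F b) = - (\<Sum>i\<in>Ig. br (?A (Eb i)) (br (?A (Fb i)) (F b)))"
      unfolding q.casimir_def using dual_bases_sum_independent[OF Q_form(1,2) dual_EF dA bil] by simp
    also have "\<dots> = ?A (q.casimir Ig Eb Fb W)"
      unfolding q.casimir_def F_def G.bracket_Ad by (simp add: linear_neg[OF G.Ad_linear] linear_sum[OF G.Ad_linear])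
    finally show ?thesis unfolding W(3) F_def by (simp add: linear_scale[OF G.Ad_linear])
  qed
  define h where "h v w = act (cl M (pm v)) w" for v w
  have hbil: "bilinear h" unfolding bilinear_def h_def
    by (auto intro!: linearI simp: cm.act_simps linear_add[OF cl_pm_linear] linear_scale[OF cl_pm_linear])
  note hs = bilinear_simps[OF hbil]
  have hb: "bounded_bilinear h" using hbil bilinear_conv_bounded_bilinear by blast
  note sm = spinor_smooth[OF sp]
  define \<phi> where "\<phi> b = h (F b) (\<psi> b)" for b
  have "G.smooth_from UNIV \<phi>" unfolding \<phi>_def by (rule G.smooth_from_bilinear[OF hb open_UNIV Fs sm])
  moreover have "\<phi> (b \<otimes>\<^bsub>Grp M\<^esub> g) = rep M (lift M (inv\<^bsub>Grp M\<^esub> g)) *v \<phi> b" if g: "g \<in> Sub M" for b g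
  proof -
    let ?g = "inv\<^bsub>Grp M\<^esub> g"
    have g': "?g \<in> Sub M" using subgroup.m_inv_closed[OF subgroup(1) g] .
    have F': "F (b \<otimes>\<^bsub>Grp M\<^esub> g) = Ad (Grp M) ?g (F b)" unfolding F_def by (simp add: G.inv_mult_group G.Ad_mult)
    have \<psi>': "\<psi> (b \<otimes>\<^bsub>Grp M\<^esub> g) = act (lift M ?g) (\<psi> b)" using sp g unfolding spinor_field_def act_def by blast
    show ?thesis
      unfolding \<phi>_def h_def F' \<psi>' pm_Ad[OF g'] act_matrix cm.act_mult[symmetric] lift_covers[OF g' pm_props(1)] ..
  qed
  ultimately have spf: "spinor_field M \<phi>" unfolding spinor_field_def by (simp add: G.smooth_map_iff)
  have d1: "lderiv (Grp M) Z (\<lambda>b. h (f b) (\<psi> b)) b = h (lderiv (Grp M) Z f b) (\<psi> b)" if "G.smooth_from UNIV f" for f Z b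
    using G.lderiv_bilinear[OF hb open_UNIV that sm UNIV_I] by (simp add: L hs)
  have Om: "Omega M \<phi> b = complex_of_real \<mu> *s \<phi> b" for b
  proof -
    have dd: "lderiv (Grp M) Z (lderiv (Grp M) Z \<phi>) b = h (br Z (br Z (F b))) (\<psi> b)" for Z
    proof -
      have lin: "bounded_linear (\<lambda>v. - br Z v)"
        by (rule linear_conv_bounded_linear[THEN iffD1]) (rule linearI, simp_all add: brs)
      have "lderiv (Grp M) Z \<phi> = (\<lambda>b. h (- br Z (F b)) (\<psi> b))"
        unfolding \<phi>_def[abs_def] d1[OF Fs] dF ..
      then have "lderiv (Grp M) Z (lderiv (Grp M) Z \<phi>) b = h (lderiv (Grp M) Z (\<lambda>b. - br Z (F b)) b) (\<psi> b)"
        using d1[OF G.smooth_from_linear[OF lin open_UNIV Fs]] by simp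
      also have "lderiv (Grp M) Z (\<lambda>b. - br Z (F b)) b = br Z (br Z (F b))"
        unfolding G.lderiv_linear_comp[OF lin open_UNIV Fs UNIV_I] dF by (simp add: brs)
      finally show ?thesis .
    qed
    have adh: "act (ad_spin M Y) (h v (\<psi> b)) = h (br Y v) (\<psi> b)" if Y: "Y \<in> hh M" for Y v
      unfolding h_def cm.act_mult[symmetric] ad_spin_cl[OF Y pm_props(1)] br_hh_pm[OF Y]
      by (simp add: cm.act_simps ad_spin_annihilates[OF sp L Y])
    have mem: "Xb M j \<in> hh M" "Yb M j \<in> hh M" if "j \<in> Ih" for j using dual_bases_mem[OF dual_XY that] by auto
    have "act (casimir_h M) (\<phi> b) = - (\<Sum>j\<in>Ih. act (ad_spin M (Xb M j)) (act (ad_spin M (Yb M j)) (\<phi> b)))"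
      unfolding casimir_h_def by (simp only: cm.act_simps)
    also have "\<dots> = - (\<Sum>j\<in>Ih. h (br (Xb M j) (br (Yb M j) (F b))) (\<psi> b))"
      unfolding \<phi>_def by (intro arg_cong[where f = uminus] sum.cong refl) (simp add: adh mem)
    \<comment> \<open>The second derivatives along m and the Casimir element of h assemble to the
      two parts of the Casimir operator of g, acting on F alone.\<close>
    finally have "Omega M \<phi> b = h (q.casimir Ig Eb Fb (F b)) (\<psi> b)"
      unfolding Omega_def dd act_matrix q.casimir_def sum_Ig Eb_def Fb_def by (simp add: hs)
    also have "\<dots> = \<mu> *\<^sub>R \<phi> b" unfolding EF \<phi>_def by (simp add: hs)
    also have "\<dots> = complex_of_real \<mu> *s \<phi> b" by (simp add: vec_eq_iff scaleR_conv_of_real[where 'a = complex])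
    finally show ?thesis .
  qed
  have \<phi>0: "\<phi> b = 0" for b
  proof -
    have "\<phi> = (\<lambda>_. 0)"
    proof (rule ccontr)
      assume "\<phi> \<noteq> (\<lambda>_. 0)"
      then have "Re (complex_of_real \<mu>) \<ge> 0" using nonneg spf Om unfolding Omega_nonneg_def by blast
      then show False using W(2) by simp
    qed
    then show ?thesis by simp
  qed
  \<comment> \<open>A vector squares to minus its norm in the Clifford algebra, so it can annihilate
    a nonzero spinor only if it is zero.\<close>
  have pF: "pm (F b) = 0" if "\<psi> b \<noteq> 0" for b
  proof -
    let ?v = "pm (F b)"
    have "cl M ?v * cl M ?v + cl M ?v * cl M ?v = (- 2 * ip M ?v ?v) *\<^sub>R 1"
      using cl_relations[OF pm_props(1) pm_props(1), of "F b" "F b"] by (simp add: of_real_def)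
    from arg_cong[OF this, of "\<lambda>x. act x (\<psi> b)"]
    have "(- 2 * ip M ?v ?v) *\<^sub>R \<psi> b = 0"
      using \<phi>0[of b] unfolding \<phi>_def h_def by (simp only: cm.act_simps) simp
    then have "ip M ?v ?v = 0" using that by simp
    then show ?thesis using ip_inner_product(4)[OF pm_props(1)[of "F b"]] by fastforce
  qed
  \<comment> \<open>The m-component of F vanishes near a, so w0 lies in h, and differentiating along
    Z in m puts [Z, w0] in h. It lies in m as well, hence is zero. As m generates g, w0 is central,
    and so is W, which is Ad(a) w0.\<close>
  define w0 where "w0 = F a"
  have w0h: "w0 \<in> hh M" using pm_props(2)[of w0] pF[OF a] by (simp add: w0_def)
  have pmb: "bounded_linear pm" using pm_linear linear_conv_bounded_linear by blast
  have br0: "br Z w0 = 0" if Z: "Z \<in> mm M" for Z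
  proof -
    have U: "open {b. \<psi> b \<noteq> 0}"
      using G.smooth_from_continuous[OF open_UNIV sm] by (intro open_Collect_neq continuous_intros)
    have "lderiv (Grp M) Z (\<lambda>b. pm (F b)) a = lderiv (Grp M) Z (\<lambda>b. 0) a"
      by (rule G.lderiv_cong[OF U]) (use a pF in \<open>auto simp: G.smooth_from_def\<close>)
    then have "pm (- br Z w0) = 0"
      unfolding G.lderiv_linear_comp[OF pmb open_UNIV Fs UNIV_I] dF w0_def by simp
    then show ?thesis using br_m_h[OF Z w0h] by (simp add: linear_neg[OF pm_linear])
  qed
  have central0: "br w0 Y = 0" for Y
  proof -
    have br0': "br w0 Z = 0" if "Z \<in> mm M" for Z using br0[OF that] G.bracket_antisym[of w0 Z] by simp
    obtain A C where Y: "Y = A + C" "A \<in> mm M" "C \<in> span {br A B |A B. A \<in> mm M \<and> B \<in> mm M}"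
      using generated by blast
    from Y(3) have "br w0 C = 0"
    proof (induction rule: span_induct_alt)
      case (step c x y)
      then obtain A B where x: "x = br A B" "A \<in> mm M" "B \<in> mm M" by blast
      have "br w0 x = 0" using G.jacobi[of w0 A B] by (simp add: br0' x brs)
      then show ?case using step by (simp add: brs)
    qed (simp add: brs)
    then show ?thesis using br0'[OF Y(2)] by (simp add: Y(1) brs)
  qed
  have "q.central W"
    unfolding q.central_def
  proof
    fix Y
    have "br W Y = br (Ad (Grp M) a w0) (Ad (Grp M) a (Ad (Grp M) (inv\<^bsub>Grp M\<^esub> a) Y))"
      unfolding w0_def F_def by simp
    also have "\<dots> = 0" unfolding G.bracket_Ad central0 by (rule linear_0[OF G.Ad_linear])
    finally show "br W Y = 0" .
  qed
  then show ?thesis using q.central_derived_0 W(1) by blast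
qed

lemma parallel_zero_t:
  assumes comp: "compact (UNIV :: 'g set)" and nonneg: "Omega_nonneg M"
    and sp: "spinor_field M \<psi>" and a: "\<psi> a \<noteq> 0"
    and par: "\<And>i b. i \<in> Iz \<Longrightarrow> lderiv (Grp M) (Zb M i) \<psi> b = 0"
    and T: "\<And>b. act tf.T6 (\<psi> b) = 0"
  shows "X \<in> mm M \<Longrightarrow> Y \<in> mm M \<Longrightarrow> brm M X Y = 0"
proof -
  note L = lderiv_zero[OF spinor_smooth[OF sp] par]
  let ?S = "\<Sum>i\<in>Iz. tf.t i * tf.t i"
  let ?q = "\<Sum>i\<in>Iz. \<Sum>j\<in>Iz. \<Sum>a\<in>Ih. Q (Xb M a) (br (Zb M i) (Zb M j)) * Q (Yb M a) (br (Zb M i) (Zb M j))"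
  have mem: "Yb M j \<in> hh M" if "j \<in> Ih" for j using dual_bases_mem[OF dual_XY that] by auto
  have "act (casimir_h M) (\<psi> a) = - (\<Sum>j\<in>Ih. act (ad_spin M (Xb M j)) (act (ad_spin M (Yb M j)) (\<psi> a)))"
    unfolding casimir_h_def by (simp only: cm.act_simps)
  also have "\<dots> = 0" using ad_spin_annihilates[OF sp L mem] by (simp add: cm.act_simps)
  finally have c0: "act (casimir_h M) (\<psi> a) = 0" .
  have "act (- 16 *\<^sub>R casimir_h M + ?S) (\<psi> a) = (- 2 * (?q + tf.C2)) *\<^sub>R \<psi> a"
    unfolding casimir_square_sum by (simp only: cm.act_simps)
  then have S1: "act ?S (\<psi> a) = (- 2 * (?q + tf.C2)) *\<^sub>R \<psi> a"
    by (simp only: cm.act_simps(1,2) c0) simp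
  have "act (tf.T6 * tf.T6) (\<psi> a) = 0" by (simp add: cm.act_simps T)
  then have "- 9 *\<^sub>R act ?S (\<psi> a) - (12 * tf.C2) *\<^sub>R \<psi> a = 0"
    unfolding tf.T6_square by (simp only: cm.act_simps)
  then have "(- 9 * (- 2 * (?q + tf.C2)) - 12 * tf.C2) *\<^sub>R \<psi> a = 0"
    unfolding S1 scaleR_scaleR scaleR_diff_left .
  \<comment> \<open>The preceding line reads 18 q + 6 C2 = 0. By \<open>bracket_square_sum\<close>
    the quantity 3 q + C2 is the excess of the sum of squared brackets for g over that for
    h.\<close>
  then have eq0: "3 * ?q + tf.C2 = 0" using a by simp
  obtain B where qla: "quadratic_lie_algebra br Q B" using invariant_product[OF comp] by blast
  interpret q: quadratic_lie_algebra br Q B by (rule qla)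
  have "q.derived \<subseteq> hh M"
  proof (rule q.derived_subset_subalgebra[OF dual_EF dual_XY br_h_h])
    show "Q x x > 0" if "x \<in> q.derived" "x \<noteq> 0" for x
      by (rule q.Q_positive_on_derived[OF dual_EF _ that])
         (rule casimir_no_negative_eigenvector[OF nonneg qla sp a L])
    show "(\<Sum>a\<in>Ig. \<Sum>b\<in>Ig. Q (br (Eb a) (Eb b)) (br (Fb a) (Fb b))) =
        (\<Sum>a\<in>Ih. \<Sum>b\<in>Ih. Q (br (Xb M a) (Xb M b)) (br (Yb M a) (Yb M b)))"
      using eq0 unfolding bracket_square_sum tf.C2_def c3_def by simp
  qed
  then show "brm M X Y = 0" unfolding brm_eq by (intro pm_hh) (use q.br_in_derived in blast)
qed

lemma no_parallel_spinor:
  assumes comp: "compact (UNIV :: 'g set)" and nonneg: "Omega_nonneg M"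
    and nlc: "\<not> is_levi_civita M (nabla M t)"
    and sp: "spinor_field M \<psi>" "\<psi> \<noteq> (\<lambda>_. 0)"
    and par: "\<forall>Z\<in>mm M. \<forall>a. nabla_spinor M t Z \<psi> a = 0"
    and T: "\<forall>a. rep M (torsion M t) *v \<psi> a = 0"
  shows False
proof -
  obtain a where a: "\<psi> a \<noteq> 0" using sp(2) by auto
  have t: "t \<noteq> 1/2" and n0: "\<not> (\<forall>X\<in>mm M. \<forall>Y\<in>mm M. brm M X Y = 0)" using nlc levi_civita by blast+
  have T6: "act tf.T6 (\<psi> b) = 0" for b
  proof -
    have "((2 * t - 1) / 6) *\<^sub>R act tf.T6 (\<psi> b) = 0"
      using T unfolding act_matrix torsion_eq cm.act_scale_left by blast
    then show ?thesis using t by simp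
  qed
  have pZ: "nabla_spinor M t (Zb M i) \<psi> b = 0" if "i \<in> Iz" for i b using par Z_mem[OF that] by blast
  have "\<forall>X\<in>mm M. \<forall>Y\<in>mm M. brm M X Y = 0"
  proof (cases "t = 0")
    case True
    have "lderiv (Grp M) (Zb M i) \<psi> b = 0" if "i \<in> Iz" for i b
      using pZ[OF that, of b] unfolding nabla_spinor_basis[OF that] True by simp
    then show ?thesis using parallel_zero_t[OF comp nonneg sp(1) a _ T6] by blast
  next
    case False
    then show ?thesis using brm_zero_if_C2_zero[OF parallel_nonzero_t[OF sp(1) a False pZ T6]] by blast
  qed
  then show False using n0 by blast
qed

end

theorem theorem4p3:
  fixes M :: "('g::{t2_space,second_countable_topology}, 'e::euclidean_space,
      'c::real_normed_algebra_1, 's::finite) spin_homogeneous"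
    and t :: real
  assumes "naturally_reductive_spin M"
    and "compact (UNIV :: 'g set)"
    and "Omega_nonneg M"
    and "\<not> is_levi_civita M (nabla M t)"
  shows "\<not> (\<exists>\<psi>. spinor_field M \<psi> \<and> \<psi> \<noteq> (\<lambda>_. 0) \<and>
           (\<forall>Z\<in>mm M. \<forall>a. nabla_spinor M t Z \<psi> a = 0) \<and>
           (\<forall>a. rep M (torsion M t) *v \<psi> a = 0))"
  using naturally_reductive_spin.no_parallel_spinor[OF assms] by blast

end
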